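(* Let $n_0$ be an odd integer, and let $h:=\frac{2}{n_0}L_0$ and $e:=Y_{\frac{n_0}{2}}$ in $\mathcal{L}$, so that $[h,e]=e$. Then there exists a structure of noncommutative and noncocommutative Hopf algebra $(U(\mathcal{L})[[t]],m,\iota,\Delta,S,\epsilon)$ on $U(\mathcal{L})[[t]]$ over $\mathbb{F}[[t]]$, with $U(\mathcal{L})[[t]]/tU(\mathcal{L})[[t]]\cong U(\mathcal{L})$, which leaves the product $m$ (with unit $\iota$) and the counit $\epsilon$ of $U(\mathcal{L})[[t]]$ undeformed, and whose comultiplication $\Delta$ and antipode $S$ are given, for all $n,k\in\mathbb{Z}$ and $p\in\frac12+\mathbb{Z}$, by $$\Delta(L_n)=1\otimes L_n+L_n\otimes(1-et)^{\frac{2n}{n_0}}+\frac{n_0-n}{2}h\otimes(1-et)^{-1}Y_{n+\frac{n_0}{2}}t+\frac{n(n-n_0)}{4}h^{(2)}\otimes(1-et)^{-2}M_{n+n_0}t^2,$$ $$\Delta(M_k)=1\otimes M_k+M_k\otimes(1-et)^{\frac{2k}{n_0}},$$ $$\Delta(Y_p)=1\otimes Y_p+Y_p\otimes(1-et)^{\frac{2p}{n_0}}-\left(p-\frac{n_0}{2}\right)h\otimes(1-et)^{-1}M_{p+\frac{n_0}{2}}t,$$ $$S(L_n)=-(1-et)^{-\frac{2n}{n_0}}\Big(L_n+\frac{n-n_0}{2}Y_{n+\frac{n_0}{2}}h^{[1]}_1t+\frac{n(n-n_0)}{4}M_{n+n_0}h^{[2]}_2t^2\Big),$$ $$S(Y_p)=-(1-et)^{-\frac{2p}{n_0}}\Big(Y_p+\left(p-\frac{n_0}{2}\right)M_{p+\frac{n_0}{2}}h^{[1]}_1t\Big),$$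 $$S(M_k)=-(1-et)^{-\frac{2k}{n_0}}M_k.$$
   Context: $\mathbb{F}$ is a field of characteristic zero. The Schrödinger-Virasoro Lie algebra $\mathcal{L}$ is the Lie algebra over $\mathbb{F}$ with basis $\{L_n,Y_p,M_n : n\in\mathbb{Z},\ p\in\frac12+\mathbb{Z}\}$ and nonvanishing brackets (all brackets of basis elements not determined by these and antisymmetry are zero) $$[L_m,L_n]=(n-m)L_{n+m},\quad [L_m,M_n]=nM_{n+m},\quad [L_n,Y_p]=\left(p-\tfrac n2\right)Y_{p+n},\quad [Y_p,Y_q]=(q-p)M_{p+q}.$$ $U(\mathcal{L})$ is its universal enveloping algebra with the standard Hopf algebra structure $(U(\mathcal{L}),m,\iota,\Delta_0,S_0,\epsilon)$: $\Delta_0(X)=X\otimes1+1\otimes X$, $S_0(X)=-X$, $\epsilon(X)=0$ for $X\in\mathcal{L}$. $U(\mathcal{L})[[t]]$ is the topologically free $\mathbb{F}[[t]]$-algebra of formal power series in a central variable $t$ with coefficients in $U(\mathcal{L})$, with the induced Hopf structure; Hopf algebras over $\mathbb{F}[[t]]$ are understood in the topological sense, with tensor products completed $t$-adically, so that $U(\mathcal{L})[[t]]\otimes U(\mathcal{L})[[t]]$ means $(U(\mathcal{L})\otimes U(\mathcal{L}))[[t]]$. As usual, $\Delta$ is an algebra homomorphism and $S$ an algebra anti-homomorphism, so they are determined by their values on the basis of $\mathcal{L}$. For $c\in\mathbb{F}$, $(1-et)^c:=\sum_{m\ge0}(-1)^m\binom{c}{m}e^mt^m\in U(\mathcal{L})[[t]]$.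 For $a\in\mathbb{F}$ and $n\in\mathbb{Z}_+$ (nonnegative integers), $x_a^{(n)}:=(x+a)(x+a+1)\cdots(x+a+n-1)$ and $x_a^{[n]}:=(x+a)(x+a-1)\cdots(x+a-n+1)$, with $x^{(n)}:=x_0^{(n)}$; thus $h^{(2)}=h(h+1)$, $h_1^{[1]}=h+1$, $h_2^{[2]}=(h+2)(h+1)$. *)

theory Defs
  imports "HOL-Library.Poly_Mapping" "HOL-Computational_Algebra.Formal_Power_Series"
begin

section \<open>Free vector spaces and monoid algebras\<close>

text \<open>\<open>'k \<Rightarrow>\<^sub>0 'a\<close> is the vector space over \<open>'a\<close> with basis \<open>'k\<close>; if \<open>'k\<close> is a monoid
  (written additively, as class \<^class>\<open>monoid_add\<close>), its product is that of the monoid algebra.\<close>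

definition fscale :: "'a::field \<Rightarrow> ('k \<Rightarrow>\<^sub>0 'a) \<Rightarrow> ('k \<Rightarrow>\<^sub>0 'a)" where
  "fscale c = Poly_Mapping.map ((*) c)"

lemma lookup_fscale [simp]: "Poly_Mapping.lookup (fscale c p) k = c * Poly_Mapping.lookup p k"
  by (simp add: fscale_def Poly_Mapping.map.rep_eq when_def)

lemma fscale_single [simp]: "fscale c (Poly_Mapping.single k d) = Poly_Mapping.single k (c * d)"
  by (rule poly_mapping_eqI) (simp add: lookup_single when_def)

interpretation fscale: vector_space fscale
  by unfold_locales (auto intro!: poly_mapping_eqI simp: lookup_add algebra_simps)

lemma fscale_eq_times:
  fixes p :: "'k::monoid_add \<Rightarrow>\<^sub>0 'a::field"
  shows "fscale c p = Poly_Mapping.single 0 c * p"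
  by (simp add: fscale_def mult_map_scale_conv_mult)

lemma fscale_mult_left:
  fixes p q :: "'k::monoid_add \<Rightarrow>\<^sub>0 'a::field"
  shows "fscale c p * q = fscale c (p * q)"
  by (simp add: fscale_eq_times mult.assoc)

lemma times_single_scalar_commute:
  fixes p :: "'k::monoid_add \<Rightarrow>\<^sub>0 'a::field"
  shows "p * Poly_Mapping.single 0 c = Poly_Mapping.single 0 c * p"
proof (induction p rule: update_induct)
  case const
  then show ?case by simp
next
  case (update p a b)
  have "Poly_Mapping.update a b p = p + Poly_Mapping.single a b"
    using update.hyps by (intro poly_mapping_eqI)
      (auto simp: lookup_update lookup_add lookup_single when_def in_keys_iff)
  then show ?case
    using update.IH by (simp add: distrib_left distrib_right mult_single mult.commute)
qed

lemma fscale_mult_right: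
  fixes p q :: "'k::monoid_add \<Rightarrow>\<^sub>0 'a::field"
  shows "p * fscale c q = fscale c (p * q)"
  by (metis fscale_eq_times mult.assoc times_single_scalar_commute)

lemma pm_induct [case_names zero single add]:
  assumes "P 0" "\<And>k c. P (Poly_Mapping.single k c)" "\<And>p q. P p \<Longrightarrow> P q \<Longrightarrow> P (p + q)"
  shows "P (p :: 'k \<Rightarrow>\<^sub>0 'a::comm_monoid_add)"
proof (induction p rule: update_induct)
  case const
  then show ?case by (simp add: assms)
next
  case (update p a b)
  have "Poly_Mapping.update a b p = p + Poly_Mapping.single a b"
    using update.hyps by (intro poly_mapping_eqI)
      (auto simp: lookup_update lookup_add lookup_single when_def in_keys_iff)
  then show ?case
    using update.IH by (simp add: assms)
qed

text \<open>The linear extension of a map defined on the basis, with values in a module with scaling \<open>s\<close>.\<close>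

definition lin_ext :: "('a \<Rightarrow> 'v \<Rightarrow> 'v) \<Rightarrow> ('k \<Rightarrow> 'v) \<Rightarrow> ('k \<Rightarrow>\<^sub>0 'a::zero) \<Rightarrow> 'v::comm_monoid_add" where
  "lin_ext s w p = (\<Sum>k\<in>Poly_Mapping.keys p. s (Poly_Mapping.lookup p k) (w k))"

context module
begin

lemma lin_ext_superset:
  assumes "finite K" "Poly_Mapping.keys p \<subseteq> K"
  shows "lin_ext scale w p = (\<Sum>k\<in>K. scale (Poly_Mapping.lookup p k) (w k))"
  unfolding lin_ext_def using assms
  by (intro sum.mono_neutral_left) (auto simp: in_keys_iff)

lemma lin_ext_zero [simp]: "lin_ext scale w 0 = 0"
  by (simp add: lin_ext_def)

lemma lin_ext_single [simp]: "lin_ext scale w (Poly_Mapping.single k c) = scale c (w k)"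
  by (subst lin_ext_superset[of "{k}"]) (auto simp: lookup_single)

lemma lin_ext_add [simp]: "lin_ext scale w (p + q) = lin_ext scale w p + lin_ext scale w q"
proof -
  let ?K = "Poly_Mapping.keys p \<union> Poly_Mapping.keys q"
  have "lin_ext scale w r = (\<Sum>k\<in>?K. scale (Poly_Mapping.lookup r k) (w k))" if "r \<in> {p, q, p + q}" for r
    using that Poly_Mapping.keys_add[of p q] by (intro lin_ext_superset) auto
  then show ?thesis
    by (simp add: lookup_add scale_left_distrib sum.distrib)
qed

lemma lin_ext_diff [simp]: "lin_ext scale w (p - q) = lin_ext scale w p - lin_ext scale w q"
  using lin_ext_add[of w "p - q" q] by (simp add: algebra_simps)

end

context vector_space
begin

lemma lin_ext_scale [simp]: "lin_ext scale w (fscale c p) = scale c (lin_ext scale w p)"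
proof (induction p rule: pm_induct)
  case (add p q)
  then show ?case by (simp add: fscale.scale_right_distrib scale_right_distrib)
qed auto

lemma linear_lin_ext: "Vector_Spaces.linear fscale scale (lin_ext scale w)"
  by unfold_locales auto

end

lemma lin_ext_mult:
  fixes W :: "'k::monoid_add \<Rightarrow> 'r::ring_1"
  assumes "vector_space s"
    and "\<And>c x y. s c x * y = s c (x * y)" "\<And>c x y. x * s c y = s c (x * y)"
    and "\<And>v w. W (v + w) = W v * W w"
  shows "lin_ext s W (p * q) = lin_ext s W p * lin_ext s W q"
proof -
  interpret vector_space s by fact
  show ?thesis
  proof (induction p rule: pm_induct)
    case (single v c)
    show ?case
      by (induction q rule: pm_induct) (simp_all add: mult_single assms(2-4) mult.commute distrib_left)
  qed (simp_all add: distrib_right)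
qed

lemma lin_ext_anti_mult:
  fixes W :: "'k::monoid_add \<Rightarrow> 'r::ring_1"
  assumes "vector_space s"
    and "\<And>c x y. s c x * y = s c (x * y)" "\<And>c x y. x * s c y = s c (x * y)"
    and "\<And>v w. W (v + w) = W w * W v"
  shows "lin_ext s W (p * q) = lin_ext s W q * lin_ext s W p"
proof -
  interpret vector_space s by fact
  show ?thesis
  proof (induction p rule: pm_induct)
    case (single v c)
    show ?case
      by (induction q rule: pm_induct) (simp_all add: mult_single assms(2-4) mult.commute distrib_left
        distrib_right scale_right_distrib)
  qed (simp_all add: distrib_right distrib_left)
qed


section \<open>Two-sided ideals\<close>

inductive_set ideal_gen :: "'r::ring_1 set \<Rightarrow> 'r set" for S where
  zero: "0 \<in> ideal_gen S"
| gen: "s \<in> S \<Longrightarrow> a * s * b \<in> ideal_gen S"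
| add: "x \<in> ideal_gen S \<Longrightarrow> y \<in> ideal_gen S \<Longrightarrow> x + y \<in> ideal_gen S"

lemma ideal_gen_left: "x \<in> ideal_gen S \<Longrightarrow> r * x \<in> ideal_gen S"
proof (induction rule: ideal_gen.induct)
  case (gen s a b)
  then show ?case using ideal_gen.gen[OF gen, of "r * a" b] by (simp add: mult.assoc)
qed (auto intro: ideal_gen.intros simp: distrib_left)

lemma ideal_gen_right: "x \<in> ideal_gen S \<Longrightarrow> x * r \<in> ideal_gen S"
proof (induction rule: ideal_gen.induct)
  case (gen s a b)
  then show ?case using ideal_gen.gen[OF gen, of a "b * r"] by (simp add: mult.assoc)
qed (auto intro: ideal_gen.intros simp: distrib_right)

lemma ideal_gen_minus: "x \<in> ideal_gen S \<Longrightarrow> - x \<in> ideal_gen S"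
  using ideal_gen_left[of x S "- 1"] by simp

lemma ideal_gen_diff: "x \<in> ideal_gen S \<Longrightarrow> y \<in> ideal_gen S \<Longrightarrow> x - y \<in> ideal_gen S"
  using ideal_gen.add[of x S "- y"] ideal_gen_minus[of y S] by simp

lemma ideal_gen_base: "s \<in> S \<Longrightarrow> s \<in> ideal_gen S"
  using ideal_gen.gen[of s S 1 1] by simp


section \<open>The Schroedinger-Virasoro Lie algebra\<close>

text \<open>\<open>SV_Y k\<close> stands for the basis vector of half-integral index \<open>k + 1/2\<close>.\<close>

datatype sv_basis = SV_L int | SV_Y int | SV_M int

fun sv_bracket_basis :: "sv_basis \<Rightarrow> sv_basis \<Rightarrow> (sv_basis \<Rightarrow>\<^sub>0 'a::field_char_0)" where
  "sv_bracket_basis (SV_L m) (SV_L n) = Poly_Mapping.single (SV_L (m + n)) (of_int (n - m))"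
| "sv_bracket_basis (SV_L m) (SV_M n) = Poly_Mapping.single (SV_M (m + n)) (of_int n)"
| "sv_bracket_basis (SV_M n) (SV_L m) = - Poly_Mapping.single (SV_M (m + n)) (of_int n)"
| "sv_bracket_basis (SV_L n) (SV_Y k) =
    Poly_Mapping.single (SV_Y (n + k)) ((of_int k + 1 / 2) - of_int n / 2)"
| "sv_bracket_basis (SV_Y k) (SV_L n) =
    - Poly_Mapping.single (SV_Y (n + k)) ((of_int k + 1 / 2) - of_int n / 2)"
| "sv_bracket_basis (SV_Y j) (SV_Y k) = Poly_Mapping.single (SV_M (j + k + 1)) (of_int (k - j))"
| "sv_bracket_basis (SV_Y j) (SV_M k) = 0"
| "sv_bracket_basis (SV_M j) (SV_Y k) = 0"
| "sv_bracket_basis (SV_M j) (SV_M k) = 0"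

type_synonym 'a sv = "sv_basis \<Rightarrow>\<^sub>0 'a"

definition sv_bracket :: "'a::field_char_0 sv \<Rightarrow> 'a sv \<Rightarrow> 'a sv" where
  "sv_bracket x y = lin_ext fscale (\<lambda>b. lin_ext fscale (\<lambda>c. sv_bracket_basis b c) y) x"

lemma lin_ext_fun_add:
  "module s \<Longrightarrow> lin_ext s (\<lambda>k. f k + g k) p = lin_ext s f p + lin_ext s g p"
  by (simp add: lin_ext_def module.scale_right_distrib sum.distrib)

lemma lin_ext_fun_scale:
  "module s \<Longrightarrow> lin_ext s (\<lambda>k. s c (f k)) p = s c (lin_ext s f p)"
  by (simp add: lin_ext_def module.scale_sum_right mult.commute module.scale_scale)

lemma sv_bracket_add_left [simp]: "sv_bracket (x + y) z = sv_bracket x z + sv_bracket y z"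
  by (simp add: sv_bracket_def)

lemma sv_bracket_add_right [simp]: "sv_bracket x (y + z) = sv_bracket x y + sv_bracket x z"
  by (simp add: sv_bracket_def lin_ext_fun_add fscale.module_axioms)

lemma sv_bracket_scale_left [simp]: "sv_bracket (fscale c x) y = fscale c (sv_bracket x y)"
  by (simp add: sv_bracket_def)

lemma sv_bracket_scale_right [simp]: "sv_bracket x (fscale c y) = fscale c (sv_bracket x y)"
  unfolding sv_bracket_def fscale.lin_ext_scale
  by (rule lin_ext_fun_scale[OF fscale.module_axioms])

lemma sv_bracket_zero [simp]: "sv_bracket 0 x = 0" "sv_bracket x 0 = 0"
  using sv_bracket_scale_left[of 0 0 x] sv_bracket_scale_right[of x 0 0] by simp_all

lemma sv_bracket_single [simp]:
  "sv_bracket (Poly_Mapping.single b c) (Poly_Mapping.single b' c') =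
     fscale (c * c') (sv_bracket_basis b b')"
  by (simp add: sv_bracket_def)

lemma sv_bracket_basis_anti: "sv_bracket_basis b c = - sv_bracket_basis c b"
  by (cases b; cases c) (auto simp: single_uminus[symmetric] algebra_simps)

lemma sv_bracket_anti: "sv_bracket x y = - sv_bracket y x"
proof (induction x rule: pm_induct)
  case (single b c)
  show ?case
  proof (induction y rule: pm_induct)
    case (single b' c')
    show ?case
      by (simp add: sv_bracket_basis_anti[of b b'] mult.commute fscale.scale_minus_right)
  qed auto
qed auto

lemma sv_bracket_self: "sv_bracket x x = 0"
proof -
  have "Poly_Mapping.lookup (sv_bracket x x) k = - Poly_Mapping.lookup (sv_bracket x x) k" for k
    by (subst sv_bracket_anti) simp
  then show ?thesis
    by (intro poly_mapping_eqI) (simp add: eq_neg_iff_add_eq_0 flip: mult_2)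
qed

lemma sv_jacobi:
  "sv_bracket x (sv_bracket y z) + sv_bracket y (sv_bracket z x) + sv_bracket z (sv_bracket x y) = 0"
    (is "?J x y z = 0")
proof -
  let ?e = "\<lambda>b. Poly_Mapping.single b (1::'a)"
  have uni: "sv_bracket u (- v) = - sv_bracket u v" for u v :: "'a sv"
    using sv_bracket_scale_right[of u "- 1" v] by (simp add: fscale.scale_minus_left)
  have basis: "?J (?e b) (?e c) (?e d) = 0" for b c d
    by (cases b; cases c; cases d)
      (auto simp: uni intro!: poly_mapping_eqI
         simp: lookup_add lookup_single when_def field_simps power2_eq_square)
  have J_add: "?J (x + x') y z = ?J x y z + ?J x' y z" "?J x (y + y') z = ?J x y z + ?J x y' z"
    "?J x y (z + z') = ?J x y z + ?J x y z'" for x x' y y' z z'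
    by (simp_all add: algebra_simps)
  show ?thesis
  proof (induction x rule: pm_induct)
    case (single b c)
    show ?case
    proof (induction y rule: pm_induct)
      case (single b' c')
      show ?case
      proof (induction z rule: pm_induct)
        case (single b'' c'')
        have "?J (fscale c (?e b)) (fscale c' (?e b')) (fscale c'' (?e b''))
              = fscale (c * c' * c'') (?J (?e b) (?e b') (?e b''))"
          by (simp add: fscale.scale_right_distrib mult_ac del: fscale_single sv_bracket_single)
        also have "\<dots> = 0" by (simp only: basis fscale.scale_zero_right)
        finally show ?case by (simp only: fscale_single mult_1_right)
      next
        case (add p q)
        then show ?case by (simp only: J_add add_0)
      qed simp
    next
      case (add p q)
      then show ?case by (simp only: J_add add_0)
    qed simp
  next
    case (add p q)
    then show ?case by (simp only: J_add add_0)
  qed simp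
qed


section \<open>The universal enveloping algebra\<close>

text \<open>The free monoid, written additively; \<open>'b word \<Rightarrow>\<^sub>0 'a\<close> is the free associative algebra on
  \<open>'b\<close>, i.e. the tensor algebra of the vector space with basis \<open>'b\<close>.\<close>

datatype 'b word = Word (letters: "'b list")

instantiation word :: (type) monoid_add
begin

definition zero_word :: "'b word" where "zero_word = Word []"
definition plus_word :: "'b word \<Rightarrow> 'b word \<Rightarrow> 'b word" where
  "plus_word v w = Word (letters v @ letters w)"

instance
  by standard (auto simp: zero_word_def plus_word_def)

end

lemma letters_zero [simp]: "letters 0 = []"
  by (simp add: zero_word_def)

lemma letters_plus [simp]: "letters (v + w) = letters v @ letters w"
  by (simp add: plus_word_def)

type_synonym ('b, 'a) tensor_algebra = "'b word \<Rightarrow>\<^sub>0 'a"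

definition in_tensor_algebra :: "('b \<Rightarrow>\<^sub>0 'a::field) \<Rightarrow> ('b, 'a) tensor_algebra" where
  "in_tensor_algebra = lin_ext fscale (\<lambda>b. Poly_Mapping.single (Word [b]) 1)"

definition uea_relators :: "(sv_basis, 'a::field_char_0) tensor_algebra set" where
  "uea_relators =
    {in_tensor_algebra x * in_tensor_algebra y - in_tensor_algebra y * in_tensor_algebra x
       - in_tensor_algebra (sv_bracket x y) | x y. True}"

definition uea_rel ::
    "(sv_basis, 'a::field_char_0) tensor_algebra \<Rightarrow> (sv_basis, 'a) tensor_algebra \<Rightarrow> bool" where
  "uea_rel p q \<longleftrightarrow> p - q \<in> ideal_gen uea_relators"

quotient_type (overloaded) 'a uea = "(sv_basis, 'a::field_char_0) tensor_algebra" / uea_rel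
proof (rule equivpI)
  show "reflp (uea_rel :: (sv_basis, 'a) tensor_algebra \<Rightarrow> _)"
    by (simp add: reflp_def uea_rel_def ideal_gen.zero)
  show "symp (uea_rel :: (sv_basis, 'a) tensor_algebra \<Rightarrow> _)"
    using ideal_gen_minus by (fastforce simp: symp_def uea_rel_def)
  show "transp (uea_rel :: (sv_basis, 'a) tensor_algebra \<Rightarrow> _)"
  proof (rule transpI)
    fix x y z :: "(sv_basis, 'a) tensor_algebra"
    assume "uea_rel x y" "uea_rel y z"
    then show "uea_rel x z"
      using ideal_gen.add[of "x - y" uea_relators "y - z"] by (simp add: uea_rel_def)
  qed
qed

text \<open>The augmentation of the tensor algebra is the coefficient of the empty word.\<close>

lemma lookup_zero_word_mult:
  fixes p q :: "('b, 'a::field) tensor_algebra"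
  shows "Poly_Mapping.lookup (p * q) 0 = Poly_Mapping.lookup p 0 * Poly_Mapping.lookup q 0"
proof (induction p rule: pm_induct)
  case (single v c)
  show ?case
  proof (induction q rule: pm_induct)
    case (single w d)
    show ?case
      by (cases v; cases w) (auto simp: mult_single lookup_single when_def plus_word_def zero_word_def)
  qed (auto simp: distrib_left lookup_add)
qed (auto simp: distrib_right lookup_add)

lemma lookup_zero_in_tensor_algebra: "Poly_Mapping.lookup (in_tensor_algebra x) 0 = 0"
  by (induction x rule: pm_induct)
    (auto simp: in_tensor_algebra_def lookup_add lookup_single when_def zero_word_def)

lemma lookup_zero_ideal:
  "p \<in> ideal_gen uea_relators \<Longrightarrow> Poly_Mapping.lookup p 0 = 0"
  by (induction rule: ideal_gen.induct)
    (auto simp: uea_relators_def lookup_add lookup_minus lookup_zero_word_mult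
       lookup_zero_in_tensor_algebra)

lift_definition uea_counit :: "'a::field_char_0 uea \<Rightarrow> 'a" is "\<lambda>p. Poly_Mapping.lookup p 0"
  using lookup_zero_ideal by (fastforce simp: uea_rel_def lookup_minus)

instantiation uea :: (field_char_0) ring_1
begin

lift_definition zero_uea :: "'a uea" is 0 .
lift_definition one_uea :: "'a uea" is 1 .

lift_definition plus_uea :: "'a uea \<Rightarrow> 'a uea \<Rightarrow> 'a uea" is "(+)"
  unfolding uea_rel_def by (metis add_diff_add ideal_gen.add)

lift_definition minus_uea :: "'a uea \<Rightarrow> 'a uea \<Rightarrow> 'a uea" is "(-)"
proof -
  fix p p' q q' :: "(sv_basis, 'a) tensor_algebra"
  assume "uea_rel p p'" "uea_rel q q'"
  then have "(p - p') - (q - q') \<in> ideal_gen uea_relators"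
    unfolding uea_rel_def by (rule ideal_gen_diff)
  then show "uea_rel (p - q) (p' - q')"
    by (simp add: uea_rel_def algebra_simps)
qed

lift_definition uminus_uea :: "'a uea \<Rightarrow> 'a uea" is uminus
  unfolding uea_rel_def by (metis ideal_gen_minus minus_diff_minus)

lift_definition times_uea :: "'a uea \<Rightarrow> 'a uea \<Rightarrow> 'a uea" is "(*)"
proof -
  fix p p' q q' :: "(sv_basis, 'a) tensor_algebra"
  assume "uea_rel p p'" "uea_rel q q'"
  then have "p * (q - q') + (p - p') * q' \<in> ideal_gen uea_relators"
    unfolding uea_rel_def by (intro ideal_gen.add ideal_gen_left ideal_gen_right)
  then show "uea_rel (p * q) (p' * q')"
    by (simp add: uea_rel_def algebra_simps)
qed

instance
proof
  show "(0::'a uea) \<noteq> 1"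
  proof
    assume "(0::'a uea) = 1"
    then have "uea_counit (0::'a uea) = uea_counit 1" by simp
    then show False by transfer simp
  qed
qed (transfer; simp add: uea_rel_def algebra_simps ideal_gen.zero)+

end

lift_definition uea_scale :: "'a::field_char_0 \<Rightarrow> 'a uea \<Rightarrow> 'a uea" is fscale
  unfolding uea_rel_def
  by (metis fscale_eq_times ideal_gen_left right_diff_distrib)

interpretation uea: vector_space uea_scale
  by unfold_locales (transfer; simp add: uea_rel_def ideal_gen.zero
     fscale.scale_right_distrib fscale.scale_left_distrib)+

lift_definition uea_of_sv :: "'a::field_char_0 sv \<Rightarrow> 'a uea" is in_tensor_algebra .

lemma uea_scale_mult_left: "uea_scale c x * y = uea_scale c (x * y)"
  by transfer (simp add: uea_rel_def ideal_gen.zero fscale_mult_left)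

lemma uea_scale_mult_right: "x * uea_scale c y = uea_scale c (x * y)"
  by transfer (simp add: uea_rel_def ideal_gen.zero fscale_mult_right)

lemma uea_of_sv_bracket:
  "uea_of_sv x * uea_of_sv y - uea_of_sv y * uea_of_sv x = uea_of_sv (sv_bracket x y)"
  by transfer (auto simp: uea_rel_def uea_relators_def intro!: ideal_gen_base)

lemma uea_of_sv_add: "uea_of_sv (x + y) = uea_of_sv x + uea_of_sv y"
  by transfer (simp add: in_tensor_algebra_def uea_rel_def ideal_gen.zero)

lemma uea_of_sv_scale: "uea_of_sv (fscale c x) = uea_scale c (uea_of_sv x)"
  by transfer (simp add: in_tensor_algebra_def uea_rel_def ideal_gen.zero)

lemma uea_counit_simps [simp]:
  "uea_counit 0 = 0" "uea_counit 1 = 1"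
  "uea_counit (x + y) = uea_counit x + uea_counit y"
  "uea_counit (x * y) = uea_counit x * uea_counit y"
  "uea_counit (uea_scale c x) = c * uea_counit x"
  "uea_counit (uea_of_sv z) = 0"
  by (transfer; simp add: lookup_add lookup_zero_word_mult lookup_zero_in_tensor_algebra)+

definition uea_gen :: "sv_basis \<Rightarrow> 'a::field_char_0 uea" where
  "uea_gen b = uea_of_sv (Poly_Mapping.single b 1)"

definition gen_L :: "int \<Rightarrow> 'a::field_char_0 uea" where
  "gen_L n = uea_gen (SV_L n)"

text \<open>\<open>gen_Y q\<close> is the generator $Y_{q/2}$; it is meaningful for odd \<open>q\<close> only.\<close>

definition gen_Y :: "int \<Rightarrow> 'a::field_char_0 uea" where
  "gen_Y q = uea_gen (SV_Y ((q - 1) div 2))"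

definition gen_M :: "int \<Rightarrow> 'a::field_char_0 uea" where
  "gen_M n = uea_gen (SV_M n)"

text \<open>$(x + a)(x + a + 1) \cdots (x + a + n - 1)$ and $(x + a)(x + a - 1) \cdots (x + a - n + 1)$.\<close>

definition rising :: "'a::field_char_0 uea \<Rightarrow> 'a \<Rightarrow> nat \<Rightarrow> 'a uea" where
  "rising x a n = prod_list (map (\<lambda>i. x + uea_scale (a + of_nat i) 1) [0..<n])"

definition falling :: "'a::field_char_0 uea \<Rightarrow> 'a \<Rightarrow> nat \<Rightarrow> 'a uea" where
  "falling x a n = prod_list (map (\<lambda>i. x + uea_scale (a - of_nat i) 1) [0..<n])"


section \<open>Tensor powers of the universal enveloping algebra\<close>

text \<open>The tensor power of \<open>U\<close> with factors indexed by the finite type \<open>'n\<close> is the quotient of the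
  free vector space on all families \<open>'n \<Rightarrow> U\<close> by the span of the multilinearity relators. The
  factorwise product of families (written additively) makes the free vector space a monoid algebra,
  whose product descends.\<close>

datatype ('n, 'u) family = Family (component: "'n \<Rightarrow> 'u")

instantiation family :: (type, monoid_mult) monoid_add
begin

definition zero_family :: "('a, 'b) family" where "zero_family = Family (\<lambda>_. 1)"
definition plus_family :: "('a, 'b) family \<Rightarrow> ('a, 'b) family \<Rightarrow> ('a, 'b) family" where
  "plus_family f g = Family (\<lambda>i. component f i * component g i)"

instance
  by standard (auto simp: zero_family_def plus_family_def mult.assoc)

end

definition free_tensor :: "('n \<Rightarrow> 'a uea) \<Rightarrow> (('n, 'a uea) family \<Rightarrow>\<^sub>0 'a::field_char_0)" where
  "free_tensor f = Poly_Mapping.single (Family f) 1"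

definition multilinear_relator ::
    "('n \<Rightarrow> 'a uea) \<Rightarrow> 'n \<Rightarrow> 'a \<Rightarrow> 'a uea \<Rightarrow> 'a \<Rightarrow> 'a uea \<Rightarrow> (('n, 'a uea) family \<Rightarrow>\<^sub>0 'a::field_char_0)" where
  "multilinear_relator f i a x b y =
     free_tensor (f(i := uea_scale a x + uea_scale b y))
     - fscale a (free_tensor (f(i := x))) - fscale b (free_tensor (f(i := y)))"

definition tensor_relators :: "(('n, 'a uea) family \<Rightarrow>\<^sub>0 'a::field_char_0) set" where
  "tensor_relators = {multilinear_relator f i a x b y | f i a x b y. True}"

definition tensor_rel ::
    "(('n, 'a uea) family \<Rightarrow>\<^sub>0 'a::field_char_0) \<Rightarrow> (('n, 'a uea) family \<Rightarrow>\<^sub>0 'a) \<Rightarrow> bool" where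
  "tensor_rel p q \<longleftrightarrow> p - q \<in> fscale.span tensor_relators"

lemma tensor_rel_refl: "tensor_rel p p"
  by (simp add: tensor_rel_def fscale.span_zero)

lemma single_family_eq: "Poly_Mapping.single g c = fscale c (free_tensor (component g))"
  by (cases g) (simp add: free_tensor_def)

lemma free_tensor_mult: "free_tensor f * free_tensor g = free_tensor (\<lambda>i. f i * g i)"
  by (simp add: free_tensor_def mult_single plus_family_def)

lemma multilinear_relator_mult_left:
  "free_tensor g * multilinear_relator f i a x b y =
     multilinear_relator (\<lambda>j. g j * f j) i a (g i * x) b (g i * y)"
proof -
  have "(\<lambda>j. g j * (f(i := z)) j) = (\<lambda>j. g j * f j)(i := g i * z)" for z by auto
  then show ?thesis
    by (simp add: multilinear_relator_def right_diff_distrib fscale_mult_right free_tensor_mult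
      distrib_left uea_scale_mult_right)
qed

lemma multilinear_relator_mult_right:
  "multilinear_relator f i a x b y * free_tensor g =
     multilinear_relator (\<lambda>j. f j * g j) i a (x * g i) b (y * g i)"
proof -
  have "(\<lambda>j. (f(i := z)) j * g j) = (\<lambda>j. f j * g j)(i := z * g i)" for z by auto
  then show ?thesis
    by (simp add: multilinear_relator_def left_diff_distrib fscale_mult_left free_tensor_mult
      distrib_right uea_scale_mult_left)
qed

lemma tensor_span_left:
  assumes "x \<in> fscale.span tensor_relators"
  shows "p * x \<in> fscale.span tensor_relators"
  using assms
proof (induction rule: fscale.span_induct_alt)
  case base
  then show ?case by (simp add: fscale.span_zero)
next
  case (step c r y)
  have "p * r \<in> fscale.span tensor_relators"
  proof (induction p rule: pm_induct)
    case (single k d)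
    have "free_tensor (component k) * r \<in> tensor_relators"
      using step.hyps by (force simp: tensor_relators_def multilinear_relator_mult_left)
    then show ?case
      by (simp only: single_family_eq fscale_mult_left) (intro fscale.span_scale fscale.span_base)
  qed (auto simp: distrib_right fscale.span_zero fscale.span_add)
  then show ?case
    using step.IH by (simp add: distrib_left fscale_mult_right fscale.span_add fscale.span_scale)
qed

lemma tensor_span_right:
  assumes "x \<in> fscale.span tensor_relators"
  shows "x * p \<in> fscale.span tensor_relators"
  using assms
proof (induction rule: fscale.span_induct_alt)
  case base
  then show ?case by (simp add: fscale.span_zero)
next
  case (step c r y)
  have "r * p \<in> fscale.span tensor_relators"
  proof (induction p rule: pm_induct)
    case (single k d)
    have "r * free_tensor (component k) \<in> tensor_relators"
      using step.hyps by (force simp: tensor_relators_def multilinear_relator_mult_right)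
    then show ?case
      by (simp only: single_family_eq fscale_mult_right) (intro fscale.span_scale fscale.span_base)
  qed (auto simp: distrib_left fscale.span_zero fscale.span_add)
  then show ?case
    using step.IH by (simp add: distrib_right fscale_mult_left fscale.span_add fscale.span_scale)
qed

quotient_type (overloaded) ('n, 'a) uea_power = "('n::finite, 'a::field_char_0 uea) family \<Rightarrow>\<^sub>0 'a" / tensor_rel
proof (rule equivpI)
  show "reflp (tensor_rel :: (('n, 'a uea) family \<Rightarrow>\<^sub>0 'a) \<Rightarrow> _)"
    by (simp add: reflp_def tensor_rel_def fscale.span_zero)
  show "symp (tensor_rel :: (('n, 'a uea) family \<Rightarrow>\<^sub>0 'a) \<Rightarrow> _)"
    using fscale.span_neg by (fastforce simp: symp_def tensor_rel_def)
  show "transp (tensor_rel :: (('n, 'a uea) family \<Rightarrow>\<^sub>0 'a) \<Rightarrow> _)"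
  proof (rule transpI)
    fix x y z :: "('n, 'a uea) family \<Rightarrow>\<^sub>0 'a"
    assume "tensor_rel x y" "tensor_rel y z"
    then show "tensor_rel x z"
      using fscale.span_add[of "x - y" tensor_relators "y - z"] by (simp add: tensor_rel_def)
  qed
qed

lemma lin_ext_multilinear_relator:
  assumes "vector_space s"
    and "\<And>f i a x b y. F (f(i := uea_scale a x + uea_scale b y)) = s a (F (f(i := x))) + s b (F (f(i := y)))"
    and "p \<in> fscale.span tensor_relators"
  shows "lin_ext s (\<lambda>k. F (component k)) p = 0"
proof -
  interpret vector_space s by fact
  have rel: "lin_ext s (\<lambda>k. F (component k)) r = 0" if "r \<in> tensor_relators" for r
    using that by (auto simp: tensor_relators_def multilinear_relator_def free_tensor_def assms(2))
  show ?thesis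
    using assms(3)
    by (induction rule: fscale.span_induct_alt) (simp_all add: rel)
qed

text \<open>The product of the augmentations of all factors shows that tensor powers are nonzero.\<close>

lemma prod_uea_counit_multilinear:
  fixes f :: "'n::finite \<Rightarrow> 'a::field_char_0 uea"
  shows "(\<Prod>j\<in>UNIV. uea_counit ((f(i := uea_scale a x + uea_scale b y)) j)) =
    a * (\<Prod>j\<in>UNIV. uea_counit ((f(i := x)) j)) + b * (\<Prod>j\<in>UNIV. uea_counit ((f(i := y)) j))"
proof -
  have "(\<Prod>j\<in>UNIV. uea_counit ((f(i := z)) j)) = uea_counit z * (\<Prod>j\<in>UNIV - {i}. uea_counit (f j))" for z
    by (subst prod.remove[of UNIV i]) (auto intro!: prod.cong)
  then show ?thesis by (simp add: algebra_simps)
qed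

lift_definition uea_power_counit :: "('n::finite, 'a::field_char_0) uea_power \<Rightarrow> 'a"
  is "lin_ext (*) (\<lambda>k. \<Prod>j\<in>UNIV. uea_counit (component k j))"
proof -
  fix p q :: "('n, 'a uea) family \<Rightarrow>\<^sub>0 'a"
  interpret vector_space "(*) :: 'a \<Rightarrow> 'a \<Rightarrow> 'a"
    by unfold_locales (auto simp: algebra_simps)
  assume "tensor_rel p q"
  then have "lin_ext (*) (\<lambda>k. \<Prod>j\<in>UNIV. uea_counit (component k j)) (p - q) = 0"
    unfolding tensor_rel_def
    by (intro lin_ext_multilinear_relator[where F = "\<lambda>f. \<Prod>j\<in>UNIV. uea_counit (f j)"]
        prod_uea_counit_multilinear vector_space_axioms)
  then show "lin_ext (*) (\<lambda>k. \<Prod>j\<in>UNIV. uea_counit (component k j)) p =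
      lin_ext (*) (\<lambda>k. \<Prod>j\<in>UNIV. uea_counit (component k j)) q"
    by simp
qed

instantiation uea_power :: (finite, field_char_0) ring_1
begin

lift_definition zero_uea_power :: "('a, 'b) uea_power" is 0 .
lift_definition one_uea_power :: "('a, 'b) uea_power" is 1 .

lift_definition plus_uea_power :: "('a, 'b) uea_power \<Rightarrow> ('a, 'b) uea_power \<Rightarrow> ('a, 'b) uea_power" is "(+)"
  unfolding tensor_rel_def by (metis add_diff_add fscale.span_add)

lift_definition minus_uea_power :: "('a, 'b) uea_power \<Rightarrow> ('a, 'b) uea_power \<Rightarrow> ('a, 'b) uea_power" is "(-)"
proof -
  fix p p' q q' :: "('a, 'b uea) family \<Rightarrow>\<^sub>0 'b"
  assume "tensor_rel p p'" "tensor_rel q q'"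
  then have "(p - p') - (q - q') \<in> fscale.span tensor_relators"
    unfolding tensor_rel_def by (rule fscale.span_diff)
  then show "tensor_rel (p - q) (p' - q')"
    by (simp add: tensor_rel_def algebra_simps)
qed

lift_definition uminus_uea_power :: "('a, 'b) uea_power \<Rightarrow> ('a, 'b) uea_power" is uminus
  unfolding tensor_rel_def by (metis fscale.span_neg minus_diff_minus)

lift_definition times_uea_power :: "('a, 'b) uea_power \<Rightarrow> ('a, 'b) uea_power \<Rightarrow> ('a, 'b) uea_power" is "(*)"
proof -
  fix p p' q q' :: "('a, 'b uea) family \<Rightarrow>\<^sub>0 'b"
  assume "tensor_rel p p'" "tensor_rel q q'"
  then have "p * (q - q') + (p - p') * q' \<in> fscale.span tensor_relators"
    unfolding tensor_rel_def by (intro fscale.span_add tensor_span_left tensor_span_right)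
  then show "tensor_rel (p * q) (p' * q')"
    by (simp add: tensor_rel_def algebra_simps)
qed

instance
proof
  fix x y z :: "('a, 'b) uea_power"
  show "x + y + z = x + (y + z)" by transfer (simp only: tensor_rel_refl add.assoc)
  show "x + y = y + x" by transfer (simp only: tensor_rel_refl add.commute)
  show "0 + x = x" by transfer (simp only: tensor_rel_refl add_0)
  show "- x + x = 0" by transfer (simp only: tensor_rel_refl left_minus)
  show "x - y = x + - y" by transfer (simp only: tensor_rel_refl diff_conv_add_uminus)
  show "x * y * z = x * (y * z)" by transfer (simp only: tensor_rel_refl mult.assoc)
  show "1 * x = x" by transfer (simp only: tensor_rel_refl mult_1_left)
  show "x * 1 = x" by transfer (simp only: tensor_rel_refl mult_1_right)
  show "(x + y) * z = x * z + y * z" by transfer (simp only: tensor_rel_refl distrib_right)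
  show "x * (y + z) = x * y + x * z" by transfer (simp only: tensor_rel_refl distrib_left)
  show "(0::('a, 'b) uea_power) \<noteq> 1"
  proof
    interpret vector_space "(*) :: 'b \<Rightarrow> 'b \<Rightarrow> 'b"
      by unfold_locales (auto simp: algebra_simps)
    have one: "(1 :: ('a, 'b uea) family \<Rightarrow>\<^sub>0 'b) = Poly_Mapping.single 0 1"
      by simp
    assume "(0::('a, 'b) uea_power) = 1"
    then have "uea_power_counit (0::('a, 'b) uea_power) = uea_power_counit 1" by simp
    then show False
      by transfer (unfold one lin_ext_single lin_ext_zero, simp add: zero_family_def)
  qed
qed

end

lift_definition uea_power_scale :: "'a::field_char_0 \<Rightarrow> ('n::finite, 'a) uea_power \<Rightarrow> ('n, 'a) uea_power"
  is fscale
proof -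
  fix c :: 'a and p q :: "('n, 'a uea) family \<Rightarrow>\<^sub>0 'a"
  assume "tensor_rel p q"
  then have "fscale c (p - q) \<in> fscale.span tensor_relators"
    unfolding tensor_rel_def by (rule fscale.span_scale)
  then show "tensor_rel (fscale c p) (fscale c q)"
    by (simp add: tensor_rel_def fscale.scale_right_diff_distrib)
qed

interpretation uea_power: vector_space uea_power_scale
proof
  fix a b :: 'a and x y :: "('n::finite, 'a) uea_power"
  show "uea_power_scale a (x + y) = uea_power_scale a x + uea_power_scale a y"
    by transfer (simp only: tensor_rel_refl fscale.scale_right_distrib)
  show "uea_power_scale (a + b) x = uea_power_scale a x + uea_power_scale b x"
    by transfer (simp only: tensor_rel_refl fscale.scale_left_distrib)
  show "uea_power_scale a (uea_power_scale b x) = uea_power_scale (a * b) x"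
    by transfer (simp only: tensor_rel_refl fscale.scale_scale)
  show "uea_power_scale 1 x = x"
    by transfer (simp only: tensor_rel_refl fscale.scale_one)
qed

lift_definition pure_tensor :: "('n::finite \<Rightarrow> 'a::field_char_0 uea) \<Rightarrow> ('n, 'a) uea_power"
  is free_tensor .

lemma pure_tensor_multilinear:
  fixes f :: "'n::finite \<Rightarrow> 'a::field_char_0 uea"
  shows "pure_tensor (f(i := uea_scale a x + uea_scale b y)) =
     uea_power_scale a (pure_tensor (f(i := x))) + uea_power_scale b (pure_tensor (f(i := y)))"
proof transfer
  fix f :: "'n \<Rightarrow> 'a uea" and i a x b y
  have "multilinear_relator f i a x b y \<in> fscale.span tensor_relators"
    by (rule fscale.span_base) (use tensor_relators_def in blast)
  then show "tensor_rel (free_tensor (f(i := uea_scale a x + uea_scale b y)))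
      (fscale a (free_tensor (f(i := x))) + fscale b (free_tensor (f(i := y))))"
    unfolding tensor_rel_def multilinear_relator_def by (simp only: diff_diff_eq)
qed

lemma pure_tensor_mult: "pure_tensor f * pure_tensor g = pure_tensor (\<lambda>i. f i * g i)"
  by transfer (simp add: tensor_rel_def free_tensor_mult fscale.span_zero)

lemma pure_tensor_one: "pure_tensor (\<lambda>_. 1) = 1"
  by transfer (simp add: tensor_rel_def free_tensor_def fscale.span_zero flip: zero_family_def)

lemma uea_power_scale_mult_left: "uea_power_scale c x * y = uea_power_scale c (x * y)"
  by transfer (simp add: tensor_rel_def fscale.span_zero fscale_mult_left)

lemma uea_power_scale_mult_right: "x * uea_power_scale c y = uea_power_scale c (x * y)"
  by transfer (simp add: tensor_rel_def fscale.span_zero fscale_mult_right)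

datatype slot2 = Fst2 | Snd2
datatype slot3 = Fst3 | Snd3 | Thd3

instance slot2 :: finite
  by standard (rule finite_subset[of _ "{Fst2, Snd2}"]; auto intro: slot2.exhaust)

instance slot3 :: finite
  by standard (rule finite_subset[of _ "{Fst3, Snd3, Thd3}"]; auto intro: slot3.exhaust)

type_synonym 'a uea2 = "(slot2, 'a) uea_power"
type_synonym 'a uea3 = "(slot3, 'a) uea_power"

definition tensor2 :: "'a::field_char_0 uea \<Rightarrow> 'a uea \<Rightarrow> 'a uea2" where
  "tensor2 x y = pure_tensor (case_slot2 x y)"

definition tensor3 :: "'a::field_char_0 uea \<Rightarrow> 'a uea \<Rightarrow> 'a uea \<Rightarrow> 'a uea3" where
  "tensor3 x y z = pure_tensor (case_slot3 x y z)"

lemma case_slot2_upd: "(case_slot2 x y)(Fst2 := z) = case_slot2 z y" "(case_slot2 x y)(Snd2 := z) = case_slot2 x z"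
  by (auto split: slot2.split)

lemma case_slot3_upd: "(case_slot3 x y z)(Fst3 := w) = case_slot3 w y z"
  "(case_slot3 x y z)(Snd3 := w) = case_slot3 x w z" "(case_slot3 x y z)(Thd3 := w) = case_slot3 x y w"
  by (auto split: slot3.split)

lemma pure_tensor_add:
  "pure_tensor (f(i := x + y)) = pure_tensor (f(i := x)) + pure_tensor (f(i := y))"
  using pure_tensor_multilinear[of f i 1 x 1 y] by simp

lemma pure_tensor_scale: "pure_tensor (f(i := uea_scale c x)) = uea_power_scale c (pure_tensor (f(i := x)))"
  using pure_tensor_multilinear[of f i c x 0 x] by simp

lemma tensor2_bilinear:
  "tensor2 (x + x') y = tensor2 x y + tensor2 x' y"
  "tensor2 x (y + y') = tensor2 x y + tensor2 x y'"
  "tensor2 (uea_scale c x) y = uea_power_scale c (tensor2 x y)"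
  "tensor2 x (uea_scale c y) = uea_power_scale c (tensor2 x y)"
  using pure_tensor_add[of "case_slot2 x y" Fst2 x x'] pure_tensor_add[of "case_slot2 x y" Snd2 y y']
    pure_tensor_scale[of "case_slot2 x y" Fst2 c x] pure_tensor_scale[of "case_slot2 x y" Snd2 c y]
  by (simp_all add: tensor2_def case_slot2_upd)

lemma tensor3_trilinear:
  "tensor3 (x + x') y z = tensor3 x y z + tensor3 x' y z"
  "tensor3 x (y + y') z = tensor3 x y z + tensor3 x y' z"
  "tensor3 x y (z + z') = tensor3 x y z + tensor3 x y z'"
  "tensor3 (uea_scale c x) y z = uea_power_scale c (tensor3 x y z)"
  "tensor3 x (uea_scale c y) z = uea_power_scale c (tensor3 x y z)"
  "tensor3 x y (uea_scale c z) = uea_power_scale c (tensor3 x y z)"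
  using pure_tensor_add[of "case_slot3 x y z" Fst3 x x'] pure_tensor_add[of "case_slot3 x y z" Snd3 y y']
    pure_tensor_add[of "case_slot3 x y z" Thd3 z z']
    pure_tensor_scale[of "case_slot3 x y z" Fst3 c x] pure_tensor_scale[of "case_slot3 x y z" Snd3 c y]
    pure_tensor_scale[of "case_slot3 x y z" Thd3 c z]
  by (simp_all add: tensor3_def case_slot3_upd)

lemma tensor2_mult: "tensor2 x y * tensor2 x' y' = tensor2 (x * x') (y * y')"
proof -
  have "(\<lambda>i. case_slot2 x y i * case_slot2 x' y' i) = case_slot2 (x * x') (y * y')"
    by (auto split: slot2.split)
  then show ?thesis by (simp add: tensor2_def pure_tensor_mult)
qed

lemma tensor3_mult: "tensor3 x y z * tensor3 x' y' z' = tensor3 (x * x') (y * y') (z * z')"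
proof -
  have "(\<lambda>i. case_slot3 x y z i * case_slot3 x' y' z' i) = case_slot3 (x * x') (y * y') (z * z')"
    by (auto split: slot3.split)
  then show ?thesis by (simp add: tensor3_def pure_tensor_mult)
qed

lemma tensor2_one: "tensor2 1 1 = 1"
proof -
  have "case_slot2 1 1 = (\<lambda>_. 1 :: 'a uea)" by (auto split: slot2.split)
  then show ?thesis by (simp add: tensor2_def pure_tensor_one)
qed

lemma tensor3_one: "tensor3 1 1 1 = 1"
proof -
  have "case_slot3 1 1 1 = (\<lambda>_. 1 :: 'a uea)" by (auto split: slot3.split)
  then show ?thesis by (simp add: tensor3_def pure_tensor_one)
qed

text \<open>The linear map on \<open>U \<otimes> U\<close> induced by a bilinear map \<open>B\<close>; the choice of representative is
  immaterial for bilinear \<open>B\<close>, as the following lemmas show.\<close>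

definition tensor_lift ::
    "('a \<Rightarrow> 'v \<Rightarrow> 'v) \<Rightarrow> ('a uea \<Rightarrow> 'a uea \<Rightarrow> 'v) \<Rightarrow> 'a::field_char_0 uea2 \<Rightarrow> 'v::ab_group_add" where
  "tensor_lift s B z =
     lin_ext s (\<lambda>f. B (component f Fst2) (component f Snd2)) (rep_uea_power z)"

locale uea_bilinear = vector_space s for s :: "'a::field_char_0 \<Rightarrow> 'v::ab_group_add \<Rightarrow> 'v" +
  fixes B :: "'a uea \<Rightarrow> 'a uea \<Rightarrow> 'v"
  assumes add_left: "B (x + x') y = B x y + B x' y"
    and add_right: "B x (y + y') = B x y + B x y'"
    and scale_left: "B (uea_scale c x) y = s c (B x y)"
    and scale_right: "B x (uea_scale c y) = s c (B x y)"
begin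

lemma lin_ext_tensor_rel:
  assumes "tensor_rel p q"
  shows "lin_ext s (\<lambda>f. B (component f Fst2) (component f Snd2)) p =
    lin_ext s (\<lambda>f. B (component f Fst2) (component f Snd2)) q"
proof -
  have "lin_ext s (\<lambda>f. B (component f Fst2) (component f Snd2)) (p - q) = 0"
  proof (rule lin_ext_multilinear_relator[where F = "\<lambda>f. B (f Fst2) (f Snd2)"])
    show "B ((f(i := uea_scale a x + uea_scale b y)) Fst2) ((f(i := uea_scale a x + uea_scale b y)) Snd2)
        = s a (B ((f(i := x)) Fst2) ((f(i := x)) Snd2)) + s b (B ((f(i := y)) Fst2) ((f(i := y)) Snd2))"
      for f :: "slot2 \<Rightarrow> 'a uea" and i a x b y
      by (cases i) (simp_all add: add_left add_right scale_left scale_right)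
  qed (use assms vector_space_axioms in \<open>simp_all add: tensor_rel_def\<close>)
  then show ?thesis by simp
qed

lemma tensor_lift_abs:
  "tensor_lift s B (abs_uea_power p) = lin_ext s (\<lambda>f. B (component f Fst2) (component f Snd2)) p"
  unfolding tensor_lift_def
  by (rule lin_ext_tensor_rel) (rule Quotient_rep_abs[OF Quotient_uea_power], simp add: tensor_rel_def fscale.span_zero)

lemma tensor_lift_tensor2: "tensor_lift s B (tensor2 x y) = B x y"
  unfolding tensor2_def pure_tensor.abs_eq tensor_lift_abs by (simp add: free_tensor_def)

lemma tensor_lift_add: "tensor_lift s B (z + w) = tensor_lift s B z + tensor_lift s B w"
  by (induct z rule: uea_power.abs_induct, induct w rule: uea_power.abs_induct)
    (simp add: plus_uea_power.abs_eq tensor_lift_abs)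

lemma tensor_lift_scale: "tensor_lift s B (uea_power_scale c z) = s c (tensor_lift s B z)"
  by (induct z rule: uea_power.abs_induct) (simp add: uea_power_scale.abs_eq tensor_lift_abs)

end

definition tensor_flip :: "'a::field_char_0 uea2 \<Rightarrow> 'a uea2" where
  "tensor_flip = tensor_lift uea_power_scale (\<lambda>x y. tensor2 y x)"

text \<open>The canonical maps \<open>(U \<otimes> U) \<times> U \<rightarrow> U \<otimes> U \<otimes> U\<close> and \<open>U \<times> (U \<otimes> U) \<rightarrow> U \<otimes> U \<otimes> U\<close>.\<close>

definition join_left :: "'a::field_char_0 uea2 \<Rightarrow> 'a uea \<Rightarrow> 'a uea3" where
  "join_left w z = tensor_lift uea_power_scale (\<lambda>x y. tensor3 x y z) w"

definition join_right :: "'a::field_char_0 uea \<Rightarrow> 'a uea2 \<Rightarrow> 'a uea3" where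
  "join_right x w = tensor_lift uea_power_scale (\<lambda>y z. tensor3 x y z) w"


section \<open>The standard comultiplication and antipode\<close>

lemma vector_space_uea_scale: "vector_space uea_scale"
  by (rule uea.vector_space_axioms)

lemma vector_space_uea_power_scale: "vector_space uea_power_scale"
  by (rule uea_power.vector_space_axioms)

text \<open>On a word $b_1 \cdots b_k$ the comultiplication is the product of the
  $b_i \otimes 1 + 1 \otimes b_i$, the antipode is $(-b_k) \cdots (-b_1)$. Neither depends on the
  chosen representative in the tensor algebra.\<close>

definition uea_comult :: "'a::field_char_0 uea \<Rightarrow> 'a uea2" where
  "uea_comult u = lin_ext uea_power_scale
     (\<lambda>w. prod_list (map (\<lambda>b. tensor2 (uea_gen b) 1 + tensor2 1 (uea_gen b)) (letters w)))
     (rep_uea u)"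

definition uea_antipode :: "'a::field_char_0 uea \<Rightarrow> 'a uea" where
  "uea_antipode u = lin_ext uea_scale
     (\<lambda>w. prod_list (map (\<lambda>b. - uea_gen b) (rev (letters w)))) (rep_uea u)"

lemma uea_rel_rep_abs: "uea_rel (rep_uea (abs_uea p)) p"
  by (rule Quotient_rep_abs[OF Quotient_uea]) (simp add: uea_rel_def ideal_gen.zero)

lemma uea_comult_abs:
  fixes p :: "(sv_basis, 'a::field_char_0) tensor_algebra"
  shows "uea_comult (abs_uea p) = lin_ext uea_power_scale
     (\<lambda>w. prod_list (map (\<lambda>b. tensor2 (uea_gen b) 1 + tensor2 1 (uea_gen b)) (letters w))) p"
    and uea_comult_mult: "uea_comult (u * v) = uea_comult u * uea_comult (v :: 'a uea)"
    and uea_comult_of_sv: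
      "uea_comult (uea_of_sv x) = tensor2 (uea_of_sv x) 1 + tensor2 1 (uea_of_sv (x :: 'a sv))"
proof -
  let ?W = "\<lambda>w. prod_list (map (\<lambda>b. tensor2 (uea_gen b) 1 + tensor2 1 (uea_gen b)) (letters w)) :: 'a uea2"
  let ?f = "lin_ext uea_power_scale ?W"
  have mult: "?f (p * q) = ?f p * ?f q" for p q
    by (rule lin_ext_mult) (auto simp: vector_space_uea_power_scale uea_power_scale_mult_left
      uea_power_scale_mult_right)
  have sv: "?f (in_tensor_algebra x) = tensor2 (uea_of_sv x) 1 + tensor2 1 (uea_of_sv x)" for x
  proof (induction x rule: pm_induct)
    case (single b c)
    have "uea_of_sv (Poly_Mapping.single b c) = uea_scale c (uea_gen b)"
      unfolding uea_gen_def by (simp flip: uea_of_sv_scale)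
    then show ?case
      by (simp add: in_tensor_algebra_def tensor2_bilinear uea_power.scale_right_distrib)
  next
    case zero
    have "uea_of_sv (0 :: 'a sv) = 0" using uea_of_sv_add[of 0 "0 :: 'a sv"] by simp
    moreover have "tensor2 0 1 = (0 :: 'a uea2)" "tensor2 1 0 = (0 :: 'a uea2)"
      using tensor2_bilinear(1)[of 0 0 "1 :: 'a uea"] tensor2_bilinear(2)[of "1 :: 'a uea" 0 0] by auto
    ultimately show ?case by (simp add: in_tensor_algebra_def)
  qed (auto simp: in_tensor_algebra_def uea_of_sv_add tensor2_bilinear)
  have diff: "tensor2 (x - y) z = tensor2 x z - tensor2 y z" "tensor2 z (x - y) = tensor2 z x - tensor2 z y"
    for x y z :: "'a uea"
    using tensor2_bilinear(1)[of "x - y" y z] tensor2_bilinear(2)[of z "x - y" y]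
    by (simp_all add: algebra_simps)
  have rel: "?f r = 0" if "r \<in> uea_relators" for r
  proof -
    from that obtain x y where "r = in_tensor_algebra x * in_tensor_algebra y
        - in_tensor_algebra y * in_tensor_algebra x - in_tensor_algebra (sv_bracket x y)"
      by (auto simp: uea_relators_def)
    then show ?thesis
      by (simp add: mult sv distrib_left distrib_right tensor2_mult diff flip: uea_of_sv_bracket)
  qed
  have "?f r = 0" if "r \<in> ideal_gen uea_relators" for r
    using that by (induction rule: ideal_gen.induct) (simp_all add: rel mult)
  then have "?f (p - q) = 0" if "uea_rel p q" for p q
    using that unfolding uea_rel_def by blast
  then have eq: "?f p = ?f q" if "uea_rel p q" for p q
    using that uea_power.lin_ext_diff[of _ p q] by fastforce
  show abs: "uea_comult (abs_uea p) = ?f p" for p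
    unfolding uea_comult_def by (rule eq) (rule uea_rel_rep_abs)
  have "uea_comult (abs_uea p * abs_uea q) = ?f p * ?f q" for p q
    unfolding times_uea.abs_eq abs by (rule mult)
  then show "uea_comult (u * v) = uea_comult u * uea_comult v"
    by (induct u rule: uea.abs_induct, induct v rule: uea.abs_induct) (simp add: abs)
  show "uea_comult (uea_of_sv x) = tensor2 (uea_of_sv x) 1 + tensor2 1 (uea_of_sv x)"
    unfolding uea_of_sv.abs_eq abs by (rule sv[unfolded uea_of_sv.abs_eq])
qed

lemma uea_antipode_abs:
  fixes p :: "(sv_basis, 'a::field_char_0) tensor_algebra"
  shows "uea_antipode (abs_uea p) = lin_ext uea_scale
     (\<lambda>w. prod_list (map (\<lambda>b. - uea_gen b) (rev (letters w)))) p"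
    and uea_antipode_mult: "uea_antipode (u * v) = uea_antipode v * uea_antipode (u :: 'a uea)"
    and uea_antipode_of_sv: "uea_antipode (uea_of_sv x) = - uea_of_sv (x :: 'a sv)"
proof -
  let ?W = "\<lambda>w. prod_list (map (\<lambda>b. - uea_gen b) (rev (letters w))) :: 'a uea"
  let ?f = "lin_ext uea_scale ?W"
  have mult: "?f (p * q) = ?f q * ?f p" for p q
    by (rule lin_ext_anti_mult) (auto simp: vector_space_uea_scale uea_scale_mult_left
      uea_scale_mult_right)
  have sv: "?f (in_tensor_algebra x) = - uea_of_sv x" for x
  proof (induction x rule: pm_induct)
    case (single b c)
    have "uea_of_sv (Poly_Mapping.single b c) = uea_scale c (uea_gen b)"
      unfolding uea_gen_def by (simp flip: uea_of_sv_scale)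
    then show ?case
      by (simp add: in_tensor_algebra_def uea.scale_minus_right)
  next
    case zero
    have "uea_of_sv (0 :: 'a sv) = 0" using uea_of_sv_add[of 0 "0 :: 'a sv"] by simp
    then show ?case by (simp add: in_tensor_algebra_def)
  qed (auto simp: in_tensor_algebra_def uea_of_sv_add)
  have rel: "?f r = 0" if "r \<in> uea_relators" for r
    using that by (auto simp: uea_relators_def mult sv simp flip: uea_of_sv_bracket)
  have "?f r = 0" if "r \<in> ideal_gen uea_relators" for r
    using that by (induction rule: ideal_gen.induct) (simp_all add: rel mult)
  then have "?f (p - q) = 0" if "uea_rel p q" for p q
    using that unfolding uea_rel_def by blast
  then have eq: "?f p = ?f q" if "uea_rel p q" for p q
    using that uea.lin_ext_diff[of _ p q] by fastforce
  show abs: "uea_antipode (abs_uea p) = ?f p" for p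
    unfolding uea_antipode_def by (rule eq) (rule uea_rel_rep_abs)
  have "uea_antipode (abs_uea p * abs_uea q) = ?f q * ?f p" for p q
    unfolding times_uea.abs_eq abs by (rule mult)
  then show "uea_antipode (u * v) = uea_antipode v * uea_antipode u"
    by (induct u rule: uea.abs_induct, induct v rule: uea.abs_induct) (simp add: abs)
  show "uea_antipode (uea_of_sv x) = - uea_of_sv x"
    unfolding uea_of_sv.abs_eq abs by (rule sv[unfolded uea_of_sv.abs_eq])
qed


section \<open>Formal power series with coefficients in a vector space\<close>

text \<open>The \<open>t\<close>-adically continuous extension of a bilinear map to formal power series. Taking for
  \<open>b\<close> a scaling yields the module structure over the power series ring; taking \<open>tensor2\<close> yields
  the completed tensor product of two power series.\<close>

definition fps_conv :: "('u \<Rightarrow> 'v \<Rightarrow> 'w) \<Rightarrow> 'u fps \<Rightarrow> 'v fps \<Rightarrow> 'w::comm_monoid_add fps" where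
  "fps_conv b f g = Abs_fps (\<lambda>n. \<Sum>i=0..n. b (fps_nth f i) (fps_nth g (n - i)))"

definition fps_map :: "('u \<Rightarrow> 'v) \<Rightarrow> 'u fps \<Rightarrow> 'v fps" where
  "fps_map \<phi> f = Abs_fps (\<lambda>n. \<phi> (fps_nth f n))"

lemma fps_conv_nth: "fps_nth (fps_conv b f g) n = (\<Sum>i=0..n. b (fps_nth f i) (fps_nth g (n - i)))"
  by (simp add: fps_conv_def)

lemma fps_map_nth [simp]: "fps_nth (fps_map \<phi> f) n = \<phi> (fps_nth f n)"
  by (simp add: fps_map_def)

lemma (in module) module_fps_conv: "module (fps_conv scale)"
proof
  fix a b :: "'a fps" and x y :: "'b fps"
  show "fps_conv scale a (x + y) = fps_conv scale a x + fps_conv scale a y"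
    by (simp add: fps_eq_iff fps_conv_nth scale_right_distrib sum.distrib)
  show "fps_conv scale (a + b) x = fps_conv scale a x + fps_conv scale b x"
    by (simp add: fps_eq_iff fps_conv_nth scale_left_distrib sum.distrib)
  show "fps_conv scale a (fps_conv scale b x) = fps_conv scale (a * b) x"
  proof (rule fps_ext)
    fix n
    have "(\<Sum>j=0..n. \<Sum>i=0..j. scale (fps_nth a i * fps_nth b (j - i)) (fps_nth x (n - j))) =
          (\<Sum>j=0..n. \<Sum>i=0..n - j. scale (fps_nth a j * fps_nth b i) (fps_nth x (n - j - i)))"
      by (rule fps_mult_assoc_lemma)
    then show "fps_nth (fps_conv scale a (fps_conv scale b x)) n = fps_nth (fps_conv scale (a * b) x) n"
      by (simp add: fps_conv_nth fps_mult_nth scale_sum_right scale_sum_left)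
  qed
  show "fps_conv scale 1 x = x"
  proof (rule fps_ext)
    fix n
    have "(\<Sum>i=0..n. scale (fps_nth 1 i) (fps_nth x (n - i))) = (\<Sum>i=0..n. if i = 0 then fps_nth x n else 0)"
      by (rule sum.cong) auto
    then show "fps_nth (fps_conv scale 1 x) n = fps_nth x n"
      by (simp add: fps_conv_nth)
  qed
qed

lemma fps_conv_const_nth [simp]:
  assumes "\<And>y. b 0 y = (0::'w::comm_monoid_add)"
  shows "fps_nth (fps_conv b (fps_const c) g) n = b c (fps_nth g n)"
proof -
  have "(\<Sum>i=0..n. b (fps_nth (fps_const c) i) (fps_nth g (n - i))) = (\<Sum>i=0..n. if i = 0 then b c (fps_nth g n) else 0)"
    by (rule sum.cong) (auto simp: assms)
  then show ?thesis by (simp add: fps_conv_nth)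
qed

abbreviation uea_fps_scale :: "'a::field_char_0 fps \<Rightarrow> 'a uea fps \<Rightarrow> 'a uea fps" where
  "uea_fps_scale \<equiv> fps_conv uea_scale"

abbreviation uea2_fps_scale :: "'a::field_char_0 fps \<Rightarrow> 'a uea2 fps \<Rightarrow> 'a uea2 fps" where
  "uea2_fps_scale \<equiv> fps_conv uea_power_scale"

abbreviation tensor_fps :: "'a::field_char_0 uea fps \<Rightarrow> 'a uea fps \<Rightarrow> 'a uea2 fps" (infixl \<open>\<otimes>\<^sub>t\<close> 67) where
  "f \<otimes>\<^sub>t g \<equiv> fps_conv tensor2 f g"

text \<open>The linear map from \<open>(U \<otimes> U)[[t]]\<close>, the completed tensor square of \<open>U[[t]]\<close>, that a bilinear
  map \<open>B\<close> on \<open>U[[t]]\<close> induces (everything over the power series ring).\<close>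

definition tensor_fps_lift ::
    "('a \<Rightarrow> 'v \<Rightarrow> 'v) \<Rightarrow> ('a uea fps \<Rightarrow> 'a uea fps \<Rightarrow> 'v fps) \<Rightarrow>
     'a::field_char_0 uea2 fps \<Rightarrow> 'v::ab_group_add fps" where
  "tensor_fps_lift s B z = Abs_fps (\<lambda>n. \<Sum>i=0..n.
     fps_nth (tensor_lift (\<lambda>c. fps_conv s (fps_const c)) (\<lambda>x y. B (fps_const x) (fps_const y))
       (fps_nth z i)) (n - i))"

lemma (in module) fps_conv_X_nth:
  "fps_nth (fps_conv scale fps_X x) n = (if n = 0 then 0 else fps_nth x (n - 1))"
proof -
  have "(\<Sum>i=0..n. scale (fps_nth fps_X i) (fps_nth x (n - i))) =
      (\<Sum>i=0..n. if i = 1 then fps_nth x (n - 1) else 0)"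
    by (rule sum.cong) (auto simp: fps_X_def)
  then show ?thesis by (simp add: fps_conv_nth)
qed

lemma module_hom_fps_nth:
  assumes "module s" "module s'" "module_hom (fps_conv s) (fps_conv s') \<phi>"
  shows "fps_nth (\<phi> f) n = (\<Sum>i=0..n. fps_nth (\<phi> (fps_const (fps_nth f i))) (n - i))"
proof -
  interpret s: module s by fact
  interpret s': module s' by fact
  interpret m: module_hom "fps_conv s" "fps_conv s'" \<phi> by fact
  have "f = fps_const (fps_nth f 0) + fps_conv s fps_X (Abs_fps (\<lambda>n. fps_nth f (Suc n)))" for f
    by (rule fps_ext) (simp add: s.fps_conv_X_nth)
  then have \<phi>: "\<phi> f = \<phi> (fps_const (fps_nth f 0)) + fps_conv s' fps_X (\<phi> (Abs_fps (\<lambda>n. fps_nth f (Suc n))))" for f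
    by (metis m.add m.scale)
  show ?thesis
  proof (induction n arbitrary: f)
    case 0
    show ?case by (subst \<phi>) (simp add: s'.fps_conv_X_nth)
  next
    case (Suc n)
    show ?case
      by (subst \<phi>) (simp add: s'.fps_conv_X_nth Suc.IH sum.atLeast0_atMost_Suc_shift del: sum.cl_ivl_Suc)
  qed
qed

lemma tensor_fps_lift_tensor:
  fixes s :: "'a::field_char_0 \<Rightarrow> 'v::ab_group_add \<Rightarrow> 'v"
  assumes "vector_space s"
    and left: "\<And>g. module_hom uea_fps_scale (fps_conv s) (\<lambda>f. B f g)"
    and right: "\<And>f. module_hom uea_fps_scale (fps_conv s) (B f)"
  shows "tensor_fps_lift s B (f \<otimes>\<^sub>t g) = B f g"
proof (rule fps_ext)
  fix n
  interpret s: vector_space s by fact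
  interpret fs: module "fps_conv s" by (rule s.module_fps_conv)
  interpret l: module_hom uea_fps_scale "fps_conv s" "\<lambda>f. B f g" for g by (rule left)
  interpret r: module_hom uea_fps_scale "fps_conv s" "B f" for f by (rule right)
  have const: "fps_const (uea_scale c x) = uea_fps_scale (fps_const c) (fps_const x)" for c :: 'a and x
    by (rule fps_ext) simp
  interpret b: uea_bilinear "\<lambda>c. fps_conv s (fps_const c)" "\<lambda>x y. B (fps_const x) (fps_const y)"
    by unfold_locales
      (simp_all add: fs.scale_right_distrib fs.scale_left_distrib l.add r.add const l.scale r.scale
        flip: fps_const_add fps_const_mult)
  have sum: "tensor_lift (\<lambda>c. fps_conv s (fps_const c)) (\<lambda>x y. B (fps_const x) (fps_const y)) (\<Sum>i\<in>A. z i)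
     = (\<Sum>i\<in>A. tensor_lift (\<lambda>c. fps_conv s (fps_const c)) (\<lambda>x y. B (fps_const x) (fps_const y)) (z i))"
    if "finite A" for A :: "nat set" and z
    using that
  proof (induction A rule: finite_induct)
    case empty
    show ?case using b.tensor_lift_add[of 0 0] by simp
  qed (simp add: b.tensor_lift_add)
  have "fps_nth (tensor_fps_lift s B (f \<otimes>\<^sub>t g)) n = (\<Sum>k=0..n. \<Sum>i=0..k.
      fps_nth (B (fps_const (fps_nth f i)) (fps_const (fps_nth g (k - i)))) (n - k))"
    by (simp add: tensor_fps_lift_def fps_conv_nth[of tensor2] sum b.tensor_lift_tensor2 fps_sum_nth)
  also have "\<dots> = (\<Sum>k=0..n. \<Sum>i=0..n - k.
      fps_nth (B (fps_const (fps_nth f k)) (fps_const (fps_nth g i))) (n - k - i))"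
    by (rule fps_mult_assoc_lemma)
  also have "\<dots> = (\<Sum>k=0..n. fps_nth (B (fps_const (fps_nth f k)) g) (n - k))"
    by (subst module_hom_fps_nth[OF uea.module_axioms s.module_axioms right]) simp
  also have "\<dots> = fps_nth (B f g) n"
    by (rule module_hom_fps_nth[OF uea.module_axioms s.module_axioms left, symmetric])
  finally show "fps_nth (tensor_fps_lift s B (f \<otimes>\<^sub>t g)) n = fps_nth (B f g) n" .
qed


section \<open>Topological Hopf algebra structures on the power series over the enveloping algebra\<close>

definition fps_unit :: "'a::field_char_0 fps \<Rightarrow> 'a uea fps" where
  "fps_unit c = uea_fps_scale c 1"

definition fps_counit :: "'a::field_char_0 uea fps \<Rightarrow> 'a fps" where
  "fps_counit = fps_map uea_counit"

text \<open>The algebra structure is that of the ring \<open>'a uea fps\<close>, with unit map \<open>fps_unit\<close>. The last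
  five conditions are coassociativity, the two counit laws and the two antipode laws.\<close>

definition topological_hopf_algebra ::
    "('a::field_char_0 uea fps \<Rightarrow> 'a uea2 fps) \<Rightarrow> ('a uea fps \<Rightarrow> 'a uea fps) \<Rightarrow>
     ('a uea fps \<Rightarrow> 'a fps) \<Rightarrow> bool" where
  "topological_hopf_algebra \<Delta> S \<epsilon> \<longleftrightarrow>
     module_hom uea_fps_scale uea2_fps_scale \<Delta> \<and> \<Delta> 1 = 1 \<and> (\<forall>f g. \<Delta> (f * g) = \<Delta> f * \<Delta> g) \<and>
     module_hom uea_fps_scale (*) \<epsilon> \<and> \<epsilon> 1 = 1 \<and> (\<forall>f g. \<epsilon> (f * g) = \<epsilon> f * \<epsilon> g) \<and>
     module_hom uea_fps_scale uea_fps_scale S \<and> S 1 = 1 \<and> (\<forall>f g. S (f * g) = S g * S f) \<and>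
     (\<forall>f. tensor_fps_lift uea_power_scale (\<lambda>x y. fps_conv join_left (\<Delta> x) y) (\<Delta> f) =
          tensor_fps_lift uea_power_scale (\<lambda>x y. fps_conv join_right x (\<Delta> y)) (\<Delta> f)) \<and>
     (\<forall>f. tensor_fps_lift uea_scale (\<lambda>x y. fps_unit (\<epsilon> x) * y) (\<Delta> f) = f) \<and>
     (\<forall>f. tensor_fps_lift uea_scale (\<lambda>x y. x * fps_unit (\<epsilon> y)) (\<Delta> f) = f) \<and>
     (\<forall>f. tensor_fps_lift uea_scale (\<lambda>x y. S x * y) (\<Delta> f) = fps_unit (\<epsilon> f)) \<and>
     (\<forall>f. tensor_fps_lift uea_scale (\<lambda>x y. x * S y) (\<Delta> f) = fps_unit (\<epsilon> f))"

definition noncocommutative :: "('a::field_char_0 uea fps \<Rightarrow> 'a uea2 fps) \<Rightarrow> bool" where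
  "noncocommutative \<Delta> \<longleftrightarrow> (\<exists>f. fps_map tensor_flip (\<Delta> f) \<noteq> \<Delta> f)"

text \<open>The coset \<open>f + t A[[t]]\<close>.\<close>

definition t_coset :: "'r::ring_1 fps \<Rightarrow> 'r fps set" where
  "t_coset f = {f + fps_X * g | g. True}"

text \<open>The Hopf algebra induced by \<open>\<Delta>\<close>, \<open>S\<close>, \<open>\<epsilon>\<close> on \<open>U[[t]] / t U[[t]]\<close> is \<open>U\<close> with its standard
  structure: \<open>\<phi>\<close> is an isomorphism of algebras which restricts to the identity on \<open>U\<close>, \<open>\<psi>\<close> is
  \<open>\<phi> \<otimes> \<phi>\<close>, and they intertwine the comultiplications, antipodes and counits.\<close>

definition reduces_to_standard ::
    "('a::field_char_0 uea fps \<Rightarrow> 'a uea2 fps) \<Rightarrow> ('a uea fps \<Rightarrow> 'a uea fps) \<Rightarrow>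
     ('a uea fps \<Rightarrow> 'a fps) \<Rightarrow> bool" where
  "reduces_to_standard \<Delta> S \<epsilon> \<longleftrightarrow>
     (\<exists>(\<phi> :: 'a uea fps set \<Rightarrow> 'a uea) (\<psi> :: 'a uea2 fps set \<Rightarrow> 'a uea2).
        bij_betw \<phi> (range t_coset) UNIV \<and>
        (\<forall>f g. \<phi> (t_coset (f + g)) = \<phi> (t_coset f) + \<phi> (t_coset g)) \<and>
        (\<forall>f g. \<phi> (t_coset (f * g)) = \<phi> (t_coset f) * \<phi> (t_coset g)) \<and>
        (\<forall>c f. \<phi> (t_coset (uea_fps_scale c f)) = uea_scale (fps_nth c 0) (\<phi> (t_coset f))) \<and>
        (\<forall>u. \<phi> (t_coset (fps_const u)) = u) \<and>
        bij_betw \<psi> (range t_coset) UNIV \<and>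
        (\<forall>z w. \<psi> (t_coset (z + w)) = \<psi> (t_coset z) + \<psi> (t_coset w)) \<and>
        (\<forall>f g. \<psi> (t_coset (f \<otimes>\<^sub>t g)) = tensor2 (\<phi> (t_coset f)) (\<phi> (t_coset g))) \<and>
        (\<forall>f. \<psi> (t_coset (\<Delta> f)) = uea_comult (\<phi> (t_coset f))) \<and>
        (\<forall>f. \<phi> (t_coset (S f)) = uea_antipode (\<phi> (t_coset f))) \<and>
        (\<forall>f. fps_nth (\<epsilon> f) 0 = uea_counit (\<phi> (t_coset f))))"

text \<open>$(1 - et)^c$\<close>

definition one_minus_et_powr :: "'a::field_char_0 uea \<Rightarrow> 'a \<Rightarrow> 'a uea fps" where
  "one_minus_et_powr e c = Abs_fps (\<lambda>m. uea_scale ((- 1) ^ m * (c gchoose m)) (e ^ m))"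

end

theory Submission
  imports Defs
begin

text \<open>Twisting by the Jordanian element $F = (1 - (1 \otimes e)t)^{h \otimes 1}$: the comultiplication is
  $\Delta(f) = F \Delta_0(f) F^{-1}$ and the antipode is $S(f) = v S_0(f) v^{-1}$ with $v = \exp(t h e)$.
  Then $\Delta$ and $S$ are (anti)homomorphisms by construction, coassociativity reduces to the cocycle
  identity of $F$, and the antipode laws hold because $v$ and $v^{-1}$ are the contractions
  $m(id \otimes S_0)(F)$ and $m(S_0 \otimes id)(F^{-1})$. The cocycle identity and the formulas on the
  generators are identities between power series over a noncommutative algebra; both sides solve the
  same linear differential equation in $t$ with the same initial value. Only finitely many terms occur
  in the formulas since $(ad\, e)^3$ vanishes on the generators.\<close>

section \<open>Power series over a noncommutative algebra\<close>

text \<open>The obstacle is ordering. In F the exponent h \<otimes> 1 and the base 1 \<otimes> e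
  commute, so F is a genuine power and negating the exponent inverts it. Contracting F into one copy
  of U brings h and e together, where [h,e] = e; the ordered series is then no longer a power but an
  exponential, inverted by negating e. \<open>twist\<close> covers both cases because it fixes the
  order.

  The conjugation identities would be convolution sums in falling factorials coefficient by
  coefficient. As differential equations they rest on one commutator: with i = (1 - Et)^{-1} and K =
  E i, [K,y] = i [E,y] i.

  The constants come from the terms k = 0, 1, 2 of F (1 \<otimes> X) F^{-1} = sum over k of
  (-1)^k/k! h^{(k)} \<otimes> (1 - et)^{-k} (ad e)^k(X) t^k. The h^{(2)} term thus carries half of
  (ad e)^2(X), which for L_n is n(n - n_0)/4 M_{n + n_0}. The other summand F (X \<otimes> 1) F^{-1}
  sees only the weight of X under ad h, which becomes the exponent of 1 - et.\<close>

locale scalar_algebra = vector_space s for s :: "'a::field_char_0 \<Rightarrow> 'r::ring_1 \<Rightarrow> 'r" +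
  assumes scale_mult_left: "s c x * y = s c (x * y)"
    and scale_mult_right: "x * s c y = s c (x * y)"
begin

lemma of_nat_mult_eq_scale: "of_nat n * x = s (of_nat n) x"
  by (induction n) (simp_all add: scale_left_distrib distrib_right)

text \<open>Characteristic zero enters the uniqueness of solutions here: a derivative determines all
  coefficients but the constant one.\<close>

lemma of_nat_Suc_mult_eq_0: "of_nat (Suc n) * (x :: 'r) = 0 \<Longrightarrow> x = 0"
  unfolding of_nat_mult_eq_scale scale_eq_0_iff by (simp del: of_nat_Suc)

text \<open>Up to the factor n + 1, the coefficient of D at n + 1 is the coefficient of A D + D B at
  n, which involves only coefficients of D up to n. Hence a zero initial value propagates.\<close>

lemma ode_unique_0:
  fixes D A B :: "'r fps"
  assumes ode: "fps_deriv D = A * D + D * B" and D0: "fps_nth D 0 = 0"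
  shows "D = 0"
proof -
  have "\<forall>m\<le>n. fps_nth D m = 0" for n
  proof (induction n)
    case (Suc n)
    have "of_nat (Suc n) * fps_nth D (Suc n) = fps_nth (A * D + D * B) n"
      by (simp flip: ode)
    also have "\<dots> = 0"
      using Suc.IH by (simp add: fps_mult_nth)
    finally show ?case
      using of_nat_Suc_mult_eq_0 Suc.IH le_Suc_eq by metis
  qed (simp add: D0)
  then show ?thesis by (intro fps_ext) auto
qed

lemma ode_unique:
  fixes A B G G' :: "'r fps"
  assumes "fps_deriv G = A * G + G * B" "fps_deriv G' = A * G' + G' * B" "fps_nth G 0 = fps_nth G' 0"
  shows "G = G'"
proof -
  have "G - G' = 0"
    by (rule ode_unique_0[of _ A B]) (simp_all add: assms algebra_simps)
  then show ?thesis by simp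
qed

lemmas ode_unique_left = ode_unique[where B = 0, simplified]

end

section \<open>Ordered binomial series and the geometric series\<close>

definition falling_prod :: "'r::ring_1 \<Rightarrow> nat \<Rightarrow> 'r" where
  "falling_prod x m = prod_list (map (\<lambda>i. x - of_nat i) [0..<m])"

lemma falling_prod_0 [simp]: "falling_prod x 0 = 1"
  and falling_prod_Suc: "falling_prod x (Suc m) = falling_prod x m * (x - of_nat m)"
  by (simp_all add: falling_prod_def)

lemma mult_assoc_eq: "x * y = z \<Longrightarrow> x * (y * w) = z * (w :: 'r::semigroup_mult)"
  by (simp flip: mult.assoc)

lemma commute_of_nat_diff:
  fixes a H :: "'r::ring_1"
  assumes "a * H = H * a"
  shows "a * (H - of_nat m) = (H - of_nat m) * a"
  by (metis assms left_diff_distrib mult_of_nat_commute right_diff_distrib)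

lemma commute_falling_prod:
  fixes a H :: "'r::ring_1"
  assumes "a * H = H * a"
  shows "a * falling_prod H m = falling_prod H m * a"
proof (induction m)
  case (Suc m)
  show ?case
    by (metis Suc commute_of_nat_diff[OF assms] falling_prod_Suc mult.assoc)
qed simp

lemma commute_power:
  fixes a E :: "'r::ring_1"
  assumes "a * E = E * a"
  shows "a * E ^ m = E ^ m * a"
  using assms by (metis power_commuting_commutes)

text \<open>\<open>twist s H E\<close> is $(1 - Et)^H$ with the powers of \<open>E\<close> written to the right of
  the binomial coefficients in \<open>H\<close>; the two need not commute.\<close>

definition twist :: "('a::field_char_0 \<Rightarrow> 'r \<Rightarrow> 'r) \<Rightarrow> 'r \<Rightarrow> 'r \<Rightarrow> 'r::ring_1 fps" where
  "twist s H E = Abs_fps (\<lambda>m. s ((- 1) ^ m / fact m) (falling_prod H m * E ^ m))"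

definition geometric :: "'r::ring_1 \<Rightarrow> 'r fps" where
  "geometric E = Abs_fps (\<lambda>m. E ^ m)"

lemma geometric_eq: "geometric E = 1 + fps_X * (fps_const E * geometric E)"
  by (rule fps_ext) (auto simp: geometric_def simp flip: power_Suc)

lemma geometric_commute: "fps_const E * geometric E = geometric E * fps_const E"
  by (rule fps_ext) (simp add: geometric_def power_commutes)

lemma fps_commute_X: "x * fps_X = fps_X * (x :: 'r::ring_1 fps)"
  by (rule fps_mult_fps_X_commute[symmetric])

lemma fps_commute_X_assoc: "x * (fps_X * y) = fps_X * (x * y :: 'r::ring_1 fps)"
  by (metis fps_commute_X mult.assoc)

lemma geometric_inverse:
  "geometric E * (1 - fps_X * fps_const E) = 1" "(1 - fps_X * fps_const E) * geometric E = 1"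
proof -
  show *: "(1 - fps_X * fps_const E) * geometric E = 1"
    by (simp only: left_diff_distrib mult_1_left mult.assoc) (metis add_diff_cancel_right' geometric_eq)
  show "geometric E * (1 - fps_X * fps_const E) = 1"
    using * by (simp add: algebra_simps geometric_commute fps_commute_X_assoc)
qed

lemma fps_deriv_geometric: "fps_deriv (geometric E) = fps_const E * geometric E * geometric E"
proof -
  let ?i = "geometric E" and ?K = "fps_const E * geometric E"
  have "(1 - fps_X * fps_const E) * fps_deriv ?i = ?K"
    by (simp only: left_diff_distrib mult_1_left mult.assoc) (subst geometric_eq, simp add: algebra_simps)
  then have "?i * ((1 - fps_X * fps_const E) * fps_deriv ?i) = ?i * ?K"
    by simp
  then show ?thesis
    by (simp only: mult.assoc[symmetric] geometric_inverse mult_1_left) (simp only: geometric_commute)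
qed

text \<open>The hypotheses say that \<open>t\<close> is central and $i = (1 - te)^{-1}$.\<close>

lemma resolvent_commutator:
  fixes e t i y :: "'r::ring_1"
  assumes t: "\<And>x. x * t = t * x" and i: "i = 1 + t * (e * i)" and c: "e * i = i * e"
  shows "e * i * y = y * (e * i) + i * (e * y - y * e) * i"
proof -
  define K where "K = e * i"
  have t': "x * (t * z) = t * (x * z)" for x z by (metis t mult.assoc)
  have "i * (e * y - y * e) * i = K * y * i - i * y * K"
    by (simp add: K_def algebra_simps c)
  also have "\<dots> = K * y * (1 + t * K) - (1 + t * K) * y * K"
    using i unfolding K_def by simp
  also have "\<dots> = K * y - y * K"
    by (simp add: algebra_simps t')
  finally show ?thesis
    by (simp add: K_def)
qed

section \<open>The series (1 - Et)^H for commuting H and E\<close>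

context scalar_algebra
begin

lemma twist_nth_0 [simp]: "fps_nth (twist s H E) 0 = 1"
  by (simp add: twist_def)

lemma twist_nth_Suc:
  "of_nat (Suc m) * fps_nth (twist s H E) (Suc m)
     = - s ((- 1) ^ m / fact m) (falling_prod H m * (H - of_nat m) * E ^ Suc m)"
proof -
  have "of_nat (Suc m) * ((- 1) ^ Suc m / fact (Suc m)) = (- (((- 1) ^ m / fact m)) :: 'a)"
    by (simp del: of_nat_Suc)
  then have "s (of_nat (Suc m) * ((- 1) ^ Suc m / fact (Suc m))) x = - s ((- 1) ^ m / fact m) x" for x
    by (simp only: scale_minus_left)
  then show ?thesis
    unfolding twist_def of_nat_mult_eq_scale fps_nth_Abs_fps scale_scale falling_prod_Suc .
qed

lemma twist_nth_commute:
  assumes "a * H = H * a" "a * E = E * a"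
  shows "a * fps_nth (twist s H E) m = fps_nth (twist s H E) m * a"
proof -
  have "a * (falling_prod H m * E ^ m) = falling_prod H m * E ^ m * a"
    using commute_falling_prod[OF assms(1)] commute_power[OF assms(2)] by (metis mult.assoc)
  then show ?thesis
    by (simp add: twist_def scale_mult_right scale_mult_left)
qed

lemma twist_commute:
  assumes H: "G * fps_const H = fps_const H * G" and E: "G * fps_const E = fps_const E * G"
  shows "G * twist s H E = twist s H E * G"
proof (rule fps_ext)
  fix n
  have "fps_nth G m * H = H * fps_nth G m" "fps_nth G m * E = E * fps_nth G m" for m
    using arg_cong[OF H, of "\<lambda>f. fps_nth f m"] arg_cong[OF E, of "\<lambda>f. fps_nth f m"] by simp_all
  then have c: "fps_nth G k * fps_nth (twist s H E) m = fps_nth (twist s H E) m * fps_nth G k" for k m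
    by (rule twist_nth_commute)
  have "fps_nth (G * twist s H E) n = (\<Sum>i=0..n. fps_nth (twist s H E) (n - i) * fps_nth G i)"
    by (simp add: fps_mult_nth c)
  also have "\<dots> = fps_nth (twist s H E * G) n"
    unfolding fps_mult_nth by (subst sum.atLeastAtMost_rev) (auto intro: sum.cong)
  finally show "fps_nth (G * twist s H E) n = fps_nth (twist s H E * G) n" .
qed

lemma geometric_commute_const:
  assumes "H * E = E * H"
  shows "fps_const H * geometric E = geometric E * fps_const H"
  by (rule fps_ext) (simp add: geometric_def commute_power[OF assms])

text \<open>The coefficients satisfy (m + 1) F_{m+1} = -(H - m) E F_m, which says (1 - Et) F' = -H E
  F. Multiplying by the geometric series solves this for F'.\<close>

lemma fps_deriv_twist:
  assumes "H * E = E * H"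
  shows "fps_deriv (twist s H E) = - (fps_const H * (fps_const E * geometric E)) * twist s H E"
proof -
  let ?F = "twist s H E" and ?q = "1 - fps_X * fps_const E"
  have rec: "of_nat (Suc m) * fps_nth ?F (Suc m) = - ((H - of_nat m) * E * fps_nth ?F m)" for m
  proof -
    have a: "falling_prod H m * (H - of_nat m) = (H - of_nat m) * falling_prod H m"
      by (rule commute_of_nat_diff) (rule commute_falling_prod[OF refl, symmetric])
    have b: "falling_prod H m * E = E * falling_prod H m"
      by (rule commute_falling_prod[OF assms[symmetric], symmetric])
    have "falling_prod H m * (H - of_nat m) * E ^ Suc m = (H - of_nat m) * (falling_prod H m * E) * E ^ m"
      unfolding a by (simp add: mult.assoc)
    also have "\<dots> = (H - of_nat m) * E * (falling_prod H m * E ^ m)"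
      unfolding b by (simp add: mult.assoc)
    finally show ?thesis
      by (simp only: twist_nth_Suc) (simp add: twist_def scale_mult_right)
  qed
  have "fps_deriv ?F = fps_X * (fps_const E * fps_deriv ?F) - fps_const (H * E) * ?F"
  proof (rule fps_ext)
    fix n
    have "E * (of_nat n * x) = of_nat n * (E * x)" for x
      by (metis mult.assoc mult_of_nat_commute)
    moreover have "fps_nth (fps_deriv ?F) n = of_nat n * (E * fps_nth ?F n) - H * (E * fps_nth ?F n)"
      by (simp only: fps_deriv_nth rec add_Suc_right add_0_right One_nat_def left_diff_distrib mult.assoc minus_diff_eq)
    ultimately show "fps_nth (fps_deriv ?F) n =
        fps_nth (fps_X * (fps_const E * fps_deriv ?F) - fps_const (H * E) * ?F) n"
      by (cases n) (simp_all add: mult.assoc del: of_nat_Suc)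
  qed
  then have "?q * fps_deriv ?F = - (fps_const (H * E) * ?F)"
    by (simp only: left_diff_distrib mult_1_left mult.assoc diff_eq_eq) simp
  then have "geometric E * (?q * fps_deriv ?F) = - (geometric E * (fps_const (H * E) * ?F))"
    by simp
  moreover have "geometric E * fps_const (H * E) = fps_const H * (fps_const E * geometric E)"
    unfolding geometric_commute fps_const_mult[symmetric] mult.assoc[symmetric]
      geometric_commute_const[OF assms] ..
  ultimately show ?thesis
    by (simp only: mult.assoc[symmetric] geometric_inverse mult_1_left mult_minus_left)
qed

text \<open>The equation for the exponent H + H' is also satisfied by the product, since H' E (1 -
  Et)^{-1} can be moved across the first factor. This takes the place of a Vandermonde
  convolution.\<close>

lemma twist_mult:
  assumes c: "H * E = E * H" "H' * E = E * H'" "H * H' = H' * H"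
  shows "twist s H E * twist s H' E = twist s (H + H') E"
proof -
  let ?K = "fps_const E * geometric E"
  have rules: "geometric E * fps_const H = fps_const H * geometric E"
      "fps_const E * fps_const H = fps_const H * fps_const E"
      "fps_const H' * fps_const H = fps_const H * fps_const H'"
      "geometric E * fps_const E = fps_const E * geometric E"
      "fps_const H' * fps_const E = fps_const E * fps_const H'"
    using geometric_commute_const[OF c(1)] by (simp_all add: c geometric_commute)
  have comm: "fps_const H' * ?K * twist s H E = twist s H E * (fps_const H' * ?K)"
    by (rule twist_commute) (simp_all only: mult.assoc rules rules[THEN mult_assoc_eq])
  have cH: "(H + H') * E = E * (H + H')"
    by (simp add: c algebra_simps)
  show ?thesis
  proof (rule ode_unique_left[where A = "- (fps_const (H + H') * ?K)"])
    show "fps_deriv (twist s (H + H') E) = - (fps_const (H + H') * ?K) * twist s (H + H') E"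
      by (rule fps_deriv_twist[OF cH])
    have "fps_deriv (twist s H E * twist s H' E) =
        - (twist s H E * (fps_const H' * ?K) * twist s H' E) - fps_const H * ?K * twist s H E * twist s H' E"
      unfolding fps_deriv_mult fps_deriv_twist[OF c(1)] fps_deriv_twist[OF c(2)]
      by (simp only: mult_minus_left mult_minus_right mult.assoc diff_conv_add_uminus)
    also have "\<dots> = - (fps_const (H + H') * ?K) * (twist s H E * twist s H' E)"
      unfolding comm[symmetric] by (simp add: algebra_simps flip: fps_const_add)
    finally show "fps_deriv (twist s H E * twist s H' E)
        = - (fps_const (H + H') * ?K) * (twist s H E * twist s H' E)" .
  qed simp
qed

lemma twist_zero [simp]: "twist s 0 E = 1"
  by (rule ode_unique_left[where A = 0]) (simp_all add: fps_deriv_twist)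

lemma twist_inverse:
  assumes "H * E = E * H"
  shows "twist s H E * twist s (- H) E = 1" "twist s (- H) E * twist s H E = 1"
  using twist_mult[of H E "- H"] twist_mult[of "- H" E H] assms by simp_all

lemma twist_minus_1: "twist s (- 1) E = geometric E"
proof (rule ode_unique_left[where A = "fps_const E * geometric E"])
  have "- fps_const (- 1 :: 'r) = 1"
    by simp
  then show "fps_deriv (twist s (- 1) E) = fps_const E * geometric E * twist s (- 1) E"
    by (simp only: fps_deriv_twist mult_minus_left[symmetric] mult_1_left mult_minus1 mult_minus1_right)
qed (simp_all only: fps_deriv_geometric twist_nth_0, simp add: geometric_def)

lemma twist_1: "twist s 1 E = 1 - fps_X * fps_const E"
proof -
  have "geometric E * twist s 1 E = 1"
    using twist_inverse(2)[of 1 E] by (simp add: twist_minus_1)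
  then have "(1 - fps_X * fps_const E) * (geometric E * twist s 1 E) = 1 - fps_X * fps_const E"
    by simp
  then show ?thesis
    by (simp only: mult.assoc[symmetric] geometric_inverse mult_1_left)
qed

end

lemma commutator_rule: "x * y - y * x = (z :: 'r::ring_1) \<Longrightarrow> x * y = y * x + z"
  by (simp add: algebra_simps)

lemma mult_assoc_add_eq: "x * y = u + v \<Longrightarrow> x * (y * w) = u * w + v * (w :: 'r::ring_1)"
  by (simp add: distrib_right flip: mult.assoc)

section \<open>Moving elements across (1 - Et)^H\<close>

context scalar_algebra
begin

text \<open>H A = A (H + w), so passing A shifts the exponent by w, and (1 - Et)^{w + H} then splits
  by \<open>twist_mult\<close>. With A = X \<otimes> 1 this yields the terms X \<otimes> (1 - et)^w
  of the comultiplication.\<close>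

lemma twist_weight:
  assumes HE: "H * E = E * H" and A: "H * A - A * H = s w A" "A * E = E * A"
  shows "twist s H E * fps_const A = fps_const A * twist s (s w 1) E * twist s H E"
proof -
  let ?K = "fps_const E * geometric E"
  have "(s w 1 + H) * E = E * (s w 1 + H)"
    by (simp add: HE algebra_simps scale_mult_left scale_mult_right)
  note deriv = fps_deriv_twist[OF this]
  have AK: "fps_const A * ?K = ?K * fps_const A"
    by (metis A(2) fps_const_mult geometric_commute_const mult.assoc)
  have AH: "fps_const A * fps_const (s w 1 + H) = fps_const H * fps_const A"
    using A(1) by (simp add: algebra_simps scale_mult_right)
  have "twist s H E * fps_const A = fps_const A * twist s (s w 1 + H) E"
  proof (rule ode_unique_left[where A = "- (fps_const H * ?K)"])
    show "fps_deriv (twist s H E * fps_const A) = - (fps_const H * ?K) * (twist s H E * fps_const A)"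
      by (simp add: fps_deriv_twist[OF HE] mult.assoc)
    have "fps_deriv (fps_const A * twist s (s w 1 + H) E)
        = - (fps_const A * fps_const (s w 1 + H) * ?K * twist s (s w 1 + H) E)"
      by (simp only: fps_deriv_mult deriv fps_deriv_const mult_zero_left add_0_right
        mult_minus_left mult_minus_right mult.assoc)
    also have "\<dots> = - (fps_const H * (fps_const A * ?K) * twist s (s w 1 + H) E)"
      unfolding AH by (simp only: mult.assoc)
    finally show "fps_deriv (fps_const A * twist s (s w 1 + H) E)
        = - (fps_const H * ?K) * (fps_const A * twist s (s w 1 + H) E)"
      unfolding AK by (simp only: mult.assoc mult_minus_left)
  qed simp
  also have "twist s (s w 1 + H) E = twist s (s w 1) E * twist s H E"
    by (rule twist_mult[symmetric]) (simp_all add: HE scale_mult_left scale_mult_right)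
  finally show ?thesis
    by (simp only: mult.assoc)
qed

text \<open>Let L and R be left and right multiplication by E and ad = L - R. Since H commutes with
  everything, conjugation is (1 - Lt)^H (1 - Rt)^{-H} = (1 + ad t (1 - Lt)^{-1})^{-H}, and its
  binomial series stops after the second order because ad^3 kills Y. Taking Z to be half of the
  second commutator absorbs the 1/2! of that order.\<close>

lemma twist_conj:
  assumes E: "E * Y - Y * E = Y'" "E * Y' - Y' * E = Z + Z" "E * Z = Z * E"
    and H: "H * E = E * H" "H * Y = Y * H" "H * Y' = Y' * H" "H * Z = Z * H"
  shows "twist s H E * fps_const Y =
    (fps_const Y - fps_const H * (geometric E * fps_const Y' * fps_X)
      + fps_const (H * (H + 1)) * (geometric E * geometric E * fps_const Z * fps_X ^ 2)) * twist s H E"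
    (is "?F * ?y = ?G * ?F")
proof -
  define i where "i = geometric E"
  define K where "K = fps_const E * i"
  define t where "t = (fps_X :: 'r fps)"
  define h where "h = fps_const H"
  define y where "y = fps_const Y"
  define y' where "y' = fps_const Y'"
  define z where "z = fps_const Z"
  note defs = i_def K_def t_def h_def y_def y'_def z_def
  have tc: "x * t = t * x" for x
    unfolding t_def by (rule fps_commute_X)
  note t = tc[of y] tc[of y'] tc[of z] tc[of i] tc[of K] tc[of h]
  note t' = t[THEN mult_assoc_eq, unfolded mult.assoc]
  have i: "i = 1 + t * K"
    unfolding i_def K_def t_def by (rule geometric_eq)
  have Ki: "K = i * fps_const E"
    unfolding K_def i_def by (rule geometric_commute)
  have iK: "i * K = K * i"
    unfolding K_def i_def by (metis geometric_commute mult.assoc)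
  have res: "K * fps_const x = fps_const x * K + i * fps_const (E * x - x * E) * i" for x
    using resolvent_commutator[of t i "fps_const E" "fps_const x", OF tc i[unfolded K_def] Ki[unfolded K_def]]
    by (simp add: K_def)
  have zi: "z * i = i * z"
    unfolding z_def i_def by (rule geometric_commute_const) (simp add: E)
  have Kz: "K * z = z * K"
    using res[of Z] by (simp add: z_def E)
  have Ky': "K * y' = y' * K + (i * i * z + i * i * z)"
    using res[of Y'] zi by (simp add: y'_def z_def E(2) distrib_left distrib_right flip: fps_const_add)
      (simp add: mult.assoc)
  \<comment> \<open>Substituting i = 1 + tK on both sides gives [i,y'] = t [K,y']. The rule keeps i
    to the left of y' in the normal form used below.\<close>
  have y'i: "y' * i = i * y' - t * (i * i * z + i * i * z)"
    by (subst (1 2) i) (simp add: algebra_simps t t' Ky')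
  have Ky: "K * y = y * K + (i * i * y' - t * (i * i * i * z + i * i * i * z))"
    using res[of Y] by (simp add: y_def E(1) flip: y'_def)
      (simp add: mult.assoc y'i, simp add: algebra_simps t t')
  have hi: "i * h = h * i"
    unfolding i_def h_def by (rule geometric_commute_const[OF H(1), symmetric])
  have hK: "K * h = h * K"
    by (simp add: K_def hi mult.assoc) (simp add: h_def H flip: mult.assoc)
  have hy: "y * h = h * y" "y' * h = h * y'" "z * h = h * z"
    by (simp_all add: y_def y'_def z_def h_def H)
  have tK: "t * (K * x) = i * x - x" for x
    by (subst i) (simp add: algebra_simps)
  note c = hi hK hy
  note c' = c[THEN mult_assoc_eq, unfolded mult.assoc]
  define G where "G = y - h * (i * (y' * t)) + h * (h + 1) * (i * (i * (z * t ^ 2)))"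
  have di: "fps_deriv i = K * i"
    unfolding i_def K_def by (rule fps_deriv_geometric)
  have d0: "fps_deriv t = 1" "fps_deriv h = 0" "fps_deriv y = 0" "fps_deriv y' = 0" "fps_deriv z = 0"
    by (simp_all add: defs(3-))
  have dG: "fps_deriv G = - (h * (i * (i * y'))) + h * ((h + 1) * (t * (i * (i * (i * z + i * z)))))"
  proof -
    have "fps_deriv G = - (h * (i * y' + t * (K * (i * y'))))
      + h * (h + 1) * (t * (i * (i * (z + z))) + t * (t * (K * (i * (i * (z + z))))))"
      unfolding G_def
      by (simp add: di d0 power2_eq_square)
        (simp add: algebra_simps t t' iK iK[THEN mult_assoc_eq, unfolded mult.assoc])
    then show ?thesis
      unfolding tK by (simp add: algebra_simps t t')
  qed
  \<comment> \<open>The product of G with the twist solves the same equation as the twist times Y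
    precisely when G' = [G, hK].\<close>
  have comm: "G * (h * K) - h * K * G = fps_deriv G"
  proof -
    have "K * G = G * K + (i * i * y' - t * (i * i * i * z + i * i * i * z))
        - h * (i * (t * (i * i * z + i * i * z)))"
      unfolding G_def power2_eq_square
      by (simp add: algebra_simps t t' iK[symmetric] iK[symmetric, THEN mult_assoc_eq, unfolded mult.assoc] c c' Ky Ky'
        Kz Ky[THEN mult_assoc_add_eq, unfolded mult.assoc] Ky'[THEN mult_assoc_add_eq, unfolded mult.assoc] Kz[THEN mult_assoc_eq, unfolded mult.assoc])
    then have KG: "G * K - K * G = h * (i * (t * (i * i * z + i * i * z)))
        - (i * i * y' - t * (i * i * i * z + i * i * i * z))"
      by (simp add: algebra_simps)
    have "G * h = h * G"
      unfolding G_def power2_eq_square by (simp add: algebra_simps t t' c c')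
    then have "G * (h * K) - h * K * G = h * (G * K - K * G)"
      by (simp add: right_diff_distrib flip: mult.assoc)
    then show ?thesis
      unfolding KG dG by (simp add: algebra_simps t t' c c')
  qed
  have "?F * ?y = G * ?F"
  proof (rule ode_unique_left[where A = "- (h * K)"])
    show "fps_deriv (?F * ?y) = - (h * K) * (?F * ?y)"
      by (simp add: fps_deriv_twist[OF H(1)] mult.assoc defs)
    have "fps_deriv (G * ?F) = fps_deriv G * ?F - G * (h * K) * ?F"
      by (simp add: fps_deriv_twist[OF H(1)] mult.assoc defs)
    also have "\<dots> = - (h * K) * (G * ?F)"
      unfolding comm[symmetric] by (simp add: algebra_simps)
    finally show "fps_deriv (G * ?F) = - (h * K) * (G * ?F)" .
    show "fps_nth (?F * ?y) 0 = fps_nth (G * ?F) 0"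
      by (simp add: G_def defs power2_eq_square mult.assoc[symmetric])
  qed
  moreover have "G = ?G"
    unfolding G_def defs by (simp add: mult.assoc flip: fps_const_mult fps_const_add)
  ultimately show ?thesis by simp
qed

end

section \<open>The ordered series when H and E do not commute\<close>

context scalar_algebra
begin

text \<open>For $[H,E] = E$ the series is $\exp(-tHE)$.\<close>

lemma fps_deriv_twist_noncommuting:
  assumes "H * E = E * H + E"
  shows "fps_deriv (twist s H E) = - (twist s H E * fps_const (H * E))"
proof (rule fps_ext)
  fix m
  \<comment> \<open>Each E that H passes raises it by one. The new factor H - m of the falling
    product thus becomes H on the right of E^m, and the next coefficient arises from the previous
    one by right multiplication with H E.\<close>
  have *: "(H - of_nat m) * E ^ m = E ^ m * H" for m
  proof (induction m)
    case (Suc m)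
    have "(H - of_nat (Suc m)) * E ^ Suc m = ((H - 1) * E - of_nat m * E) * E ^ m"
      by (simp add: algebra_simps)
    also have "(H - 1) * E - of_nat m * E = E * (H - of_nat m)"
      using assms mult_of_nat_commute[of m E] by (simp add: algebra_simps)
    also have "\<dots> * E ^ m = E ^ Suc m * H"
      using Suc.IH by (simp add: mult.assoc)
    finally show ?case .
  qed simp
  have "falling_prod H m * (H - of_nat m) * E ^ Suc m = falling_prod H m * ((H - of_nat m) * E ^ m) * E"
    by (simp add: mult.assoc power_commutes)
  also have "\<dots> = falling_prod H m * E ^ m * (H * E)"
    by (simp add: * mult.assoc)
  finally show "fps_nth (fps_deriv (twist s H E)) m = fps_nth (- (twist s H E * fps_const (H * E))) m"
    using twist_nth_Suc[of m H E] by (simp add: twist_def scale_mult_left)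
qed

text \<open>With a = H E, the commutator D = a u - u a satisfies D' = -D a and starts at 0.\<close>

lemma twist_commute_noncommuting:
  assumes "H * E = E * H + E"
  shows "fps_const (H * E) * twist s H E = twist s H E * fps_const (H * E)"
proof -
  let ?u = "twist s H E" and ?a = "fps_const (H * E)"
  have "?a * ?u - ?u * ?a = 0"
    by (rule ode_unique_0[where A = 0 and B = "- ?a"])
      (simp_all add: fps_deriv_twist_noncommuting[OF assms] algebra_simps del: fps_const_mult fps_const_neg)
  then show ?thesis by simp
qed

text \<open>This is exp(-tHE) exp(tHE) = 1. The sign goes to E because the pair H, -E satisfies the
  same relation, whereas the pair -H, E does not.\<close>

lemma twist_inverse_noncommuting:
  assumes "H * E = E * H + E"
  shows "twist s H E * twist s H (- E) = 1"
proof (rule ode_unique_left[where A = 0])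
  let ?a = "fps_const (H * E)"
  have "H * - E = - E * H + - E"
    using assms by simp
  from twist_commute_noncommuting[OF this] fps_deriv_twist_noncommuting[OF this]
  show "fps_deriv (twist s H E * twist s H (- E)) = 0 * (twist s H E * twist s H (- E))"
    by (simp add: fps_deriv_twist_noncommuting[OF assms] mult.assoc del: fps_const_mult)
      (simp flip: mult.assoc fps_const_neg)
qed simp_all

lemma geometric_commute_series:
  fixes G :: "'r fps"
  assumes "G * fps_const E = fps_const E * G"
  shows "G * geometric E = geometric E * G"
  using twist_commute[of G "- 1" E] assms by (simp add: twist_minus_1 flip: fps_const_neg)

text \<open>This is \<open>twist_conj\<close> with the scalar c as exponent and H in the role of Y:
  there [E,H] = -E commutes with E, so only the first-order term remains.\<close>

lemma twist_scalar_commutator: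
  assumes "H * E = E * H + E"
  shows "fps_const H * twist s (s c 1) E = twist s (s c 1) E * fps_const H
    - fps_const (s c E) * geometric E * fps_X * twist s (s c 1) E"
proof -
  have "twist s (s c 1) E * fps_const H =
      (fps_const H - fps_const (s c 1) * (geometric E * fps_const (- E) * fps_X)) * twist s (s c 1) E"
    using twist_conj[of E H "- E" 0 "s c 1"] assms
    by (simp add: scale_mult_left scale_mult_right)
  also have "fps_const (s c 1) * (geometric E * fps_const (- E) * fps_X)
      = - (fps_const (s c E) * geometric E * fps_X)"
    by (simp add: geometric_commute[symmetric] scale_mult_left del: fps_const_neg flip: fps_const_neg mult.assoc)
  finally show ?thesis
    by (simp add: algebra_simps)
qed

text \<open>Here v = exp(ta) with a = H E, and both sides solve G' = a G. The polynomial factor Q is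
  exp(tD) Y for the operator D(x) = [a,x] - w E x, which is nilpotent on Y; the prefactor (1 -
  Et)^{-w} compensates for the term w E x.\<close>

lemma twist_conj_noncommuting:
  assumes HE: "H * E = E * H + E"
    and E: "E * Y - Y * E = Y'" "E * Y' - Y' * E = Z + Z" "E * Z = Z * E"
    and H: "H * Y - Y * H = s w Y" "H * Y' - Y' * H = s (w + 1) Y'" "H * Z - Z * H = s (w + 2) Z"
  shows "twist s H (- E) * fps_const Y = twist s (s (- w) 1) E *
    (fps_const Y + fps_const (Y' * (H + 1)) * fps_X + fps_const (Z * ((H + 2) * (H + 1))) * fps_X ^ 2)
    * twist s H (- E)"
    (is "?v * ?y = ?P * ?Q * ?v")
proof -
  have HE': "H * - E = - E * H + - E"
    using HE by simp
  define a where "a = fps_const (H * E)"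
  define e where "e = fps_const E"
  define t where "t = (fps_X :: 'r fps)"
  define i where "i = geometric E"
  define P where "P = ?P"
  define Q where "Q = ?Q"
  define W where "W = fps_const (s w 1)"
  have dv: "fps_deriv ?v = a * ?v"
    using twist_commute_noncommuting[OF HE'] fps_deriv_twist_noncommuting[OF HE']
    by (simp add: a_def del: fps_const_mult flip: fps_const_neg)
  have av: "a * ?v = ?v * a"
    using twist_commute_noncommuting[OF HE'] by (simp add: a_def del: fps_const_mult flip: fps_const_neg)
  have tc: "x * t = t * x" for x
    unfolding t_def by (rule fps_commute_X)
  have Wc: "x * W = W * x" for x
    unfolding W_def by (rule fps_ext) (simp add: scale_mult_left scale_mult_right)
  have iq: "e * i = i * e" "i - t * (e * i) = 1"
    unfolding e_def i_def t_def by (rule geometric_commute, use geometric_eq[of E] in \<open>simp add: algebra_simps\<close>)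
  have eP: "e * P = P * e"
    unfolding e_def P_def by (rule twist_commute) (simp_all add: scale_mult_left scale_mult_right)
  have dP: "fps_deriv P = W * (e * (i * P))"
    unfolding P_def by (subst fps_deriv_twist)
      (simp_all add: scale_mult_left scale_mult_right e_def i_def W_def mult.assoc scale_minus_left flip: fps_const_neg)
  have HP: "fps_const H * P = P * fps_const H + W * (e * (i * (t * P)))"
  proof -
    have "fps_const (s (- w) E) = - (W * e)"
      by (simp add: W_def e_def scale_mult_left scale_minus_left)
    then show ?thesis
      using twist_scalar_commutator[OF HE, of "- w"] by (simp add: P_def i_def t_def mult.assoc)
  qed
  have aP: "a * P = P * a + W * (e * (i * (t * (P * e))))"
  proof -
    have "a * P = fps_const H * P * e"
      by (simp add: a_def eP mult.assoc flip: e_def fps_const_mult)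
    then show ?thesis
      unfolding HP by (simp add: a_def distrib_right mult.assoc flip: e_def fps_const_mult)
  qed
  have Q: "fps_deriv Q = a * Q - Q * a - W * (e * Q)"
  proof -
    define y0 where "y0 = fps_const Y"
    define y1 where "y1 = fps_const (Y' * (H + 1))"
    define y2 where "y2 = fps_const (Z * ((H + 2) * (H + 1)))"
    have two: "s 2 x = x + x" for x
      using scale_left_distrib[of 1 1 x] by simp
    have rules: "H * E = E * H + E" "E * Y = Y * E + Y'" "E * Y' = Y' * E + (Z + Z)"
      "H * Y = Y * H + s w Y" "H * Y' = Y' * H + (s w Y' + Y')" "H * Z = Z * H + (s w Z + (Z + Z))"
      using HE E(1,2) H by (simp_all add: scale_left_distrib two algebra_simps)
    \<comment> \<open>The operator x \<mapsto> [a,x] - w e x sends y0 to y1, y1 to 2 y2 and y2 to 0,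
      so on Q it acts as the derivative in t.\<close>
    have k: "a * y0 = y0 * a + W * (e * y0) + y1" "a * y1 = y1 * a + W * (e * y1) + (y2 + y2)"
      "a * y2 = y2 * a + W * (e * y2)"
      unfolding a_def y0_def y1_def y2_def W_def e_def fps_const_mult fps_const_add
      by (simp_all add: algebra_simps rules E(3) rules[THEN mult_assoc_add_eq] E(3)[THEN mult_assoc_eq]
        mult_2 mult_2_right scale_mult_left scale_mult_right scale_right_distrib)
    have Q: "Q = y0 + t * y1 + t * (t * y2)"
      by (simp add: Q_def y0_def y1_def y2_def t_def power2_eq_square
        fps_commute_X[of "fps_const c" for c] fps_commute_X_assoc[of "fps_const c" for c] del: fps_const_mult)
    have d: "fps_deriv t = 1" "fps_deriv y0 = 0" "fps_deriv y1 = 0" "fps_deriv y2 = 0"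
      by (simp_all add: t_def y0_def y1_def y2_def)
    show ?thesis
      unfolding Q by (simp add: d algebra_simps k tc[of a, THEN mult_assoc_eq] tc[of e, THEN mult_assoc_eq]
        tc[of W, THEN mult_assoc_eq])
  qed
  have "fps_deriv (P * Q * ?v) = (fps_deriv P * Q + P * fps_deriv Q + P * Q * a) * ?v"
    by (simp add: dv algebra_simps)
  also have "fps_deriv P * Q + P * fps_deriv Q + P * Q * a = a * (P * Q)"
  proof -
    have "W * (e * (i * (P * Q))) - W * (e * (i * (t * (P * (e * Q))))) =
        W * (e * ((i - t * (e * i)) * (P * Q)))"
      by (simp add: algebra_simps tc[of i, THEN mult_assoc_eq] eP[symmetric, THEN mult_assoc_eq]
        iq(1)[THEN mult_assoc_eq])
    also have "\<dots> = P * (W * (e * Q))"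
      by (simp add: iq(2) Wc[of P, THEN mult_assoc_eq] eP[symmetric, THEN mult_assoc_eq] mult.assoc)
    finally have *: "P * (W * (e * Q)) = W * (e * (i * (P * Q))) - W * (e * (i * (t * (P * (e * Q)))))" ..
    show ?thesis
      unfolding Q right_diff_distrib *
      by (simp add: dP algebra_simps aP[THEN mult_assoc_add_eq])
  qed
  finally have 1: "fps_deriv (P * Q * ?v) = a * (P * Q * ?v)"
    by (simp only: mult.assoc)
  have 2: "fps_deriv (?v * ?y) = a * (?v * ?y)"
    by (simp add: dv mult.assoc)
  have "fps_nth (?v * ?y) 0 = fps_nth (P * Q * ?v) 0"
    by (simp add: P_def Q_def power2_eq_square)
  from ode_unique_left[OF 2 1 this] show ?thesis
    by (simp only: P_def Q_def)
qed

text \<open>The instance to keep in mind has H1 = h \<otimes> 1 \<otimes> 1, H2 = 1 \<otimes> h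
  \<otimes> 1, E2 = 1 \<otimes> e \<otimes> 1 and E3 = 1 \<otimes> 1 \<otimes> e. The identity is
  then Drinfeld's condition F_{12} (\<Delta>_0 \<otimes> id)(F) = F_{23} (id \<otimes>
  \<Delta>_0)(F).\<close>

lemma twist_cocycle:
  assumes H1: "H1 * H2 = H2 * H1" "H1 * E2 = E2 * H1" "H1 * E3 = E3 * H1"
    and E3: "E3 * E2 = E2 * E3" "H2 * E3 = E3 * H2" and E2: "H2 * E2 - E2 * H2 = E2"
  shows "twist s H1 E2 * twist s (H1 + H2) E3 = twist s H2 E3 * twist s H1 (E2 + E3)"
proof -
  define t where "t = (fps_X :: 'r fps)"
  define i where "i = geometric E2"
  define j where "j = geometric E3"
  define k where "k = geometric (E2 + E3)"
  define h1 where "h1 = fps_const H1"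
  define h2 where "h2 = fps_const H2"
  define e2 where "e2 = fps_const E2"
  define e3 where "e3 = fps_const E3"
  note defs = i_def j_def k_def h1_def h2_def e2_def e3_def
  let ?F = "twist s H1 E2" and ?Fb = "twist s (H1 + H2) E3"
  let ?Fa = "twist s H2 E3" and ?Fc = "twist s H1 (E2 + E3)"
  have tc: "x * t = t * x" for x
    unfolding t_def by (rule fps_commute_X)
  have dF: "fps_deriv ?F = - (h1 * (e2 * i) * ?F)"
    by (subst fps_deriv_twist) (simp_all add: H1 defs)
  have dFb: "fps_deriv ?Fb = - ((h1 + h2) * (e3 * j) * ?Fb)"
    by (subst fps_deriv_twist) (simp_all add: H1 E3 defs algebra_simps flip: fps_const_add)
  have dFa: "fps_deriv ?Fa = - (h2 * (e3 * j) * ?Fa)"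
    by (subst fps_deriv_twist) (simp_all add: E3 defs)
  have dFc: "fps_deriv ?Fc = - (h1 * ((e2 + e3) * k) * ?Fc)"
    by (subst fps_deriv_twist) (simp_all add: H1 defs algebra_simps)
  have ij: "e2 * i = i * e2" "e3 * j = j * e3" "e3 * i = i * e3" "i * j = j * i"
    unfolding defs
    by (rule geometric_commute geometric_commute_const[OF E3(1)] geometric_commute_series
      geometric_commute_const[OF E3(1), symmetric])+
  have Fh1: "?F * h1 = h1 * ?F"
    unfolding h1_def by (rule twist_commute[symmetric]) (simp_all add: H1)
  have Fh2: "?F * h2 = h2 * ?F + h1 * (i * (e2 * (t * ?F)))"
    using twist_conj[of E2 H2 "- E2" 0 H1] H1 E2
    by (simp add: defs t_def algebra_simps flip: fps_const_neg)
  have Fe3: "?F * e3 = e3 * ?F"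
    unfolding e3_def by (rule twist_commute[symmetric]) (simp_all add: H1 E3)
  have Fj: "?F * j = j * ?F"
    unfolding j_def by (rule geometric_commute_series) (rule Fe3[unfolded e3_def])
  have Fae2: "?Fa * e2 = e2 * (1 - t * e3) * ?Fa"
    using twist_weight[of H2 E3 E2 1] E2 E3
    by (simp add: twist_1 defs t_def)
  have Fae3: "?Fa * e3 = e3 * ?Fa"
    unfolding e3_def by (rule twist_commute[symmetric]) (simp_all add: E3)
  have Fah1: "?Fa * h1 = h1 * ?Fa"
    unfolding h1_def by (rule twist_commute[symmetric]) (simp_all add: H1)
  \<comment> \<open>Since E2 has weight 1 under H2, conjugating 1 - t(e2 + e3) by \<open>?Fa\<close>
    factors it as (1 - t e2)(1 - t e3). This step passes to inverses.\<close>
  have Fak: "?Fa * k = j * i * ?Fa"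
  proof -
    have "?Fa * (1 - t * (e2 + e3)) = (1 - t * e2) * (1 - t * e3) * ?Fa"
      by (simp add: algebra_simps tc[of ?Fa, THEN mult_assoc_eq] tc[of e2, THEN mult_assoc_eq] Fae2 Fae3)
    then have "j * (i * (?Fa * (1 - t * (e2 + e3)) * k)) = j * (i * (1 - t * e2)) * (1 - t * e3) * ?Fa * k"
      by (simp add: mult.assoc)
    moreover have "(1 - t * (e2 + e3)) * k = 1" "i * (1 - t * e2) = 1" "j * (1 - t * e3) = 1"
      using geometric_inverse[of "E2 + E3"] geometric_inverse[of E2] geometric_inverse[of E3]
      by (simp_all add: defs t_def)
    ultimately show ?thesis
      by (simp add: mult.assoc)
  qed
  have qj: "t * (e3 * j) = j - 1" and qi: "t * (e2 * i) = i - 1"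
    using geometric_eq[of E3] geometric_eq[of E2] by (simp_all add: defs t_def algebra_simps)
  \<comment> \<open>The common left coefficient of both equations. The left product reaches it after
    t e2 i = i - 1, the right one after t e3 j = j - 1.\<close>
  define A where "A = - (h1 * (e2 * i) + h2 * (e3 * j) + h1 * (j * i * e3))"
  show ?thesis
  proof (rule ode_unique_left[where A = A])
    have "fps_deriv (?F * ?Fb) =
        - (h1 * (e3 * j) + h2 * (e3 * j) + h1 * (t * (e2 * i)) * (e3 * j) + h1 * (e2 * i)) * (?F * ?Fb)"
      by (simp add: dF dFb algebra_simps Fh1[THEN mult_assoc_eq] Fh2[THEN mult_assoc_add_eq]
        Fe3[THEN mult_assoc_eq] Fj[THEN mult_assoc_eq] ij tc[of i, THEN mult_assoc_eq]
        tc[of e2, THEN mult_assoc_eq])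
    also have "\<dots> = A * (?F * ?Fb)"
      unfolding A_def qi by (simp add: algebra_simps ij ij[THEN mult_assoc_eq])
    finally show "fps_deriv (?F * ?Fb) = A * (?F * ?Fb)" .
    have "fps_deriv (?Fa * ?Fc) =
        - (h1 * ((e2 * (j - t * (e3 * j)) + e3 * j) * i) + h2 * (e3 * j)) * (?Fa * ?Fc)"
      by (simp add: dFa dFc algebra_simps Fah1[THEN mult_assoc_eq] Fae2[THEN mult_assoc_eq]
        Fae3[THEN mult_assoc_eq] Fak[THEN mult_assoc_eq])
    also have "\<dots> = A * (?Fa * ?Fc)"
      unfolding A_def qj by (simp add: algebra_simps ij ij[THEN mult_assoc_eq])
    finally show "fps_deriv (?Fa * ?Fc) = A * (?Fa * ?Fc)" .
  qed simp
qed

end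

section \<open>Homomorphisms and maps that are linear over the power series ring\<close>

locale algebra_hom = source: scalar_algebra s + target: scalar_algebra s'
  for s :: "'a::field_char_0 \<Rightarrow> 'u::ring_1 \<Rightarrow> 'u" and s' :: "'a \<Rightarrow> 'v::ring_1 \<Rightarrow> 'v" +
  fixes \<phi> :: "'u \<Rightarrow> 'v"
  assumes add: "\<phi> (x + y) = \<phi> x + \<phi> y"
    and mult: "\<phi> (x * y) = \<phi> x * \<phi> y"
    and scale: "\<phi> (s c x) = s' c (\<phi> x)"
    and one: "\<phi> 1 = 1"

lemma additive_sum:
  fixes \<phi> :: "'u::ab_group_add \<Rightarrow> 'v::ab_group_add"
  assumes "\<And>x y. \<phi> (x + y) = \<phi> x + \<phi> y"
  shows "\<phi> 0 = 0" "\<phi> (- x) = - \<phi> x" "\<phi> (x - y) = \<phi> x - \<phi> y" "\<phi> (sum g A) = (\<Sum>i\<in>A. \<phi> (g i))"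
proof -
  interpret additive \<phi> by standard (rule assms)
  show "\<phi> 0 = 0" "\<phi> (- x) = - \<phi> x" "\<phi> (x - y) = \<phi> x - \<phi> y" "\<phi> (sum g A) = (\<Sum>i\<in>A. \<phi> (g i))"
    by (fact zero minus diff sum)+
qed

lemma fps_map_const: "\<phi> 0 = 0 \<Longrightarrow> fps_map \<phi> (fps_const x) = fps_const (\<phi> x)"
  by (rule fps_ext) simp

lemma fps_map_add: "(\<And>x y. \<phi> (x + y) = \<phi> x + \<phi> y) \<Longrightarrow> fps_map \<phi> (f + g) = fps_map \<phi> f + fps_map \<phi> g"
  by (rule fps_ext) simp

text \<open>Embeds the base ring of power series centrally, so that its module action becomes plain
  multiplication and linearity of algebra maps can be checked on these central elements.\<close>

definition scalar_series :: "('a \<Rightarrow> 'r \<Rightarrow> 'r) \<Rightarrow> 'a fps \<Rightarrow> 'r::one fps" where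
  "scalar_series s c = fps_map (\<lambda>x. s x 1) c"

context scalar_algebra
begin

lemma fps_conv_eq_mult: "fps_conv s c f = scalar_series s c * f"
  by (rule fps_ext) (simp add: scalar_series_def fps_conv_nth fps_mult_nth scale_mult_left)

lemma scalar_series_commute: "x * scalar_series s c = scalar_series s c * x"
proof (rule fps_ext)
  fix n
  have "fps_nth (x * scalar_series s c) n = (\<Sum>i=0..n. fps_nth (scalar_series s c) (n - i) * fps_nth x i)"
    by (simp add: fps_mult_nth scalar_series_def scale_mult_left scale_mult_right)
  also have "\<dots> = fps_nth (scalar_series s c * x) n"
    unfolding fps_mult_nth by (subst sum.atLeastAtMost_rev) (auto intro: sum.cong)
  finally show "fps_nth (x * scalar_series s c) n = fps_nth (scalar_series s c * x) n" .
qed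

lemma scalar_series_const: "scalar_series s (fps_const c) = fps_const (s c 1)"
  by (simp add: scalar_series_def fps_map_const)

lemma vector_space_fps_const: "vector_space (\<lambda>c. fps_conv s (fps_const c))"
  by unfold_locales (simp_all add: fps_eq_iff scale_right_distrib scale_left_distrib
    module.scale_one[OF module_fps_conv])

end

context algebra_hom
begin

lemmas additive = additive_sum[of \<phi>, OF add]

lemma of_nat: "\<phi> (of_nat n) = of_nat n"
  by (induction n) (simp_all add: additive add one)

lemma power: "\<phi> (x ^ n) = \<phi> x ^ n"
  by (induction n) (simp_all add: one mult)

lemma falling_prod: "\<phi> (falling_prod x n) = falling_prod (\<phi> x) n"
  by (induction n) (simp_all add: falling_prod_Suc one mult additive of_nat)

text \<open>Coefficients are polynomials in H and E, so images of the twisting element under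
  coproducts, counits and slot embeddings are again twists, determined by the images of h and
  e.\<close>

lemma fps_map_twist: "fps_map \<phi> (twist s H E) = twist s' (\<phi> H) (\<phi> E)"
  by (rule fps_ext) (simp add: twist_def scale mult power falling_prod)

lemma fps_map_mult: "fps_map \<phi> (f * g) = fps_map \<phi> f * fps_map \<phi> g"
  by (rule fps_ext) (simp add: fps_mult_nth additive mult)

lemma fps_map_one: "fps_map \<phi> 1 = 1"
  by (rule fps_ext) (simp add: one additive)

lemma fps_map_X: "fps_map \<phi> fps_X = fps_X"
  by (rule fps_ext) (simp add: fps_X_def one additive)

lemma fps_map_scalar_series: "fps_map \<phi> (scalar_series s c) = scalar_series s' c"
  by (rule fps_ext) (simp add: scalar_series_def scale one)

end

definition t_linear :: "('u::ring_1 fps \<Rightarrow> 'v::ring_1 fps) \<Rightarrow> bool" where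
  "t_linear \<phi> \<longleftrightarrow> (\<forall>f g. \<phi> (f + g) = \<phi> f + \<phi> g) \<and> (\<forall>f. \<phi> (fps_X * f) = fps_X * \<phi> f)"

lemma t_linear_add: "t_linear \<phi> \<Longrightarrow> \<phi> (f + g) = \<phi> f + \<phi> g"
  by (simp add: t_linear_def)

text \<open>Splitting f into its constant term and t times a series reduces the n-th coefficient to
  values on constants after finitely many steps. Continuity in the t-adic topology is therefore
  automatic.\<close>

lemma t_linear_eqI:
  assumes "t_linear \<phi>" "t_linear \<psi>" and const: "\<And>x. \<phi> (fps_const x) = \<psi> (fps_const x)"
  shows "\<phi> f = \<psi> f"
proof -
  have split: "f = fps_const (fps_nth f 0) + fps_X * Abs_fps (\<lambda>n. fps_nth f (Suc n))" for f :: "'a fps"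
    by (rule fps_ext) simp
  have "fps_nth (\<phi> f) n = fps_nth (\<psi> f) n" for n
  proof (induction n arbitrary: f)
    case 0
    show ?case
      using assms by (subst (1 2) split) (simp add: t_linear_def)
  next
    case (Suc n)
    show ?case
      using assms Suc.IH by (subst (1 2) split) (simp add: t_linear_def)
  qed
  then show ?thesis by (rule fps_ext)
qed

lemma t_linear_fps_map:
  fixes \<phi> :: "'u::ring_1 \<Rightarrow> 'v::ring_1"
  assumes "\<And>x y. \<phi> (x + y) = \<phi> x + \<phi> y"
  shows "t_linear (fps_map \<phi>)"
  by (simp add: t_linear_def fps_eq_iff assms additive_sum(1)[of \<phi>, OF assms])

lemma t_linear_comp: "t_linear \<phi> \<Longrightarrow> t_linear \<psi> \<Longrightarrow> t_linear (\<lambda>f. \<phi> (\<psi> f))"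
  by (simp add: t_linear_def)

lemma t_linear_mult_left: "t_linear \<phi> \<Longrightarrow> t_linear (\<lambda>f. a * \<phi> f)"
  by (simp add: t_linear_def distrib_left fps_commute_X_assoc)

lemma t_linear_mult_right: "t_linear \<phi> \<Longrightarrow> t_linear (\<lambda>f. \<phi> f * a)"
  by (simp add: t_linear_def distrib_right mult.assoc)

lemma t_linear_id: "t_linear (\<lambda>f. f)"
  by (simp add: t_linear_def)

lemmas t_linear_intros = t_linear_id t_linear_mult_left t_linear_mult_right

section \<open>The enveloping algebra and its tensor powers\<close>

interpretation uea_alg: scalar_algebra uea_scale
  by unfold_locales (rule uea_scale_mult_left uea_scale_mult_right)+

interpretation uea_power_alg: scalar_algebra uea_power_scale
  by unfold_locales (rule uea_power_scale_mult_left uea_power_scale_mult_right)+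

interpretation field_alg: scalar_algebra "(*) :: 'a::field_char_0 \<Rightarrow> 'a \<Rightarrow> 'a"
  by unfold_locales (simp_all add: algebra_simps)

lemma fps_unit_eq: "fps_unit c = scalar_series uea_scale c"
  by (simp add: fps_unit_def uea_alg.fps_conv_eq_mult)

lemma uea_induct [case_names scalar gen add mult]:
  fixes u :: "'a::field_char_0 uea"
  assumes scalar: "\<And>c. P (uea_scale c 1)" and gen: "\<And>b. P (uea_gen b)"
    and add: "\<And>u v. P u \<Longrightarrow> P v \<Longrightarrow> P (u + v)" and mult: "\<And>u v. P u \<Longrightarrow> P v \<Longrightarrow> P (u * v)"
  shows "P u"
proof (induct u rule: uea.abs_induct)
  case (1 p)
  show ?case
  proof (induction p rule: pm_induct)
    case zero
    show ?case
      using scalar[of 0] by (simp flip: zero_uea_def)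
  next
    case (single w c)
    have gen_eq: "abs_uea (Poly_Mapping.single (Word [b]) 1) = (uea_gen b :: 'a uea)" for b
      by (simp add: uea_gen_def uea_of_sv.abs_eq in_tensor_algebra_def)
    have word: "P (abs_uea (Poly_Mapping.single (Word l) 1))" for l
    proof (induction l)
      case Nil
      show ?case
        using scalar[of 1] by (simp add: one_uea_def flip: zero_word_def)
    next
      case (Cons b l)
      have "abs_uea (Poly_Mapping.single (Word (b # l)) 1) =
          uea_gen b * (abs_uea (Poly_Mapping.single (Word l) 1) :: 'a uea)"
        unfolding gen_eq[symmetric] times_uea.abs_eq by (simp add: mult_single plus_word_def)
      then show ?case
        using mult[OF gen Cons.IH] by simp
    qed
    obtain l where w: "w = Word l" by (cases w)
    have "abs_uea (Poly_Mapping.single w c) = uea_scale c 1 * abs_uea (Poly_Mapping.single (Word l) 1)"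
      by (simp add: w uea_scale_mult_left uea_scale.abs_eq)
    then show ?case
      using mult[OF scalar word] by simp
  next
    case (add p q)
    then show ?case
      using assms(3) by (simp flip: plus_uea.abs_eq)
  qed
qed

lemma tensor2_zero [simp]: "tensor2 0 y = 0" "tensor2 x 0 = 0"
  using tensor2_bilinear(1)[of 0 0 y] tensor2_bilinear(2)[of x 0 0] by simp_all

lemma tensor2_induct [case_names tensor2 add]:
  fixes z :: "'a::field_char_0 uea2"
  assumes tensor2: "\<And>x y. P (tensor2 x y)" and add: "\<And>z w. P z \<Longrightarrow> P w \<Longrightarrow> P (z + w)"
  shows "P z"
proof (induct z rule: uea_power.abs_induct)
  case (1 p)
  show ?case
  proof (induction p rule: pm_induct)
    case zero
    show ?case
      using tensor2[of 0 0] by (simp flip: zero_uea_power_def)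
  next
    case (single k c)
    \<comment> \<open>The coefficient c is absorbed into the first factor, so that pure tensors and
      sums exhaust the tensor square.\<close>
    have "case_slot2 (component k Fst2) (component k Snd2) = component k"
      by (rule ext) (simp split: slot2.split)
    then have "abs_uea_power (Poly_Mapping.single k c) =
        tensor2 (uea_scale c (component k Fst2)) (component k Snd2)"
      unfolding tensor2_bilinear
      by (simp add: single_family_eq tensor2_def pure_tensor.abs_eq uea_power_scale.abs_eq)
    then show ?case
      using tensor2 by simp
  next
    case (add p q)
    then show ?case
      using assms(2) by (simp flip: plus_uea_power.abs_eq)
  qed
qed

lemma t_linear_tensor_eqI:
  fixes z :: "'a::field_char_0 uea2 fps"
  assumes "t_linear \<phi>" "t_linear \<psi>"
    and tensor2: "\<And>x y. \<phi> (fps_const (tensor2 x y)) = \<psi> (fps_const (tensor2 x y))"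
  shows "\<phi> z = \<psi> z"
proof (rule t_linear_eqI[OF assms(1,2)])
  fix x :: "'a uea2"
  show "\<phi> (fps_const x) = \<psi> (fps_const x)"
    by (induction x rule: tensor2_induct)
      (simp_all add: tensor2 t_linear_add[OF assms(1)] t_linear_add[OF assms(2)] flip: fps_const_add)
qed

lemma algebra_hom_tensor_lift:
  assumes "scalar_algebra s" "uea_bilinear s B"
    and mult: "\<And>x x' y y'. B (x * x') (y * y') = B x y * B x' y'" and one: "B 1 1 = 1"
  shows "algebra_hom uea_power_scale s (tensor_lift s B)"
proof -
  interpret scalar_algebra s by fact
  interpret uea_bilinear s B by fact
  have "tensor_lift s B (z * w) = tensor_lift s B z * tensor_lift s B w" for z w
  proof (induction z rule: tensor2_induct)
    case (tensor2 x y)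
    show ?case
      by (induction w rule: tensor2_induct)
        (simp_all add: tensor2_mult tensor_lift_tensor2 tensor_lift_add mult distrib_left)
  qed (simp add: tensor_lift_add distrib_right)
  moreover have "tensor_lift s B 1 = 1"
    using tensor_lift_tensor2[of 1 1] by (simp add: tensor2_one one)
  ultimately show ?thesis
    by unfold_locales (simp_all add: tensor_lift_add tensor_lift_scale)
qed

lemma fps_const_bilinear:
  fixes B :: "'a::field_char_0 uea fps \<Rightarrow> 'a uea fps \<Rightarrow> 'v::ring_1 fps"
  assumes "scalar_algebra s"
    and "\<And>x x' y. B (fps_const (x + x')) (fps_const y) = B (fps_const x) (fps_const y) + B (fps_const x') (fps_const y)"
    and "\<And>x y y'. B (fps_const x) (fps_const (y + y')) = B (fps_const x) (fps_const y) + B (fps_const x) (fps_const y')"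
    and "\<And>c x y. B (fps_const (uea_scale c x)) (fps_const y) = fps_const (s c 1) * B (fps_const x) (fps_const y)"
    and "\<And>c x y. B (fps_const x) (fps_const (uea_scale c y)) = fps_const (s c 1) * B (fps_const x) (fps_const y)"
  shows "uea_bilinear (\<lambda>c. fps_conv s (fps_const c)) (\<lambda>x y. B (fps_const x) (fps_const y))"
proof -
  interpret scalar_algebra s by fact
  interpret f: vector_space "\<lambda>c. fps_conv s (fps_const c)" by (rule vector_space_fps_const)
  show ?thesis
    by unfold_locales (simp_all add: assms(2-) fps_conv_eq_mult scalar_series_const)
qed

text \<open>Only the values of B on constant series enter \<open>tensor_fps_lift\<close>, so
  bilinearity is demanded there alone.\<close>

lemma
  assumes "scalar_algebra s" and "uea_bilinear (\<lambda>c. fps_conv s (fps_const c)) (\<lambda>x y. B (fps_const x) (fps_const y))"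
  shows t_linear_tensor_fps_lift: "t_linear (tensor_fps_lift s B)"
    and tensor_fps_lift_const: "tensor_fps_lift s B (fps_const (tensor2 x y)) = B (fps_const x) (fps_const y)"
proof -
  interpret scalar_algebra s by fact
  interpret b: uea_bilinear "\<lambda>c. fps_conv s (fps_const c)" "\<lambda>x y. B (fps_const x) (fps_const y)"
    by fact
  let ?L = "tensor_lift (\<lambda>c. fps_conv s (fps_const c)) (\<lambda>x y. B (fps_const x) (fps_const y))"
  have L0: "?L 0 = 0"
    using b.tensor_lift_add[of 0 0] by simp
  show "t_linear (tensor_fps_lift s B)"
    unfolding t_linear_def
  proof (intro conjI allI)
    show "tensor_fps_lift s B (f + g) = tensor_fps_lift s B f + tensor_fps_lift s B g" for f g
      by (rule fps_ext) (simp add: tensor_fps_lift_def b.tensor_lift_add sum.distrib)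
    show "tensor_fps_lift s B (fps_X * f) = fps_X * tensor_fps_lift s B f" for f
    proof (rule fps_ext)
      fix n
      show "fps_nth (tensor_fps_lift s B (fps_X * f)) n = fps_nth (fps_X * tensor_fps_lift s B f) n"
        by (cases n) (simp_all add: tensor_fps_lift_def L0 sum.atLeast0_atMost_Suc_shift del: sum.cl_ivl_Suc)
    qed
  qed
  show "tensor_fps_lift s B (fps_const (tensor2 x y)) = B (fps_const x) (fps_const y)"
  proof (rule fps_ext)
    fix n
    have "fps_nth (tensor_fps_lift s B (fps_const (tensor2 x y))) n =
        (\<Sum>i=0..n. if i = 0 then fps_nth (B (fps_const x) (fps_const y)) n else 0)"
      unfolding tensor_fps_lift_def fps_nth_Abs_fps
      by (rule sum.cong) (auto simp: L0 b.tensor_lift_tensor2)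
    then show "fps_nth (tensor_fps_lift s B (fps_const (tensor2 x y))) n = fps_nth (B (fps_const x) (fps_const y)) n"
      by simp
  qed
qed

lemma uea_comult_hom: "algebra_hom uea_scale uea_power_scale uea_comult"
proof unfold_locales
  fix u v :: "'a uea" and c
  show "uea_comult (u + v) = uea_comult u + uea_comult v"
    by (induct u rule: uea.abs_induct, induct v rule: uea.abs_induct)
      (simp add: plus_uea.abs_eq uea_comult_abs)
  show "uea_comult (uea_scale c u) = uea_power_scale c (uea_comult u)"
    by (induct u rule: uea.abs_induct) (simp add: uea_scale.abs_eq uea_comult_abs)
  show "uea_comult (u * v) = uea_comult u * uea_comult v"
    by (rule uea_comult_mult)
  have "uea_comult (abs_uea (Poly_Mapping.single 0 1) :: 'a uea) = 1"
    unfolding uea_comult_abs uea_power.lin_ext_single by simp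
  then show "uea_comult (1 :: 'a uea) = 1"
    by (simp add: one_uea_def)
qed

interpretation comult: algebra_hom uea_scale uea_power_scale uea_comult
  by (rule uea_comult_hom)

interpretation counit: algebra_hom uea_scale "(*)" uea_counit
  by unfold_locales simp_all

lemma uea_antipode_add: "uea_antipode (u + v) = uea_antipode u + uea_antipode v"
  by (induct u rule: uea.abs_induct, induct v rule: uea.abs_induct)
    (simp add: plus_uea.abs_eq uea_antipode_abs)

lemma uea_antipode_scale: "uea_antipode (uea_scale c u) = uea_scale c (uea_antipode u)"
  by (induct u rule: uea.abs_induct) (simp add: uea_scale.abs_eq uea_antipode_abs)

lemma uea_antipode_one: "uea_antipode (1 :: 'a::field_char_0 uea) = 1"
proof -
  have "uea_antipode (abs_uea (Poly_Mapping.single 0 1) :: 'a uea) = 1"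
    unfolding uea_antipode_abs uea.lin_ext_single by simp
  then show ?thesis
    by (simp add: one_uea_def)
qed

lemmas uea_antipode_additive = additive_sum[of uea_antipode, OF uea_antipode_add]

lemma fps_map_antipode_mult:
  "fps_map uea_antipode (f * g) = fps_map uea_antipode g * fps_map uea_antipode f"
proof (rule fps_ext)
  fix n
  show "fps_nth (fps_map uea_antipode (f * g)) n = fps_nth (fps_map uea_antipode g * fps_map uea_antipode f) n"
    by (simp add: fps_mult_nth uea_antipode_additive uea_antipode_mult)
      (subst sum.atLeastAtMost_rev, auto intro: sum.cong)
qed

lemma uea_gen_simps:
  "uea_comult (uea_gen b) = tensor2 (uea_gen b) 1 + tensor2 1 (uea_gen b)"
  "uea_antipode (uea_gen b) = - uea_gen b"
  "uea_counit (uea_gen b) = 0"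
  by (simp_all add: uea_gen_def uea_comult_of_sv uea_antipode_of_sv)

section \<open>Slot embeddings into the triple tensor product and the standard Hopf laws\<close>

lemma tensor3_bilinear:
  "uea_bilinear uea_power_scale (\<lambda>x y. tensor3 x y z)"
  "uea_bilinear uea_power_scale (\<lambda>y z. tensor3 x y z)"
  by unfold_locales (simp_all add: tensor3_trilinear)

lemma join_left_tensor2: "join_left (tensor2 x y) z = tensor3 x y z"
  unfolding join_left_def by (rule uea_bilinear.tensor_lift_tensor2[OF tensor3_bilinear(1)])

lemma join_right_tensor2: "join_right x (tensor2 y z) = tensor3 x y z"
  unfolding join_right_def by (rule uea_bilinear.tensor_lift_tensor2[OF tensor3_bilinear(2)])

lemma join_add:
  "join_left (w + w') z = join_left w z + join_left w' z"
  "join_right x (w + w') = join_right x w + join_right x w'"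
  unfolding join_left_def join_right_def
  by (rule uea_bilinear.tensor_lift_add tensor3_bilinear)+

lemma join_scale:
  "join_left (uea_power_scale c w) z = uea_power_scale c (join_left w z)"
  "join_right x (uea_power_scale c w) = uea_power_scale c (join_right x w)"
  unfolding join_left_def join_right_def
  by (rule uea_bilinear.tensor_lift_scale tensor3_bilinear)+

lemma join_add_uea:
  "join_left w (z + z') = join_left w z + join_left w z'"
  "join_right (z + z') w = join_right z w + join_right z' w"
  by (induction w rule: tensor2_induct)
    (simp_all add: join_left_tensor2 join_right_tensor2 join_add tensor3_trilinear)

lemma join_scale_uea:
  "join_left w (uea_scale c z) = uea_power_scale c (join_left w z)"
  "join_right (uea_scale c z) w = uea_power_scale c (join_right z w)"
  by (induction w rule: tensor2_induct)
    (simp_all add: join_left_tensor2 join_right_tensor2 join_add tensor3_trilinear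
      uea_power.scale_right_distrib)

lemma join_mult:
  "join_left (w * w') (z * z') = join_left w z * join_left w' z'"
  "join_right (z * z') (w * w') = join_right z w * join_right z' w'"
proof -
  have "join_left (tensor2 x y * w') (z * z') = join_left (tensor2 x y) z * join_left w' z' \<and>
      join_right (z * z') (tensor2 x y * w') = join_right z (tensor2 x y) * join_right z' w'" for x y
    by (induction w' rule: tensor2_induct)
      (simp_all add: tensor2_mult join_left_tensor2 join_right_tensor2 tensor3_mult join_add distrib_left)
  then have "join_left (w * w') (z * z') = join_left w z * join_left w' z' \<and>
      join_right (z * z') (w * w') = join_right z w * join_right z' w'"
    by (induction w rule: tensor2_induct) (simp_all add: join_add distrib_right)
  then show "join_left (w * w') (z * z') = join_left w z * join_left w' z'"
    "join_right (z * z') (w * w') = join_right z w * join_right z' w'" by auto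
qed

lemma join_one: "join_left 1 1 = 1" "join_right 1 1 = 1"
  using join_left_tensor2[of 1 1 1] join_right_tensor2[of 1 1 1] by (simp_all add: tensor2_one tensor3_one)

interpretation join_left_one: algebra_hom uea_power_scale uea_power_scale "\<lambda>w. join_left w 1"
  by unfold_locales (use join_mult(1)[of _ _ 1 1] in \<open>simp_all add: join_add join_scale join_one\<close>)

interpretation join_right_one: algebra_hom uea_power_scale uea_power_scale "join_right 1"
  by unfold_locales (use join_mult(2)[of 1 1] in \<open>simp_all add: join_add join_scale join_one\<close>)

text \<open>\<open>\<Delta>\<^sub>0 \<otimes> id\<close> and \<open>id \<otimes> \<Delta>\<^sub>0\<close>\<close>

definition comult_left :: "'a::field_char_0 uea2 \<Rightarrow> 'a uea3" where
  "comult_left = tensor_lift uea_power_scale (\<lambda>x y. join_left (uea_comult x) y)"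

definition comult_right :: "'a::field_char_0 uea2 \<Rightarrow> 'a uea3" where
  "comult_right = tensor_lift uea_power_scale (\<lambda>x y. join_right x (uea_comult y))"

lemma comult_join_bilinear:
  "uea_bilinear uea_power_scale (\<lambda>x y. join_left (uea_comult x) y)"
  "uea_bilinear uea_power_scale (\<lambda>x y. join_right x (uea_comult y))"
  by unfold_locales
    (simp_all add: join_add join_add_uea join_scale join_scale_uea comult.add comult.scale)

lemma comult_left_tensor2: "comult_left (tensor2 x y) = join_left (uea_comult x) y"
  unfolding comult_left_def by (rule uea_bilinear.tensor_lift_tensor2[OF comult_join_bilinear(1)])

lemma comult_right_tensor2: "comult_right (tensor2 x y) = join_right x (uea_comult y)"
  unfolding comult_right_def by (rule uea_bilinear.tensor_lift_tensor2[OF comult_join_bilinear(2)])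

interpretation comult_left: algebra_hom uea_power_scale uea_power_scale comult_left
  unfolding comult_left_def
  by (rule algebra_hom_tensor_lift[OF uea_power_alg.scalar_algebra_axioms comult_join_bilinear(1)])
    (simp_all add: comult.mult comult.one join_mult join_one)

interpretation comult_right: algebra_hom uea_power_scale uea_power_scale comult_right
  unfolding comult_right_def
  by (rule algebra_hom_tensor_lift[OF uea_power_alg.scalar_algebra_axioms comult_join_bilinear(2)])
    (simp_all add: comult.mult comult.one join_mult join_one)

lemma comult_coassociative: "comult_left (uea_comult u) = comult_right (uea_comult u)"
proof (induction u rule: uea_induct)
  case (gen b)
  show ?case
    by (simp add: uea_gen_simps comult_left.add comult_right.add comult_left_tensor2 comult_right_tensor2
      comult.one join_add join_left_tensor2 join_right_tensor2 join_left_one.one flip: tensor2_one)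
qed (simp_all add: comult.add comult.mult comult.scale comult.one
    comult_left.add comult_left.mult comult_left.scale comult_left.one
    comult_right.add comult_right.mult comult_right.scale comult_right.one)

definition counit_left :: "'a::field_char_0 uea2 \<Rightarrow> 'a uea" where
  "counit_left = tensor_lift uea_scale (\<lambda>x y. uea_scale (uea_counit x) y)"

definition counit_right :: "'a::field_char_0 uea2 \<Rightarrow> 'a uea" where
  "counit_right = tensor_lift uea_scale (\<lambda>x y. uea_scale (uea_counit y) x)"

lemma counit_bilinear:
  "uea_bilinear uea_scale (\<lambda>x y. uea_scale (uea_counit x) y)"
  "uea_bilinear uea_scale (\<lambda>x y. uea_scale (uea_counit y) x)"
  by unfold_locales (simp_all add: uea.scale_right_distrib uea.scale_left_distrib mult.commute)

lemma counit_left_tensor2: "counit_left (tensor2 x y) = uea_scale (uea_counit x) y"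
  unfolding counit_left_def by (rule uea_bilinear.tensor_lift_tensor2[OF counit_bilinear(1)])

lemma counit_right_tensor2: "counit_right (tensor2 x y) = uea_scale (uea_counit y) x"
  unfolding counit_right_def by (rule uea_bilinear.tensor_lift_tensor2[OF counit_bilinear(2)])

interpretation counit_left: algebra_hom uea_power_scale uea_scale counit_left
  unfolding counit_left_def
  by (rule algebra_hom_tensor_lift[OF uea_alg.scalar_algebra_axioms counit_bilinear(1)])
    (simp_all add: uea_scale_mult_left uea_scale_mult_right mult.commute)

interpretation counit_right: algebra_hom uea_power_scale uea_scale counit_right
  unfolding counit_right_def
  by (rule algebra_hom_tensor_lift[OF uea_alg.scalar_algebra_axioms counit_bilinear(2)])
    (simp_all add: uea_scale_mult_left uea_scale_mult_right mult.commute)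

lemma counit_left_comult: "counit_left (uea_comult u) = u"
  by (induction u rule: uea_induct)
    (simp_all add: comult.add comult.mult comult.scale comult.one counit_left.add counit_left.mult
      counit_left.scale counit_left.one uea_gen_simps counit_left_tensor2)

lemma counit_right_comult: "counit_right (uea_comult u) = u"
  by (induction u rule: uea_induct)
    (simp_all add: comult.add comult.mult comult.scale comult.one counit_right.add counit_right.mult
      counit_right.scale counit_right.one uea_gen_simps counit_right_tensor2)

section \<open>Contraction of tensors with the antipode\<close>

text \<open>The map x \<otimes> y \<mapsto> S_0(x) c y. The inner element c makes contraction an
  action of the tensor square on U, so that products of tensors can be contracted factor by factor;
  \<open>contract_right\<close> is the mirror image.\<close>

definition contract_left :: "'a::field_char_0 uea fps \<Rightarrow> 'a uea2 fps \<Rightarrow> 'a uea fps" where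
  "contract_left c = tensor_fps_lift uea_scale (\<lambda>x y. fps_map uea_antipode x * c * y)"

definition contract_right :: "'a::field_char_0 uea fps \<Rightarrow> 'a uea2 fps \<Rightarrow> 'a uea fps" where
  "contract_right c = tensor_fps_lift uea_scale (\<lambda>x y. x * c * fps_map uea_antipode y)"

lemma fps_const_uea_scale:
  "fps_const (uea_scale c x) = scalar_series uea_scale (fps_const c) * fps_const x"
  by (simp add: uea_alg.scalar_series_const uea_scale_mult_left)

lemma fps_map_antipode_const: "fps_map uea_antipode (fps_const x) = fps_const (uea_antipode x)"
  by (simp add: fps_map_const uea_antipode_additive)

lemma fps_map_antipode_add:
  "fps_map uea_antipode (f + g) = fps_map uea_antipode f + fps_map uea_antipode g"
  by (rule fps_map_add) (rule uea_antipode_add)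

lemma contract_bilinear:
  "uea_bilinear (\<lambda>k. fps_conv uea_scale (fps_const k))
     (\<lambda>x y. fps_map uea_antipode (fps_const x) * c * fps_const y)"
  "uea_bilinear (\<lambda>k. fps_conv uea_scale (fps_const k))
     (\<lambda>x y. fps_const x * c * fps_map uea_antipode (fps_const y))"
proof -
  have k: "fps_const x * (scalar_series uea_scale k * z) = scalar_series uea_scale k * (fps_const x * z)"
      "c * (scalar_series uea_scale k * z) = scalar_series uea_scale k * (c * z)" for x z k
    by (metis mult.assoc uea_alg.scalar_series_commute)+
  have S: "fps_map uea_antipode (scalar_series uea_scale (fps_const k) * fps_const x) =
      scalar_series uea_scale (fps_const k) * fps_const (uea_antipode x)" for k and x :: "'a uea"
    by (simp only: fps_const_uea_scale[symmetric] fps_map_antipode_const uea_antipode_scale)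
  show "uea_bilinear (\<lambda>k. fps_conv uea_scale (fps_const k))
     (\<lambda>x y. fps_map uea_antipode (fps_const x) * c * fps_const y)"
    by (rule fps_const_bilinear[OF uea_alg.scalar_algebra_axioms,
          where B = "\<lambda>x y. fps_map uea_antipode x * c * y"])
      (simp_all add: fps_map_antipode_add distrib_left distrib_right fps_map_antipode_const
        uea_antipode_add fps_const_uea_scale mult.assoc k S del: fps_const_mult flip: fps_const_add)
  show "uea_bilinear (\<lambda>k. fps_conv uea_scale (fps_const k))
     (\<lambda>x y. fps_const x * c * fps_map uea_antipode (fps_const y))"
    by (rule fps_const_bilinear[OF uea_alg.scalar_algebra_axioms,
          where B = "\<lambda>x y. x * c * fps_map uea_antipode y"])
      (simp_all add: fps_map_antipode_add distrib_left distrib_right fps_map_antipode_const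
        uea_antipode_add fps_const_uea_scale mult.assoc k S del: fps_const_mult flip: fps_const_add)
qed

lemma contract_const:
  "contract_left c (fps_const (tensor2 x y)) = fps_const (uea_antipode x) * c * fps_const y"
  "contract_right c (fps_const (tensor2 x y)) = fps_const x * c * fps_const (uea_antipode y)"
  unfolding contract_left_def contract_right_def
  by (subst tensor_fps_lift_const[OF uea_alg.scalar_algebra_axioms contract_bilinear(1)]
      tensor_fps_lift_const[OF uea_alg.scalar_algebra_axioms contract_bilinear(2)],
      simp add: fps_map_antipode_const)+

lemma t_linear_contract: "t_linear (contract_left c)" "t_linear (contract_right c)"
  unfolding contract_left_def contract_right_def
  by (rule t_linear_tensor_fps_lift[OF uea_alg.scalar_algebra_axioms] contract_bilinear)+

lemma fps_const_tensor2_mult: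
  "fps_const (tensor2 x y) * fps_const (tensor2 x' y') = fps_const (tensor2 (x * x') (y * y'))"
  by (simp add: tensor2_mult)

text \<open>S_0 reverses products, hence S_0(x x') c y y' = S_0(x') (S_0(x) c y) y', and the left
  factor of the product is contracted innermost.\<close>

lemma contract_left_mult: "contract_left c (z * w) = contract_left (contract_left c z) w"
proof (rule t_linear_tensor_eqI[where \<phi> = "\<lambda>w. contract_left c (z * w)"])
  show "t_linear (\<lambda>w. contract_left c (z * w))" "t_linear (contract_left (contract_left c z))"
    by (intro t_linear_comp[OF t_linear_contract(1)] t_linear_intros t_linear_contract)+
  fix x y
  have "contract_left c (z * fps_const (tensor2 x y)) = fps_const (uea_antipode x) * contract_left c z * fps_const y"
    by (rule t_linear_tensor_eqI[where \<phi> = "\<lambda>z. contract_left c (z * fps_const (tensor2 x y))"])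
      (intro t_linear_comp[OF t_linear_contract(1)] t_linear_intros t_linear_contract,
       intro t_linear_intros t_linear_contract,
       simp add: fps_const_tensor2_mult contract_const uea_antipode_mult mult.assoc flip: fps_const_mult)
  then show "contract_left c (z * fps_const (tensor2 x y)) =
      contract_left (contract_left c z) (fps_const (tensor2 x y))"
    by (simp add: contract_const)
qed

text \<open>Now x x' c S_0(y y') = x (x' c S_0(y')) S_0(y), and the right factor is
  innermost.\<close>

lemma contract_right_mult: "contract_right c (z * w) = contract_right (contract_right c w) z"
proof (rule t_linear_tensor_eqI[where \<phi> = "\<lambda>z. contract_right c (z * w)"])
  show "t_linear (\<lambda>z. contract_right c (z * w))" "t_linear (contract_right (contract_right c w))"
    by (intro t_linear_comp[OF t_linear_contract(2)] t_linear_intros t_linear_contract)+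
  fix x y
  have "contract_right c (fps_const (tensor2 x y) * w) = fps_const x * contract_right c w * fps_const (uea_antipode y)"
    by (rule t_linear_tensor_eqI[where \<phi> = "\<lambda>w. contract_right c (fps_const (tensor2 x y) * w)"])
      (intro t_linear_comp[OF t_linear_contract(2)] t_linear_intros t_linear_contract,
       intro t_linear_intros t_linear_contract,
       simp add: fps_const_tensor2_mult contract_const uea_antipode_mult mult.assoc flip: fps_const_mult)
  then show "contract_right c (fps_const (tensor2 x y) * w) =
      contract_right (contract_right c w) (fps_const (tensor2 x y))"
    by (simp add: contract_const)
qed

lemma contract_scalar:
  "contract_left (scalar_series uea_scale c) z = scalar_series uea_scale c * contract_left 1 z"
  "contract_right (scalar_series uea_scale c) z = scalar_series uea_scale c * contract_right 1 z"
  by (rule t_linear_tensor_eqI, intro t_linear_contract, intro t_linear_intros t_linear_contract,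
      simp add: contract_const uea_alg.scalar_series_commute[of "fps_const x" for x] mult.assoc
        uea_alg.scalar_series_commute[of "fps_const x" for x, THEN mult_assoc_eq] del: fps_const_mult)+

lemma contract_one: "contract_left c 1 = c" "contract_right c 1 = c"
  using contract_const[of c 1 1] by (simp_all add: tensor2_one uea_antipode_one)

text \<open>These are the antipode laws of the undeformed structure. They pass to products because
  contracting one coproduct leaves a central scalar, which then comes out of the contraction of the
  other.\<close>

lemma contract_comult:
  "contract_left 1 (fps_map uea_comult f) = fps_unit (fps_counit f)"
  "contract_right 1 (fps_map uea_comult f) = fps_unit (fps_counit f)"
proof -
  have eq: "fps_unit (fps_counit f) = fps_map (\<lambda>x. uea_scale (uea_counit x) 1) f" for f :: "'a uea fps"
    by (rule fps_ext) (simp add: fps_unit_eq scalar_series_def fps_counit_def)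
  have const: "contract_left 1 (fps_const (uea_comult x)) = fps_const (uea_scale (uea_counit x) 1) \<and>
      contract_right 1 (fps_const (uea_comult x)) = fps_const (uea_scale (uea_counit x) 1)" for x :: "'a uea"
  proof (induction x rule: uea_induct)
    case (scalar c)
    have "uea_comult (uea_scale c 1) = tensor2 (uea_scale c 1) (1 :: 'a uea)"
      by (simp add: comult.scale comult.one tensor2_bilinear tensor2_one)
    then show ?case
      by (simp add: contract_const uea_antipode_scale uea_antipode_one)
  next
    case (gen b)
    show ?case
      by (simp add: uea_gen_simps contract_const t_linear_add[OF t_linear_contract(1)]
          t_linear_add[OF t_linear_contract(2)] uea_antipode_one flip: fps_const_add) simp
  next
    case (add u v)
    then show ?case
      by (simp add: comult.add t_linear_add[OF t_linear_contract(1)] t_linear_add[OF t_linear_contract(2)]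
          uea.scale_left_distrib flip: fps_const_add)
  next
    case (mult u v)
    have unit: "fps_const (uea_scale c 1) = scalar_series uea_scale (fps_const c)" for c :: 'a
      by (simp add: uea_alg.scalar_series_const)
    have "contract_left 1 (fps_const (uea_comult (u * v))) =
        scalar_series uea_scale (fps_const (uea_counit u)) * contract_left 1 (fps_const (uea_comult v))"
      using mult(1) by (simp only: comult.mult fps_const_mult[symmetric] contract_left_mult unit contract_scalar)
    moreover have "contract_right 1 (fps_const (uea_comult (u * v))) =
        scalar_series uea_scale (fps_const (uea_counit v)) * contract_right 1 (fps_const (uea_comult u))"
      using mult(2) by (simp only: comult.mult fps_const_mult[symmetric] contract_right_mult unit contract_scalar)
    ultimately show ?case
      using mult by (simp add: uea_alg.scalar_series_const uea_scale_mult_left mult.commute)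
  qed
  show "contract_left 1 (fps_map uea_comult f) = fps_unit (fps_counit f)"
    unfolding eq
    by (rule t_linear_eqI) (auto intro!: t_linear_comp[OF t_linear_contract(1)] t_linear_fps_map
      simp: comult.add uea.scale_left_distrib fps_map_const comult.additive const)
  show "contract_right 1 (fps_map uea_comult f) = fps_unit (fps_counit f)"
    unfolding eq
    by (rule t_linear_eqI) (auto intro!: t_linear_comp[OF t_linear_contract(2)] t_linear_fps_map
      simp: comult.add uea.scale_left_distrib fps_map_const comult.additive const)
qed

section \<open>The twisted Hopf structure\<close>

interpretation tensor_right: algebra_hom uea_scale uea_power_scale "tensor2 1"
  by unfold_locales (simp_all add: tensor2_bilinear tensor2_mult tensor2_one)

interpretation tensor_left: algebra_hom uea_scale uea_power_scale "\<lambda>x. tensor2 x 1"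
  by unfold_locales (simp_all add: tensor2_bilinear tensor2_mult tensor2_one)

lemma const_tensor_fps: "fps_const x \<otimes>\<^sub>t g = fps_const (tensor2 x 1) * fps_map (tensor2 1) g"
  by (rule fps_ext) (simp add: tensor2_mult)

lemma one_tensor_fps_const: "1 \<otimes>\<^sub>t fps_const x = fps_const (tensor2 1 x)"
  unfolding fps_const_1_eq_1[symmetric] const_tensor_fps
  by (simp add: fps_map_const tensor2_one del: fps_const_1_eq_1)

text \<open>A scalar exponent is a case of commuting H and E, so all powers in the formulas become
  twists.\<close>

lemma one_minus_et_powr_eq: "one_minus_et_powr e c = twist uea_scale (uea_scale c 1) e"
proof (rule fps_ext)
  fix m
  have "falling_prod c m = (\<Prod>i=0..<m. c - of_nat i)"
    by (induction m) (simp_all add: falling_prod_Suc)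
  moreover have "falling_prod (uea_scale c 1) m = uea_scale (falling_prod c m) 1"
    by (induction m)
      (simp_all add: falling_prod_Suc uea_scale_mult_left uea.scale_left_diff_distrib right_diff_distrib
        uea_alg.of_nat_mult_eq_scale[of _ 1, simplified])
  ultimately show "fps_nth (one_minus_et_powr e c) m = fps_nth (twist uea_scale (uea_scale c 1) e) m"
    by (simp add: one_minus_et_powr_def twist_def gbinomial_prod_rev uea_scale_mult_left)
qed

lemma rising_2: "rising x a 2 = (x + uea_scale a 1) * (x + uea_scale (a + 1) 1)"
  and falling_1: "falling x a 1 = x + uea_scale a 1"
  and falling_2: "falling x a 2 = (x + uea_scale a 1) * (x + uea_scale (a - 1) 1)"
  by (simp_all add: rising_def falling_def upt_rec)

lemma fps_conv_join_const:
  "fps_conv join_left g (fps_const y) = fps_map (\<lambda>w. join_left w 1) g * fps_const (join_left 1 y)"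
  "fps_conv join_right (fps_const y) g = fps_const (join_right y 1) * fps_map (join_right 1) g"
proof -
  have 0: "join_left w 0 = 0" "join_right 0 w = 0" for w :: "'a uea2"
    using join_add_uea(1)[of w 0 0] join_add_uea(2)[of 0 0 w] by simp_all
  show "fps_conv join_right (fps_const y) g = fps_const (join_right y 1) * fps_map (join_right 1) g"
    by (rule fps_ext) (simp add: 0 join_mult(2)[symmetric])
  show "fps_conv join_left g (fps_const y) = fps_map (\<lambda>w. join_left w 1) g * fps_const (join_left 1 y)"
  proof (rule fps_ext)
    fix n
    have "fps_nth (fps_conv join_left g (fps_const y)) n =
        (\<Sum>i=0..n. if i = n then join_left (fps_nth g n) y else 0)"
      unfolding fps_conv_nth by (rule sum.cong) (auto simp: 0)
    then show "fps_nth (fps_conv join_left g (fps_const y)) n =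
        fps_nth (fps_map (\<lambda>w. join_left w 1) g * fps_const (join_left 1 y)) n"
      by (simp add: join_mult(1)[symmetric])
  qed
qed

lemma join_commute:
  "fps_map (\<lambda>w. join_left w 1) g * fps_const (join_left 1 y) = fps_const (join_left 1 y) * fps_map (\<lambda>w. join_left w 1) g"
  "fps_const (join_right y 1) * fps_map (join_right 1) g = fps_map (join_right 1) g * fps_const (join_right y 1)"
  by (rule fps_ext, simp add: join_mult[symmetric])+

text \<open>The Hopf axioms use only that h and e are primitive with [h,e] = e. The particular
  brackets with the other generators matter only for the explicit formulas.\<close>

locale twisting_pair =
  fixes h e :: "'a::field_char_0 uea"
  assumes bracket: "h * e = e * h + e"
    and comult_h: "uea_comult h = tensor2 h 1 + tensor2 1 h"
    and comult_e: "uea_comult e = tensor2 e 1 + tensor2 1 e"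
    and antipode_h: "uea_antipode h = - h" and antipode_e: "uea_antipode e = - e"
    and counit_h: "uea_counit h = 0" and counit_e: "uea_counit e = 0"
begin

text \<open>F and \<open>F'\<close> are powers with commuting exponent and base, so they differ in
  the sign of h; u = exp(-the) and v = exp(the) differ in the sign of e.\<close>

definition "F = twist uea_power_scale (tensor2 h 1) (tensor2 1 e)"
definition "F' = twist uea_power_scale (tensor2 (- h) 1) (tensor2 1 e)"
definition "u = twist uea_scale h e"
definition "v = twist uea_scale h (- e)"

definition \<Delta> :: "'a uea fps \<Rightarrow> 'a uea2 fps" where
  "\<Delta> f = F * fps_map uea_comult f * F'"

definition S :: "'a uea fps \<Rightarrow> 'a uea fps" where
  "S f = v * fps_map uea_antipode f * u"

lemma F_inverse: "F * F' = 1" "F' * F = 1"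
  using uea_power_alg.twist_inverse[of "tensor2 h 1" "tensor2 1 e"]
  by (simp_all add: F_def F'_def tensor2_mult tensor_left.additive)

lemma v_u: "v * u = 1"
  using uea_alg.twist_inverse_noncommuting[of h "- e"] bracket by (simp add: u_def v_def)

lemma u_v: "u * v = 1"
  using uea_alg.twist_inverse_noncommuting[OF bracket] by (simp add: u_def v_def)

lemma F'_F_assoc: "F' * (F * z) = z" and u_v_assoc: "u * (v * z') = z'"
  by (simp_all add: F_inverse u_v flip: mult.assoc)

lemma t_linear_\<Delta>: "t_linear \<Delta>"
  unfolding \<Delta>_def by (intro t_linear_intros t_linear_fps_map comult.add)

lemma t_linear_S: "t_linear S"
  unfolding S_def by (intro t_linear_intros t_linear_fps_map uea_antipode_add)

lemma \<Delta>_mult: "\<Delta> (f * g) = \<Delta> f * \<Delta> g"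
  by (simp add: \<Delta>_def comult.fps_map_mult mult.assoc F'_F_assoc)

lemma \<Delta>_one: "\<Delta> 1 = 1"
  by (simp add: \<Delta>_def comult.fps_map_one F_inverse)

lemma S_mult: "S (f * g) = S g * S f"
  by (simp add: S_def fps_map_antipode_mult mult.assoc u_v_assoc)

lemma fps_map_antipode_scalar_series:
  "fps_map uea_antipode (scalar_series uea_scale c) = scalar_series uea_scale c"
  by (rule fps_ext) (simp add: scalar_series_def uea_antipode_scale uea_antipode_one)

lemma fps_map_antipode_one: "fps_map uea_antipode (1 :: 'a uea fps) = 1"
  using fps_map_antipode_const[of "1 :: 'a uea"] by (simp add: uea_antipode_one)

lemma S_one: "S 1 = 1"
  by (simp add: S_def fps_map_antipode_one v_u)

lemma module_hom_\<Delta>: "module_hom uea_fps_scale uea2_fps_scale \<Delta>"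
proof -
  interpret s: module uea_fps_scale by (rule uea.module_fps_conv)
  interpret s': module uea2_fps_scale by (rule uea_power.module_fps_conv)
  have "\<Delta> (scalar_series uea_scale c) = scalar_series uea_power_scale c" for c
    by (simp add: \<Delta>_def comult.fps_map_scalar_series uea_power_alg.scalar_series_commute[of F]
      F_inverse mult.assoc)
  then show ?thesis
    by unfold_locales (simp_all add: t_linear_add[OF t_linear_\<Delta>] uea_alg.fps_conv_eq_mult
      uea_power_alg.fps_conv_eq_mult \<Delta>_mult)
qed

lemma module_hom_S: "module_hom uea_fps_scale uea_fps_scale S"
proof -
  interpret s: module uea_fps_scale by (rule uea.module_fps_conv)
  have "S (scalar_series uea_scale c) = scalar_series uea_scale c" for c
    by (simp add: S_def fps_map_antipode_scalar_series uea_alg.scalar_series_commute[of v] v_u mult.assoc)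
  then show ?thesis
    by unfold_locales (simp_all add: t_linear_add[OF t_linear_S] uea_alg.fps_conv_eq_mult
      S_mult uea_alg.scalar_series_commute)
qed

text \<open>In F^{-1} the antipode meets the falling product of -h; its factors commute and S_0
  turns -h - j into h - j. In F it meets e^m and gives (-e)^m.\<close>

lemma contract_F: "contract_left 1 F' = u" "contract_right 1 F = v"
proof -
  have add: "uea_bilinear uea_scale (\<lambda>x y. uea_antipode x * y)" "uea_bilinear uea_scale (\<lambda>x y. x * uea_antipode y)"
    by unfold_locales (simp_all add: uea_antipode_add uea_antipode_scale distrib_left distrib_right
      uea_scale_mult_left uea_scale_mult_right)
  note lift = uea_bilinear.tensor_lift_add[OF add(1)] uea_bilinear.tensor_lift_add[OF add(2)]
    uea_bilinear.tensor_lift_scale[OF add(1)] uea_bilinear.tensor_lift_scale[OF add(2)]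
    uea_bilinear.tensor_lift_tensor2[OF add(1)] uea_bilinear.tensor_lift_tensor2[OF add(2)]
  let ?l = "tensor_lift uea_scale (\<lambda>x y. uea_antipode x * y :: 'a uea)"
  let ?r = "tensor_lift uea_scale (\<lambda>x y. x * uea_antipode y :: 'a uea)"
  \<comment> \<open>With inner element 1, which carries no t, contraction is a linear map applied to
    each coefficient.\<close>
  have l: "contract_left 1 z = fps_map ?l z" for z :: "'a uea2 fps"
    by (rule t_linear_tensor_eqI[OF t_linear_contract(1) t_linear_fps_map])
      (simp_all add: lift contract_const fps_map_const additive_sum[of ?l])
  have r: "contract_right 1 z = fps_map ?r z" for z :: "'a uea2 fps"
    by (rule t_linear_tensor_eqI[OF t_linear_contract(2) t_linear_fps_map])
      (simp_all add: lift contract_const fps_map_const additive_sum[of ?r])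
  have coeff: "uea_power_scale c (falling_prod (tensor2 x 1) m * tensor2 1 e ^ m) =
      uea_power_scale c (tensor2 (falling_prod x m) (e ^ m))" for c m x
    by (simp add: tensor_left.falling_prod[symmetric] tensor_right.power[symmetric] tensor2_mult)
  have power: "uea_antipode (e ^ m) = (- e) ^ m" for m
    by (induction m) (simp_all add: uea_antipode_one uea_antipode_mult antipode_e power_commuting_commutes[of "- e" e])
  have of_nat: "uea_antipode (of_nat m) = (of_nat m :: 'a uea)" for m
    by (induction m) (simp_all add: uea_antipode_add uea_antipode_additive uea_antipode_one)
  have falling: "uea_antipode (falling_prod (- h) m) = falling_prod h m" for m
  proof (induction m)
    case (Suc m)
    have "uea_antipode (falling_prod (- h) (Suc m)) = (h - of_nat m) * falling_prod h m"
      by (simp add: falling_prod_Suc uea_antipode_mult uea_antipode_additive uea_antipode_add antipode_h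
        of_nat Suc.IH)
    also have "\<dots> = falling_prod h m * (h - of_nat m)"
      by (rule commute_falling_prod[OF commute_of_nat_diff[OF refl, symmetric]])
    finally show ?case
      by (simp add: falling_prod_Suc)
  qed (simp add: uea_antipode_one)
  show "contract_left 1 F' = u"
    by (rule fps_ext) (simp add: l F'_def u_def twist_def coeff lift falling)
  show "contract_right 1 F = v"
    by (rule fps_ext) (simp add: r F_def v_def twist_def coeff lift power)
qed

text \<open>Contract the factors of F \<Delta>_0(f) F^{-1} in turn. As u is the contraction of
  F^{-1}, contracting F with inner element u gives the contraction of F^{-1} F = 1; then
  \<Delta>_0(f) gives the counit, and the last F^{-1} restores u. The right-hand version runs from
  the other end with v.\<close>

lemma contract_\<Delta>:
  "contract_left u (\<Delta> f) = fps_unit (fps_counit f) * u"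
  "contract_right v (\<Delta> f) = fps_unit (fps_counit f) * v"
proof -
  have "contract_left u F = 1"
    unfolding contract_F[symmetric] by (simp add: F_inverse contract_one flip: contract_left_mult)
  then show "contract_left u (\<Delta> f) = fps_unit (fps_counit f) * u"
    by (simp add: \<Delta>_def contract_left_mult contract_comult fps_unit_eq contract_scalar contract_F)
  have "contract_right v F' = 1"
    unfolding contract_F[symmetric] by (simp add: F_inverse contract_one flip: contract_right_mult)
  then show "contract_right v (\<Delta> f) = fps_unit (fps_counit f) * v"
    by (simp add: \<Delta>_def contract_right_mult contract_comult fps_unit_eq contract_scalar contract_F)
qed

text \<open>Since S(x) = v S_0(x) u, the left law is v times a contraction with inner element u, and
  the right law is a contraction with inner element v times u. The counit is central, and v u = 1
  removes the rest.\<close>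

lemma antipode_laws:
  "tensor_fps_lift uea_scale (\<lambda>x y. S x * y) (\<Delta> f) = fps_unit (fps_counit f)"
  "tensor_fps_lift uea_scale (\<lambda>x y. x * S y) (\<Delta> f) = fps_unit (fps_counit f)"
proof -
  note s = uea_alg.scalar_series_commute
  have k: "x * (scalar_series uea_scale k * z) = scalar_series uea_scale k * (x * z)" for x z :: "'a uea fps" and k
    by (metis mult.assoc s)
  have S_const: "S (fps_const x) = v * fps_const (uea_antipode x) * u" for x
    by (simp add: S_def fps_map_antipode_const)
  have bl: "uea_bilinear (\<lambda>k. fps_conv uea_scale (fps_const k)) (\<lambda>x y. S (fps_const x) * fps_const y)"
    by (rule fps_const_bilinear[OF uea_alg.scalar_algebra_axioms, where B = "\<lambda>x y. S x * y"],
        simp_all only: S_const uea_antipode_add uea_antipode_scale)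
      (simp_all add: distrib_left distrib_right fps_const_uea_scale mult.assoc k
        del: fps_const_mult flip: fps_const_add)
  have br: "uea_bilinear (\<lambda>k. fps_conv uea_scale (fps_const k)) (\<lambda>x y. fps_const x * S (fps_const y))"
    by (rule fps_const_bilinear[OF uea_alg.scalar_algebra_axioms, where B = "\<lambda>x y. x * S y"],
        simp_all only: S_const uea_antipode_add uea_antipode_scale)
      (simp_all add: distrib_left distrib_right fps_const_uea_scale mult.assoc k
        del: fps_const_mult flip: fps_const_add)
  have "tensor_fps_lift uea_scale (\<lambda>x y. S x * y) z = v * contract_left u z" for z
    by (rule t_linear_tensor_eqI[OF t_linear_tensor_fps_lift[OF uea_alg.scalar_algebra_axioms bl]])
      (intro t_linear_intros t_linear_contract, simp add: contract_const S_const mult.assoc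
        tensor_fps_lift_const[OF uea_alg.scalar_algebra_axioms bl])
  then show "tensor_fps_lift uea_scale (\<lambda>x y. S x * y) (\<Delta> f) = fps_unit (fps_counit f)"
    by (simp add: contract_\<Delta> fps_unit_eq k v_u)
  have "tensor_fps_lift uea_scale (\<lambda>x y. x * S y) z = contract_right v z * u" for z
    by (rule t_linear_tensor_eqI[OF t_linear_tensor_fps_lift[OF uea_alg.scalar_algebra_axioms br]])
      (intro t_linear_intros t_linear_contract, simp add: contract_const S_const mult.assoc
        tensor_fps_lift_const[OF uea_alg.scalar_algebra_axioms br])
  then show "tensor_fps_lift uea_scale (\<lambda>x y. x * S y) (\<Delta> f) = fps_unit (fps_counit f)"
    by (simp add: contract_\<Delta> mult.assoc v_u)
qed

lemma counit_laws:
  "tensor_fps_lift uea_scale (\<lambda>x y. fps_unit (fps_counit x) * y) (\<Delta> f) = f"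
  "tensor_fps_lift uea_scale (\<lambda>x y. x * fps_unit (fps_counit y)) (\<Delta> f) = f"
proof -
  have k: "x * (scalar_series uea_scale k * z) = scalar_series uea_scale k * (x * z)" for x z :: "'a uea fps" and k
    by (metis mult.assoc uea_alg.scalar_series_commute)
  have const: "fps_unit (fps_counit (fps_const x)) = fps_const (uea_scale (uea_counit x) 1)" for x :: "'a uea"
    by (simp add: fps_counit_def fps_map_const fps_unit_eq uea_alg.scalar_series_const)
  have bl: "uea_bilinear (\<lambda>k. fps_conv uea_scale (fps_const k)) (\<lambda>x y. fps_unit (fps_counit (fps_const x)) * fps_const y :: 'a uea fps)"
    by (rule fps_const_bilinear[OF uea_alg.scalar_algebra_axioms, where B = "\<lambda>x y. fps_unit (fps_counit x) * y"])
      (simp_all add: const uea_scale_mult_left uea_scale_mult_right uea.scale_left_distrib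
        uea.scale_right_distrib distrib_left distrib_right mult.commute)
  have br: "uea_bilinear (\<lambda>k. fps_conv uea_scale (fps_const k)) (\<lambda>x y. fps_const x * fps_unit (fps_counit (fps_const y)) :: 'a uea fps)"
    by (rule fps_const_bilinear[OF uea_alg.scalar_algebra_axioms, where B = "\<lambda>x y. x * fps_unit (fps_counit y)"])
      (simp_all add: const uea_scale_mult_left uea_scale_mult_right uea.scale_left_distrib
        uea.scale_right_distrib distrib_left distrib_right mult.commute)
  have l: "tensor_fps_lift uea_scale (\<lambda>x y. fps_unit (fps_counit x) * y) z = fps_map counit_left z" for z :: "'a uea2 fps"
    by (rule t_linear_tensor_eqI[OF t_linear_tensor_fps_lift[OF uea_alg.scalar_algebra_axioms bl]])
      (intro t_linear_fps_map counit_left.add, simp add: const counit_left_tensor2 fps_map_const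
        uea_scale_mult_left counit_left.additive
        tensor_fps_lift_const[OF uea_alg.scalar_algebra_axioms bl])
  have r: "tensor_fps_lift uea_scale (\<lambda>x y. x * fps_unit (fps_counit y)) z = fps_map counit_right z" for z :: "'a uea2 fps"
    by (rule t_linear_tensor_eqI[OF t_linear_tensor_fps_lift[OF uea_alg.scalar_algebra_axioms br]])
      (intro t_linear_fps_map counit_right.add, simp add: const counit_right_tensor2 fps_map_const
        uea_scale_mult_right counit_right.additive
        tensor_fps_lift_const[OF uea_alg.scalar_algebra_axioms br])
  \<comment> \<open>A counit on the first factor kills the exponent of F, and on the second it kills
    the base; the latter case needs these values.\<close>
  have twist0: "twist uea_scale h 0 = 1" "twist uea_scale (- h) 0 = 1"
    by (rule fps_ext; simp add: twist_def power_0_left)+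
  have "fps_map counit_left F = 1" "fps_map counit_left F' = 1"
    "fps_map counit_right F = 1" "fps_map counit_right F' = 1"
    unfolding F_def F'_def counit_left.fps_map_twist counit_right.fps_map_twist
    by (simp_all add: counit_left_tensor2 counit_right_tensor2 counit_h counit_e counit.additive twist0)
  moreover have "fps_map counit_left (fps_map uea_comult f) = f" "fps_map counit_right (fps_map uea_comult f) = f"
    by (rule fps_ext; simp add: counit_left_comult counit_right_comult)+
  ultimately show
    "tensor_fps_lift uea_scale (\<lambda>x y. fps_unit (fps_counit x) * y) (\<Delta> f) = f"
    "tensor_fps_lift uea_scale (\<lambda>x y. x * fps_unit (fps_counit y)) (\<Delta> f) = f"
    unfolding l r by (simp_all add: \<Delta>_def counit_left.fps_map_mult counit_right.fps_map_mult)
qed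

lemma coassociativity:
  "tensor_fps_lift uea_power_scale (\<lambda>x y. fps_conv join_left (\<Delta> x) y) (\<Delta> f) =
   tensor_fps_lift uea_power_scale (\<lambda>x y. fps_conv join_right x (\<Delta> y)) (\<Delta> f)"
proof -
  let ?jl = "fps_map (\<lambda>w. join_left w (1 :: 'a uea))" and ?jr = "fps_map (join_right (1 :: 'a uea))"
  \<comment> \<open>An element of the third slot commutes with the first two slots, so it can be
    drawn inside the conjugation by F_{12}; \<open>const_r\<close> is the mirror image with
    F_{23}.\<close>
  have const_l: "fps_conv join_left (\<Delta> (fps_const x)) (fps_const y) =
      ?jl F * fps_const (comult_left (tensor2 x y)) * ?jl F'" for x y
  proof -
    have "fps_conv join_left (\<Delta> (fps_const x)) (fps_const y) =
        ?jl F * (fps_const (join_left (uea_comult x) 1) * fps_const (join_left 1 y)) * ?jl F'"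
      unfolding fps_conv_join_const \<Delta>_def join_left_one.fps_map_mult
      by (simp only: mult.assoc join_commute fps_map_const comult.additive join_left_one.additive)
    then show ?thesis
      by (simp add: comult_left_tensor2 join_mult(1)[symmetric])
  qed
  have const_r: "fps_conv join_right (fps_const x) (\<Delta> (fps_const y)) =
      ?jr F * fps_const (comult_right (tensor2 x y)) * ?jr F'" for x y
  proof -
    have "fps_conv join_right (fps_const x) (\<Delta> (fps_const y)) =
        ?jr F * (fps_const (join_right x 1) * fps_const (join_right 1 (uea_comult y))) * ?jr F'"
      unfolding fps_conv_join_const \<Delta>_def join_right_one.fps_map_mult
      by (simp only: mult.assoc[symmetric] join_commute fps_map_const comult.additive join_right_one.additive)
    then show ?thesis
      by (simp add: comult_right_tensor2 join_mult(2)[symmetric])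
  qed
  have scalar: "fps_const (uea_power_scale c x) = scalar_series uea_power_scale (fps_const c) * fps_const x"
    for c and x :: "'a uea3"
    by (simp add: uea_power_alg.scalar_series_const uea_power_scale_mult_left)
  have k: "x * (scalar_series uea_power_scale k * z) = scalar_series uea_power_scale k * (x * z)"
    for x z :: "'a uea3 fps" and k
    by (metis mult.assoc uea_power_alg.scalar_series_commute)
  have bl: "uea_bilinear (\<lambda>k. fps_conv uea_power_scale (fps_const k))
      (\<lambda>x y. fps_conv join_left (\<Delta> (fps_const x)) (fps_const y))"
    by (rule fps_const_bilinear[OF uea_power_alg.scalar_algebra_axioms, where B = "\<lambda>x y. fps_conv join_left (\<Delta> x) y"],
        simp_all only: const_l tensor2_bilinear comult_left.add comult_left.scale)
      (simp_all add: scalar k distrib_left distrib_right mult.assoc del: fps_const_mult flip: fps_const_add)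
  have br: "uea_bilinear (\<lambda>k. fps_conv uea_power_scale (fps_const k))
      (\<lambda>x y. fps_conv join_right (fps_const x) (\<Delta> (fps_const y)))"
    by (rule fps_const_bilinear[OF uea_power_alg.scalar_algebra_axioms, where B = "\<lambda>x y. fps_conv join_right x (\<Delta> y)"],
        simp_all only: const_r tensor2_bilinear comult_right.add comult_right.scale)
      (simp_all add: scalar k distrib_left distrib_right mult.assoc del: fps_const_mult flip: fps_const_add)
  have l: "tensor_fps_lift uea_power_scale (\<lambda>x y. fps_conv join_left (\<Delta> x) y) z =
      ?jl F * fps_map comult_left z * ?jl F'" for z
    by (rule t_linear_tensor_eqI[OF t_linear_tensor_fps_lift[OF uea_power_alg.scalar_algebra_axioms bl]])
      (intro t_linear_intros t_linear_fps_map comult_left.add, simp add: const_l fps_map_const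
        comult_left.additive tensor_fps_lift_const[OF uea_power_alg.scalar_algebra_axioms bl])
  have r: "tensor_fps_lift uea_power_scale (\<lambda>x y. fps_conv join_right x (\<Delta> y)) z =
      ?jr F * fps_map comult_right z * ?jr F'" for z
    by (rule t_linear_tensor_eqI[OF t_linear_tensor_fps_lift[OF uea_power_alg.scalar_algebra_axioms br]])
      (intro t_linear_intros t_linear_fps_map comult_right.add, simp add: const_r fps_map_const
        comult_right.additive tensor_fps_lift_const[OF uea_power_alg.scalar_algebra_axioms br])
  have "twist uea_power_scale (tensor3 h 1 1) (tensor3 1 e 1)
        * twist uea_power_scale (tensor3 h 1 1 + tensor3 1 h 1) (tensor3 1 1 e)
      = twist uea_power_scale (tensor3 1 h 1) (tensor3 1 1 e)
        * twist uea_power_scale (tensor3 h 1 1) (tensor3 1 e 1 + tensor3 1 1 e)"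
    by (rule uea_power_alg.twist_cocycle) (simp_all add: tensor3_mult bracket tensor3_trilinear)
  then have cocycle: "?jl F * fps_map comult_left F = ?jr F * fps_map comult_right F"
    unfolding F_def join_left_one.fps_map_twist join_right_one.fps_map_twist comult_left.fps_map_twist
      comult_right.fps_map_twist
    by (simp add: join_left_tensor2 join_right_tensor2 comult_left_tensor2 comult_right_tensor2
      comult_h comult_e join_add comult.one flip: tensor2_one)
  have inverse: "?jl F' * ?jl F = 1" "?jl F * ?jl F' = 1" "?jr F' * ?jr F = 1" "?jr F * ?jr F' = 1"
    "fps_map comult_left F' * fps_map comult_left F = 1" "fps_map comult_left F * fps_map comult_left F' = 1"
    "fps_map comult_right F' * fps_map comult_right F = 1" "fps_map comult_right F * fps_map comult_right F' = 1"
    by (simp_all add: F_inverse join_left_one.fps_map_one join_right_one.fps_map_one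
      comult_left.fps_map_one comult_right.fps_map_one flip: join_left_one.fps_map_mult
      join_right_one.fps_map_mult comult_left.fps_map_mult comult_right.fps_map_mult)
  \<comment> \<open>Both iterated comultiplications are conjugations by \<open>?Q\<close>. For the
    inverses, \<open>?l\<close> is a left inverse of \<open>?Q\<close>, and \<open>?r\<close> is a
    right inverse by the cocycle identity, so the two coincide.\<close>
  let ?Q = "?jl F * fps_map comult_left F"
  let ?l = "fps_map comult_left F' * ?jl F'" and ?r = "fps_map comult_right F' * ?jr F'"
  have lQ: "?l * ?Q = 1"
    by (simp add: mult.assoc inverse inverse[THEN mult_assoc_eq])
  have Qr: "?Q * ?r = 1"
    unfolding cocycle by (simp add: mult.assoc inverse inverse[THEN mult_assoc_eq])
  have "?l = ?l * (?Q * ?r)"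
    unfolding Qr by simp
  also have "\<dots> = ?l * ?Q * ?r"
    by (simp only: mult.assoc)
  finally have lr: "?l = ?r"
    unfolding lQ by simp
  have coassoc: "fps_map comult_left (fps_map uea_comult f) = fps_map comult_right (fps_map uea_comult f)"
    by (rule fps_ext) (simp add: comult_coassociative)
  have "?jl F * fps_map comult_left (\<Delta> f) * ?jl F' = ?Q * fps_map comult_left (fps_map uea_comult f) * ?l"
    by (simp add: \<Delta>_def comult_left.fps_map_mult mult.assoc)
  also have "\<dots> = ?jr F * fps_map comult_right (\<Delta> f) * ?jr F'"
    unfolding lr cocycle coassoc by (simp add: \<Delta>_def comult_right.fps_map_mult mult.assoc)
  finally show ?thesis
    unfolding l r .
qed

theorem topological_hopf_algebra: "topological_hopf_algebra \<Delta> S fps_counit"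
proof -
  interpret s: module uea_fps_scale by (rule uea.module_fps_conv)
  have "fps_counit (scalar_series uea_scale c) = c" for c :: "'a fps"
    by (rule fps_ext) (simp add: fps_counit_def scalar_series_def)
  moreover have mult: "fps_counit (f * g) = fps_counit f * fps_counit g" for f g :: "'a uea fps"
    unfolding fps_counit_def by (rule counit.fps_map_mult)
  ultimately have "module_hom uea_fps_scale (*) (fps_counit :: 'a uea fps \<Rightarrow> 'a fps)"
    by unfold_locales
      (simp_all add: uea_alg.fps_conv_eq_mult algebra_simps, simp add: fps_counit_def fps_map_add)
  then show ?thesis
    unfolding topological_hopf_algebra_def
    using module_hom_\<Delta> module_hom_S \<Delta>_mult \<Delta>_one S_mult S_one coassociativity counit_laws antipode_laws mult
    by (simp add: fps_counit_def counit.fps_map_one)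
qed

end

section \<open>Values on weight vectors and reduction modulo t\<close>

context twisting_pair
begin

text \<open>F meets X \<otimes> 1 through the weight of X (\<open>twist_weight\<close>) and 1
  \<otimes> X through the commutators with e (\<open>twist_conj\<close>); in each case it passes to
  the right and cancels against \<open>F'\<close>.\<close>

lemma \<Delta>_formula:
  assumes X: "uea_comult X = tensor2 X 1 + tensor2 1 X"
    and e: "e * X - X * e = X'" "e * X' - X' * e = Z + Z" "e * Z = Z * e"
    and h: "h * X - X * h = uea_scale w X"
  shows "\<Delta> (fps_const X) = 1 \<otimes>\<^sub>t fps_const X + fps_const X \<otimes>\<^sub>t one_minus_et_powr e w
    - fps_const h \<otimes>\<^sub>t (one_minus_et_powr e (- 1) * fps_const X' * fps_X)
    + fps_const (rising h 0 2) \<otimes>\<^sub>t (one_minus_et_powr e (- 2) * fps_const Z * fps_X ^ 2)"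
proof -
  let ?r = "fps_map (tensor2 (1 :: 'a uea))"
  have g: "geometric (tensor2 1 e) = ?r (one_minus_et_powr e (- 1))"
    by (simp add: one_minus_et_powr_eq tensor_right.fps_map_twist tensor_right.additive tensor2_one
      flip: uea_power_alg.twist_minus_1)
  have "uea_scale (- 2) (1 :: 'a uea) = - 1 + - 1"
    using uea.scale_left_distrib[of "- 1" "- 1" "1 :: 'a uea"] by simp
  then have g2: "geometric (tensor2 1 e) * geometric (tensor2 1 e) = ?r (one_minus_et_powr e (- 2))"
    unfolding g tensor_right.fps_map_mult[symmetric] one_minus_et_powr_eq
    by (simp add: uea_alg.twist_mult)
  have 1: "F * fps_const (tensor2 X 1) = fps_const (tensor2 X 1) * ?r (one_minus_et_powr e w) * F"
    using uea_power_alg.twist_weight[of "tensor2 h 1" "tensor2 1 e" "tensor2 X 1" w] h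
    by (simp add: F_def tensor2_mult one_minus_et_powr_eq tensor_right.fps_map_twist tensor_right.scale
      tensor_right.one tensor2_bilinear flip: tensor_left.additive)
  have "F * fps_const (tensor2 1 X) = (fps_const (tensor2 1 X)
      - fps_const (tensor2 h 1) * (geometric (tensor2 1 e) * fps_const (tensor2 1 X') * fps_X)
      + fps_const (tensor2 h 1 * (tensor2 h 1 + 1)) * (geometric (tensor2 1 e) * geometric (tensor2 1 e)
          * fps_const (tensor2 1 Z) * fps_X ^ 2)) * F"
    unfolding F_def
    by (rule uea_power_alg.twist_conj)
      (simp_all add: tensor2_mult e(3), simp_all add: e(1,2) tensor_right.add[symmetric] tensor_right.additive[symmetric])
  moreover have "tensor2 h 1 * (tensor2 h 1 + 1) = tensor2 (rising h 0 2) 1"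
    by (simp add: rising_2 tensor_left.add tensor_left.mult tensor2_one)
  ultimately have 2: "F * fps_const (tensor2 1 X) = (fps_const (tensor2 1 X)
      - fps_const (tensor2 h 1) * ?r (one_minus_et_powr e (- 1) * fps_const X' * fps_X)
      + fps_const (tensor2 (rising h 0 2) 1) * ?r (one_minus_et_powr e (- 2) * fps_const Z * fps_X ^ 2)) * F"
    by (simp add: g2 power2_eq_square tensor_right.fps_map_mult tensor_right.fps_map_X fps_map_const)
      (simp add: g)
  have "\<Delta> (fps_const X) = (F * fps_const (tensor2 X 1) + F * fps_const (tensor2 1 X)) * F'"
    by (simp add: \<Delta>_def fps_map_const comult.additive X algebra_simps flip: fps_const_add)
  then show ?thesis
    unfolding 1 2 const_tensor_fps one_tensor_fps_const
    by (simp add: distrib_right mult.assoc F_inverse)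
qed

text \<open>S(X) = -v X u, and \<open>twist_conj_noncommuting\<close> carries v across X to cancel
  u. The weights w + 1 and w + 2 reflect that e itself has weight 1.\<close>

lemma S_formula:
  assumes X: "uea_antipode X = - X"
    and e: "e * X - X * e = X'" "e * X' - X' * e = Z + Z" "e * Z = Z * e"
    and h: "h * X - X * h = uea_scale w X" "h * X' - X' * h = uea_scale (w + 1) X'"
      "h * Z - Z * h = uea_scale (w + 2) Z"
  shows "S (fps_const X) = - (one_minus_et_powr e (- w) * (fps_const X
    + fps_const (X' * falling h 1 1) * fps_X + fps_const (Z * falling h 2 2) * fps_X ^ 2))"
proof -
  have "uea_scale (2 :: 'a) 1 = 2"
    using uea_alg.of_nat_mult_eq_scale[of 2 "1 :: 'a uea"] by simp
  then have f: "falling h 1 1 = h + 1" "falling h 2 2 = (h + 2) * (h + 1)"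
    unfolding falling_1 falling_2 by simp_all
  have "S (fps_const X) = - (v * fps_const X * u)"
    by (simp add: S_def fps_map_antipode_const X del: fps_const_neg flip: fps_const_neg)
  also have "v * fps_const X = twist uea_scale (uea_scale (- w) 1) e *
    (fps_const X + fps_const (X' * (h + 1)) * fps_X + fps_const (Z * ((h + 2) * (h + 1))) * fps_X ^ 2) * v"
    unfolding v_def by (rule uea_alg.twist_conj_noncommuting[OF bracket e h])
  finally show ?thesis
    unfolding f by (simp add: mult.assoc v_u one_minus_et_powr_eq)
qed

lemma fps_nth_0_\<Delta>: "fps_nth (\<Delta> f) 0 = uea_comult (fps_nth f 0)"
  and fps_nth_0_S: "fps_nth (S f) 0 = uea_antipode (fps_nth f 0)"
  by (simp_all add: \<Delta>_def S_def F_def F'_def u_def v_def)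

lemma reduces_to_standard: "reduces_to_standard \<Delta> S fps_counit"
proof -
  have coset: "g \<in> t_coset f \<longleftrightarrow> fps_nth g 0 = fps_nth f 0" for f g :: "'r::ring_1 fps"
  proof
    assume "fps_nth g 0 = fps_nth f 0"
    then have "g = f + fps_X * Abs_fps (\<lambda>n. fps_nth (g - f) (Suc n))"
      by (intro fps_ext) simp
    then show "g \<in> t_coset f"
      unfolding t_coset_def by blast
  qed (auto simp: t_coset_def)
  \<comment> \<open>The members of a coset share their constant term, so evaluating any chosen
    representative at t = 0 is well defined.\<close>
  define \<phi> where "\<phi> A = fps_nth (SOME f. f \<in> A) 0" for A :: "'a uea fps set"
  define \<psi> where "\<psi> A = fps_nth (SOME f. f \<in> A) 0" for A :: "'a uea2 fps set"
  have \<phi>: "\<phi> (t_coset f) = fps_nth f 0" for f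
    unfolding \<phi>_def using someI[of "\<lambda>g. g \<in> t_coset f" f] by (simp add: coset)
  have \<psi>: "\<psi> (t_coset f) = fps_nth f 0" for f
    unfolding \<psi>_def using someI[of "\<lambda>g. g \<in> t_coset f" f] by (simp add: coset)
  have bij: "bij_betw \<chi> (range t_coset) UNIV"
    if \<chi>: "\<And>f. \<chi> (t_coset f) = fps_nth f 0" for \<chi> :: "'r::ring_1 fps set \<Rightarrow> 'r"
  proof (rule bij_betwI')
    fix A B :: "'r fps set"
    assume "A \<in> range t_coset" "B \<in> range t_coset"
    then show "\<chi> A = \<chi> B \<longleftrightarrow> A = B"
      by (auto simp: \<chi> coset set_eq_iff)
  next
    fix x :: 'r
    show "\<exists>A\<in>range t_coset. x = \<chi> A"
      by (rule bexI[of _ "t_coset (fps_const x)"]) (simp_all add: \<chi>)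
  qed simp
  have "fps_nth (f \<otimes>\<^sub>t g) 0 = tensor2 (fps_nth f 0) (fps_nth g 0)" for f g :: "'a uea fps"
    by (simp add: fps_conv_nth)
  then show ?thesis
    unfolding reduces_to_standard_def
    by (intro exI[of _ \<phi>] exI[of _ \<psi>])
      (simp add: \<phi> \<psi> bij fps_nth_0_\<Delta> fps_nth_0_S, simp add: fps_conv_nth fps_counit_def)
qed

end

section \<open>The adjoint action\<close>

text \<open>This representation separates the few elements of \<open>U\<close> and \<open>U \<otimes> U\<close> that have to be distinct,
  so that the Poincare-Birkhoff-Witt theorem is not needed.\<close>

definition word_action :: "'a::field_char_0 sv \<Rightarrow> sv_basis word \<Rightarrow> 'a sv" where
  "word_action x w = foldr (\<lambda>b. sv_bracket (Poly_Mapping.single b 1)) (letters w) x"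

definition tensor_algebra_action :: "(sv_basis, 'a::field_char_0) tensor_algebra \<Rightarrow> 'a sv \<Rightarrow> 'a sv" where
  "tensor_algebra_action p x = lin_ext fscale (word_action x) p"

lemma word_action_linear:
  "word_action (x + y) w = word_action x w + word_action y w"
  "word_action (fscale c x) w = fscale c (word_action x w)"
proof -
  have "foldr (\<lambda>b. sv_bracket (Poly_Mapping.single b 1)) l (x + y) =
      foldr (\<lambda>b. sv_bracket (Poly_Mapping.single b 1)) l x + foldr (\<lambda>b. sv_bracket (Poly_Mapping.single b 1)) l y"
    "foldr (\<lambda>b. sv_bracket (Poly_Mapping.single b 1)) l (fscale c x) =
      fscale c (foldr (\<lambda>b. sv_bracket (Poly_Mapping.single b 1)) l x)" for l
    by (induction l) simp_all
  then show "word_action (x + y) w = word_action x w + word_action y w"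
    "word_action (fscale c x) w = fscale c (word_action x w)"
    by (simp_all add: word_action_def)
qed

lemma tensor_algebra_action_add: "tensor_algebra_action (p + q) x = tensor_algebra_action p x + tensor_algebra_action q x"
  and tensor_algebra_action_diff: "tensor_algebra_action (p - q) x = tensor_algebra_action p x - tensor_algebra_action q x"
  and tensor_algebra_action_add_right: "tensor_algebra_action p (x + y) = tensor_algebra_action p x + tensor_algebra_action p y"
  by (simp_all add: tensor_algebra_action_def)
    (simp add: lin_ext_def word_action_linear fscale.scale_right_distrib sum.distrib)

lemma tensor_algebra_action_mult:
  "tensor_algebra_action (p * q) x = tensor_algebra_action p (tensor_algebra_action q x)"
proof (induction p rule: pm_induct)
  case (single v c)
  show ?case
  proof (induction q rule: pm_induct)
    case zero
    show ?case
      using tensor_algebra_action_add_right[of "Poly_Mapping.single v c" 0 0]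
      by (simp add: tensor_algebra_action_def)
  next
    case (single w d)
    show ?case
      by (simp add: tensor_algebra_action_def mult_single word_action_linear)
        (simp add: word_action_def)
  qed (simp add: distrib_left tensor_algebra_action_add tensor_algebra_action_add_right)
qed (simp_all add: distrib_right tensor_algebra_action_add, simp add: tensor_algebra_action_def)

lemma in_tensor_algebra_action: "tensor_algebra_action (in_tensor_algebra x) y = sv_bracket x y"
proof (induction x rule: pm_induct)
  case (single b c)
  have "sv_bracket (Poly_Mapping.single b c) y = fscale c (sv_bracket (Poly_Mapping.single b 1) y)"
    by (simp flip: sv_bracket_scale_left)
  then show ?case
    by (simp add: tensor_algebra_action_def in_tensor_algebra_def word_action_def)
qed (simp_all add: tensor_algebra_action_def in_tensor_algebra_def)

text \<open>A relator acts as [y,[y',z]] - [y',[y,z]] - [[y,y'],z], which vanishes by the Jacobi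
  identity. This lets the adjoint representation descend to U.\<close>

lemma ideal_action: "p \<in> ideal_gen uea_relators \<Longrightarrow> tensor_algebra_action p x = 0"
proof (induction arbitrary: x rule: ideal_gen.induct)
  case (gen r a b)
  have neg: "sv_bracket u (- v) = - sv_bracket u v" for u v :: "'a sv"
    using sv_bracket_add_right[of u v "- v"] by (simp add: eq_neg_iff_add_eq_0 add.commute)
  have "tensor_algebra_action r z = 0" for z
  proof -
    from gen obtain y y' where "r = in_tensor_algebra y * in_tensor_algebra y'
        - in_tensor_algebra y' * in_tensor_algebra y - in_tensor_algebra (sv_bracket y y')"
      by (auto simp: uea_relators_def)
    then have "tensor_algebra_action r z =
        sv_bracket y (sv_bracket y' z) - sv_bracket y' (sv_bracket y z) - sv_bracket (sv_bracket y y') z"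
      by (simp add: tensor_algebra_action_diff tensor_algebra_action_mult in_tensor_algebra_action)
    also have "\<dots> = 0"
      using sv_jacobi[of y y' z] sv_bracket_anti[of z y] sv_bracket_anti[of z "sv_bracket y y'"]
      by (simp add: neg)
    finally show ?thesis .
  qed
  moreover have "tensor_algebra_action a 0 = 0"
    using tensor_algebra_action_add_right[of a 0 0] by simp
  ultimately show ?case
    by (simp add: tensor_algebra_action_mult)
qed (simp_all add: tensor_algebra_action_add, simp add: tensor_algebra_action_def)

lift_definition adjoint_action :: "'a::field_char_0 uea \<Rightarrow> 'a sv \<Rightarrow> 'a sv" is tensor_algebra_action
  unfolding uea_rel_def using ideal_action tensor_algebra_action_diff by (metis eq_iff_diff_eq_0 ext)

lemma adjoint_action_add: "adjoint_action (u + v) x = adjoint_action u x + adjoint_action v x"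
  by transfer (rule tensor_algebra_action_add)

lemma adjoint_action_scale: "adjoint_action (uea_scale c u) x = fscale c (adjoint_action u x)"
  by transfer (simp add: tensor_algebra_action_def)

lemma adjoint_action_gen: "adjoint_action (uea_gen b) x = sv_bracket (Poly_Mapping.single b 1) x"
  unfolding uea_gen_def by transfer (rule in_tensor_algebra_action)

lemma uea_gen_commutator:
  "uea_gen b * uea_gen c - uea_gen c * uea_gen b = uea_of_sv (sv_bracket_basis b c)"
  by (simp add: uea_gen_def uea_of_sv_bracket)

lemma uea_of_sv_single: "uea_of_sv (Poly_Mapping.single b c) = uea_scale c (uea_gen b)"
  unfolding uea_gen_def by (simp flip: uea_of_sv_scale)

lemma uea_of_sv_uminus: "uea_of_sv (- x) = - uea_of_sv x" and uea_of_sv_zero: "uea_of_sv 0 = 0"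
  using additive_sum[of uea_of_sv, OF uea_of_sv_add] by blast+

text \<open>The general formula has the structure constant in the second tensor factor, inside the
  commutator with e, while the stated formulas attach it to h in the first.\<close>

lemma scaled_tensor_fps:
  "fps_const (uea_scale c x) \<otimes>\<^sub>t (p * fps_const y * q) = fps_const x \<otimes>\<^sub>t (p * fps_const (uea_scale c y) * q)"
proof -
  have "p * fps_const (uea_scale c y) * q = scalar_series uea_scale (fps_const c) * (p * fps_const y * q)"
    by (simp only: fps_const_uea_scale mult.assoc[symmetric] uea_alg.scalar_series_commute[of p])
  then have "fps_const x \<otimes>\<^sub>t (p * fps_const (uea_scale c y) * q) = fps_const (tensor2 x 1 * tensor2 1 (uea_scale c 1))
      * fps_map (tensor2 1) (p * fps_const y * q)"
    by (simp add: const_tensor_fps tensor_right.fps_map_mult uea_alg.scalar_series_const fps_map_const mult.assoc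
      flip: fps_const_mult)
  then show ?thesis
    by (simp add: const_tensor_fps tensor2_mult tensor2_bilinear uea_power_scale_mult_right)
qed

lemma const_tensor_fps_additive:
  "fps_const x \<otimes>\<^sub>t (- g) = - (fps_const x \<otimes>\<^sub>t g)" "fps_const x \<otimes>\<^sub>t 0 = 0"
  by (rule fps_ext, simp add: const_tensor_fps tensor_right.additive)+

lemma tensor_flip_tensor2: "tensor_flip (tensor2 x y) = tensor2 y x"
proof -
  have "uea_bilinear uea_power_scale (\<lambda>x y :: 'a uea. tensor2 y x)"
    by unfold_locales (simp_all add: tensor2_bilinear)
  then show ?thesis
    unfolding tensor_flip_def by (rule uea_bilinear.tensor_lift_tensor2)
qed

lemma comult_gen:
  "uea_comult (gen_L n) = tensor2 (gen_L n) 1 + tensor2 1 (gen_L n)"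
  "uea_comult (gen_Y q) = tensor2 (gen_Y q) 1 + tensor2 1 (gen_Y q)"
  "uea_comult (gen_M n) = tensor2 (gen_M n) 1 + tensor2 1 (gen_M n)"
  by (simp_all add: gen_L_def gen_Y_def gen_M_def uea_gen_simps)

lemma antipode_gen:
  "uea_antipode (gen_L n) = - gen_L n" "uea_antipode (gen_Y q) = - gen_Y q" "uea_antipode (gen_M n) = - gen_M n"
  by (simp_all add: gen_L_def gen_Y_def gen_M_def uea_gen_simps)

lemma weight_scale:
  assumes "h * y - y * h = uea_scale w y"
  shows "h * uea_scale c y - uea_scale c y * h = uea_scale w (uea_scale c y)"
  by (simp only: uea_scale_mult_left uea_scale_mult_right uea.scale_right_diff_distrib[symmetric]
    assms uea.scale_scale mult.commute)

theorem theorem2: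
  fixes n\<^sub>0 :: int and h e :: "'a::field_char_0 uea"
  assumes "odd n\<^sub>0"
    and "h = uea_scale (2 / of_int n\<^sub>0) (gen_L 0)"
    and "e = gen_Y n\<^sub>0"
  shows "h * e - e * h = e \<and>
    (\<exists>(\<Delta> :: 'a uea fps \<Rightarrow> 'a uea2 fps) (S :: 'a uea fps \<Rightarrow> 'a uea fps).
      topological_hopf_algebra \<Delta> S fps_counit \<and>
      (\<exists>f g :: 'a uea fps. f * g \<noteq> g * f) \<and>
      noncocommutative \<Delta> \<and>
      reduces_to_standard \<Delta> S fps_counit \<and>
      (\<forall>n. \<Delta> (fps_const (gen_L n)) =
         1 \<otimes>\<^sub>t fps_const (gen_L n)
         + fps_const (gen_L n) \<otimes>\<^sub>t one_minus_et_powr e (of_int (2 * n) / of_int n\<^sub>0)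
         + fps_const (uea_scale (of_int (n\<^sub>0 - n) / 2) h)
             \<otimes>\<^sub>t (one_minus_et_powr e (- 1) * fps_const (gen_Y (2 * n + n\<^sub>0)) * fps_X)
         + fps_const (uea_scale (of_int (n * (n - n\<^sub>0)) / 4) (rising h 0 2))
             \<otimes>\<^sub>t (one_minus_et_powr e (- 2) * fps_const (gen_M (n + n\<^sub>0)) * fps_X ^ 2)) \<and>
      (\<forall>k. \<Delta> (fps_const (gen_M k)) =
         1 \<otimes>\<^sub>t fps_const (gen_M k)
         + fps_const (gen_M k) \<otimes>\<^sub>t one_minus_et_powr e (of_int (2 * k) / of_int n\<^sub>0)) \<and>
      (\<forall>q. odd q \<longrightarrow> (let p = of_int q / 2 :: 'a in
         \<Delta> (fps_const (gen_Y q)) =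
         1 \<otimes>\<^sub>t fps_const (gen_Y q)
         + fps_const (gen_Y q) \<otimes>\<^sub>t one_minus_et_powr e (2 * p / of_int n\<^sub>0)
         - fps_const (uea_scale (p - of_int n\<^sub>0 / 2) h)
             \<otimes>\<^sub>t (one_minus_et_powr e (- 1) * fps_const (gen_M ((q + n\<^sub>0) div 2)) * fps_X))) \<and>
      (\<forall>n. S (fps_const (gen_L n)) =
         - (one_minus_et_powr e (- (of_int (2 * n) / of_int n\<^sub>0)) *
            (fps_const (gen_L n)
             + fps_const (uea_scale (of_int (n - n\<^sub>0) / 2) (gen_Y (2 * n + n\<^sub>0) * falling h 1 1)) * fps_X
             + fps_const (uea_scale (of_int (n * (n - n\<^sub>0)) / 4) (gen_M (n + n\<^sub>0) * falling h 2 2))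
                 * fps_X ^ 2))) \<and>
      (\<forall>q. odd q \<longrightarrow> (let p = of_int q / 2 :: 'a in
         S (fps_const (gen_Y q)) =
         - (one_minus_et_powr e (- (2 * p / of_int n\<^sub>0)) *
            (fps_const (gen_Y q)
             + fps_const (uea_scale (p - of_int n\<^sub>0 / 2)
                 (gen_M ((q + n\<^sub>0) div 2) * falling h 1 1)) * fps_X)))) \<and>
      (\<forall>k. S (fps_const (gen_M k)) =
         - (one_minus_et_powr e (- (of_int (2 * k) / of_int n\<^sub>0)) * fps_const (gen_M k))))"
proof -
  obtain m where m: "n\<^sub>0 = 2 * m + 1"
    using \<open>odd n\<^sub>0\<close> by (rule oddE)
  define N :: 'a where "N = of_int n\<^sub>0"
  have N: "N \<noteq> 0"
    using \<open>odd n\<^sub>0\<close> by (auto simp: N_def)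
  have N_m: "N = 2 * of_int m + 1"
    by (simp add: N_def m)
  have e: "e = uea_gen (SV_Y m)"
    by (simp add: assms(3) gen_Y_def m)
  have h: "h = uea_scale (2 / N) (uea_gen (SV_L 0))"
    by (simp add: assms(2) gen_L_def N_def)
  have h_gen: "h * uea_gen b - uea_gen b * h = uea_scale (2 / N) (uea_of_sv (sv_bracket_basis (SV_L 0) b))" for b
    unfolding h uea_scale_mult_left uea_scale_mult_right
    by (simp add: uea_gen_commutator flip: uea.scale_right_diff_distrib)
  have hL: "h * gen_L n - gen_L n * h = uea_scale (of_int (2 * n) / N) (gen_L n)" for n
    unfolding gen_L_def h_gen by (simp add: uea_of_sv_single)
  have hM: "h * gen_M n - gen_M n * h = uea_scale (of_int (2 * n) / N) (gen_M n)" for n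
    unfolding gen_M_def h_gen by (simp add: uea_of_sv_single)
  have hY: "h * gen_Y q - gen_Y q * h = uea_scale (of_int q / N) (gen_Y q)" if q: "odd q" for q
  proof -
    obtain j where j: "q = 2 * j + 1"
      using q by (rule oddE)
    have "uea_of_sv (sv_bracket_basis (SV_L 0) (SV_Y j)) = (uea_scale (of_int q / 2) (uea_gen (SV_Y j)) :: 'a uea)"
      by (simp add: uea_of_sv_single j add_divide_distrib)
    moreover have "(q - 1) div 2 = j"
      by (simp add: j)
    ultimately show ?thesis
      unfolding gen_Y_def h_gen by simp
  qed
  have eL: "e * gen_L n - gen_L n * e = uea_scale (of_int (n - n\<^sub>0) / 2) (gen_Y (2 * n + n\<^sub>0))" for n
  proof -
    have "(2 * n + n\<^sub>0 - 1) div 2 = n + m"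
      by (simp add: m)
    then show ?thesis
      unfolding e gen_L_def gen_Y_def uea_gen_commutator
      by (simp add: uea_of_sv_uminus uea_of_sv_single m diff_divide_distrib add_divide_distrib
        flip: uea.scale_minus_left)
  qed
  have eY: "e * gen_Y q - gen_Y q * e = uea_scale (of_int q / 2 - N / 2) (gen_M ((q + n\<^sub>0) div 2))"
    if q: "odd q" for q
  proof -
    obtain j where j: "q = 2 * j + 1"
      using q by (rule oddE)
    then have "(q + n\<^sub>0) div 2 = m + j + 1"
      by (simp add: m)
    then show ?thesis
      unfolding e gen_Y_def gen_M_def uea_gen_commutator
      by (simp add: uea_of_sv_single j N_m add_divide_distrib)
  qed
  have eM: "e * gen_M k = gen_M k * e" for k
    using uea_gen_commutator[of "SV_Y m" "SV_M k"] by (simp add: e gen_M_def uea_of_sv_zero)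
  have he: "h * e - e * h = e"
    using hY[OF \<open>odd n\<^sub>0\<close>] N by (simp add: assms(3) N_def)
  interpret twisting_pair h e
  proof
    show "h * e = e * h + e"
      using he by (rule commutator_rule)
  qed (simp_all add: h e uea_gen_simps comult.scale uea_antipode_scale tensor2_bilinear
      uea_power.scale_right_distrib)

  have \<Delta>_L: "\<Delta> (fps_const (gen_L n)) =
         1 \<otimes>\<^sub>t fps_const (gen_L n)
         + fps_const (gen_L n) \<otimes>\<^sub>t one_minus_et_powr e (of_int (2 * n) / of_int n\<^sub>0)
         + fps_const (uea_scale (of_int (n\<^sub>0 - n) / 2) h)
             \<otimes>\<^sub>t (one_minus_et_powr e (- 1) * fps_const (gen_Y (2 * n + n\<^sub>0)) * fps_X)
         + fps_const (uea_scale (of_int (n * (n - n\<^sub>0)) / 4) (rising h 0 2))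
             \<otimes>\<^sub>t (one_minus_et_powr e (- 2) * fps_const (gen_M (n + n\<^sub>0)) * fps_X ^ 2)" (is ?\<Delta>L)
    and S_L: "S (fps_const (gen_L n)) =
         - (one_minus_et_powr e (- (of_int (2 * n) / of_int n\<^sub>0)) *
            (fps_const (gen_L n)
             + fps_const (uea_scale (of_int (n - n\<^sub>0) / 2) (gen_Y (2 * n + n\<^sub>0) * falling h 1 1)) * fps_X
             + fps_const (uea_scale (of_int (n * (n - n\<^sub>0)) / 4) (gen_M (n + n\<^sub>0) * falling h 2 2))
                 * fps_X ^ 2))" (is ?SL) for n
  proof -
    \<comment> \<open>Here c is the coefficient of [e, L_n]. Bracketing with e again multiplies it
      by n, and d is half of the result, matching the convention for Z in
      \<open>\<Delta>_formula\<close>.\<close>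
    define c :: 'a where "c = of_int (n - n\<^sub>0) / 2"
    define d :: 'a where "d = of_int (n * (n - n\<^sub>0)) / 4"
    let ?Y = "uea_scale c (gen_Y (2 * n + n\<^sub>0))" and ?M = "uea_scale d (gen_M (n + n\<^sub>0))"
    have odd: "odd (2 * n + n\<^sub>0)"
      using \<open>odd n\<^sub>0\<close> by simp
    have 1: "e * gen_L n - gen_L n * e = ?Y"
      by (simp add: eL c_def)
    have "(2 * n + n\<^sub>0 + n\<^sub>0) div 2 = n + n\<^sub>0" by simp
    note eY' = eY[OF odd, unfolded this]
    have "e * ?Y - ?Y * e = uea_scale (c * (of_int (2 * n + n\<^sub>0) / 2 - N / 2)) (gen_M (n + n\<^sub>0))"
      by (simp only: uea_scale_mult_left uea_scale_mult_right eY' uea.scale_scale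
        uea.scale_right_diff_distrib[symmetric])
    also have "c * (of_int (2 * n + n\<^sub>0) / 2 - N / 2) = d + d"
    proof -
      have quarters: "a / 4 + a / 4 = a / 2" for a :: 'a
        by (simp flip: mult_2 add_divide_distrib)
      have "(x - y) / 2 * ((2 * x + y) / 2 - y / 2) = x * (x - y) / 4 + x * (x - y) / 4" for x y :: 'a
        unfolding quarters by (simp add: add_divide_distrib mult.commute)
      then show ?thesis
        by (simp only: c_def d_def N_def of_int_diff of_int_add of_int_mult of_int_numeral)
    qed
    finally have 2: "e * ?Y - ?Y * e = ?M + ?M"
      by (simp only: uea.scale_left_distrib)
    have 3: "e * ?M = ?M * e"
      by (simp add: uea_scale_mult_left uea_scale_mult_right eM)
    have w: "of_int (2 * n) / N + 1 = of_int (2 * n + n\<^sub>0) / N" "of_int (2 * n) / N + 2 = of_int (2 * (n + n\<^sub>0)) / N"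
      using N by (simp_all add: add_divide_distrib flip: N_def)
    have 4: "h * ?Y - ?Y * h = uea_scale (of_int (2 * n) / N + 1) ?Y"
      unfolding w by (rule weight_scale) (rule hY[OF odd])
    have 5: "h * ?M - ?M * h = uea_scale (of_int (2 * n) / N + 2) ?M"
      unfolding w by (rule weight_scale) (rule hM)
    \<comment> \<open>The stated coproduct uses n_0 - n with a plus sign, the general formula n -
      n_0 with a minus sign.\<close>
    have neg: "of_int (n\<^sub>0 - n) / 2 = - c"
      by (simp add: c_def diff_divide_distrib)
    show ?\<Delta>L
      using \<Delta>_formula[OF comult_gen(1) 1 2 3 hL]
      unfolding neg d_def[symmetric] N_def[symmetric] scaled_tensor_fps
      by (simp only: uea.scale_minus_left fps_const_neg[symmetric] mult_minus_left mult_minus_right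
        const_tensor_fps_additive diff_conv_add_uminus)
    show ?SL
      using S_formula[OF antipode_gen(1) 1 2 3 hL 4 5]
      unfolding c_def[symmetric] d_def[symmetric] N_def[symmetric] by (simp only: uea_scale_mult_left)
  qed

  have \<Delta>_M: "\<Delta> (fps_const (gen_M k)) = 1 \<otimes>\<^sub>t fps_const (gen_M k)
      + fps_const (gen_M k) \<otimes>\<^sub>t one_minus_et_powr e (of_int (2 * k) / of_int n\<^sub>0)"
    and S_M: "S (fps_const (gen_M k)) =
      - (one_minus_et_powr e (- (of_int (2 * k) / of_int n\<^sub>0)) * fps_const (gen_M k))" for k
    using \<Delta>_formula[of "gen_M k" 0 0, OF comult_gen(3) _ _ _ hM]
      S_formula[of "gen_M k" 0 0, OF antipode_gen(3) _ _ _ hM]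
    by (simp_all add: eM const_tensor_fps_additive N_def)

  have \<Delta>_Y: "\<Delta> (fps_const (gen_Y q)) = 1 \<otimes>\<^sub>t fps_const (gen_Y q)
         + fps_const (gen_Y q) \<otimes>\<^sub>t one_minus_et_powr e (of_int q / of_int n\<^sub>0)
         - fps_const (uea_scale (of_int q / 2 - of_int n\<^sub>0 / 2) h)
             \<otimes>\<^sub>t (one_minus_et_powr e (- 1) * fps_const (gen_M ((q + n\<^sub>0) div 2)) * fps_X)" (is ?\<Delta>Y)
    and S_Y: "S (fps_const (gen_Y q)) = - (one_minus_et_powr e (- (of_int q / of_int n\<^sub>0)) *
            (fps_const (gen_Y q) + fps_const (uea_scale (of_int q / 2 - of_int n\<^sub>0 / 2)
                 (gen_M ((q + n\<^sub>0) div 2) * falling h 1 1)) * fps_X))" (is ?SY) if "odd q" for q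
  proof -
    define c where "c = of_int q / 2 - N / 2"
    let ?M = "uea_scale c (gen_M ((q + n\<^sub>0) div 2))"
    have 1: "e * gen_Y q - gen_Y q * e = ?M"
      by (simp add: eY[OF that] c_def)
    \<comment> \<open>Already the second commutator vanishes on the Y generators, so there is no t^2
      term.\<close>
    have 2: "e * ?M - ?M * e = 0 + 0"
      by (simp add: uea_scale_mult_left uea_scale_mult_right eM)
    have "2 * ((q + n\<^sub>0) div 2) = q + n\<^sub>0"
      using that \<open>odd n\<^sub>0\<close> by simp
    then have w: "of_int q / N + 1 = of_int (2 * ((q + n\<^sub>0) div 2)) / N"
      using N by (simp add: add_divide_distrib flip: N_def)
    have 3: "h * ?M - ?M * h = uea_scale (of_int q / N + 1) ?M"
      unfolding w by (rule weight_scale) (rule hM)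
    show ?\<Delta>Y
      using \<Delta>_formula[OF comult_gen(2) 1 2 _ hY[OF that]]
      unfolding N_def[symmetric] c_def[symmetric] scaled_tensor_fps
      by (simp add: const_tensor_fps_additive)
    show ?SY
      using S_formula[OF antipode_gen(2) 1 2 _ hY[OF that] 3]
      unfolding N_def[symmetric] c_def[symmetric] by (simp add: uea_scale_mult_left)
  qed

  define Ym where "Ym = (Poly_Mapping.single (SV_Y m) 1 :: 'a sv)"
  define L0 where "L0 = (Poly_Mapping.single (SV_L 0) 1 :: 'a sv)"
  \<comment> \<open>A product of two matrix coefficients of the adjoint representation. The first is
    1 on h and 0 on e, and the second is -n_0/2 on e, so B separates h \<otimes> e from e \<otimes>
    h.\<close>
  define B where "B x y = Poly_Mapping.lookup (adjoint_action x Ym) (SV_Y m)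
    * Poly_Mapping.lookup (adjoint_action y L0) (SV_Y m)" for x y :: "'a uea"
  have action: "Poly_Mapping.lookup (adjoint_action h Ym) (SV_Y m) = 1"
      "Poly_Mapping.lookup (adjoint_action e Ym) (SV_Y m) = 0"
      "Poly_Mapping.lookup (adjoint_action e L0) (SV_Y m) = - (N / 2)"
    using N by (simp_all add: h e adjoint_action_scale adjoint_action_gen Ym_def L0_def lookup_single)
      (simp_all add: N_m add_divide_distrib distrib_left)
  have "e \<noteq> 0"
  proof
    assume "e = 0"
    then have "adjoint_action e L0 = fscale 0 (adjoint_action e L0)"
      by (metis adjoint_action_scale uea.scale_zero_left)
    then show False
      using action(3) N by simp
  qed
  with he have "h * e \<noteq> e * h"
    by auto
  then have noncommutative_algebra: "fps_const h * fps_const e \<noteq> fps_const e * fps_const h"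
    by (metis fps_const_mult fps_nth_fps_const)
  have noncocommutative: "noncocommutative \<Delta>"
  proof -
    \<comment> \<open>The general formula applies to h itself, with weight 0 and [e,h] = -e, which
      commutes with e. Its coefficient at t is h \<otimes> e, the first witness of
      asymmetry.\<close>
    have "\<Delta> (fps_const h) = 1 \<otimes>\<^sub>t fps_const h + fps_const h \<otimes>\<^sub>t one_minus_et_powr e 0
        - fps_const h \<otimes>\<^sub>t (one_minus_et_powr e (- 1) * fps_const (- e) * fps_X)"
      using \<Delta>_formula[of h "- e" 0 0] by (simp add: comult_h bracket const_tensor_fps_additive)
    then have 1: "fps_nth (\<Delta> (fps_const h)) 1 = tensor2 h e"
      by (simp add: one_tensor_fps_const const_tensor_fps one_minus_et_powr_def tensor2_bilinear
        tensor2_mult tensor_right.additive)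
    interpret B: uea_bilinear "(*)" B
      by (intro uea_bilinear.intro field_alg.vector_space_axioms uea_bilinear_axioms.intro)
        (simp_all add: B_def adjoint_action_add adjoint_action_scale lookup_add distrib_left distrib_right)
    have "tensor_lift (*) B (tensor2 h e) \<noteq> tensor_lift (*) B (tensor2 e h)"
      using N by (simp add: B.tensor_lift_tensor2 B_def action)
    then have "tensor_flip (fps_nth (\<Delta> (fps_const h)) 1) \<noteq> fps_nth (\<Delta> (fps_const h)) 1"
      unfolding 1 tensor_flip_tensor2 by metis
    then have "fps_map tensor_flip (\<Delta> (fps_const h)) \<noteq> \<Delta> (fps_const h)"
      by (metis fps_map_nth)
    then show ?thesis
      unfolding noncocommutative_def by blast
  qed
  show ?thesis
  proof (intro conjI exI[of _ \<Delta>] exI[of _ S])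
    show "\<exists>f g :: 'a uea fps. f * g \<noteq> g * f"
      using noncommutative_algebra by blast
  qed (use he topological_hopf_algebra noncocommutative reduces_to_standard \<Delta>_L \<Delta>_M \<Delta>_Y S_L S_Y S_M
      in \<open>simp_all add: Let_def\<close>)
qed

end
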